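(* Let $\varepsilon\in[0,1]\mapsto R_\varepsilon\in SO(3)$ and $\varepsilon\in[0,1]\mapsto m_\varepsilon,M_\varepsilon,a_\varepsilon,e_\varepsilon\in\mathbb{R}$ be $C^\infty$ functions such that for each $\varepsilon>0$ $$m_\varepsilon>0,\quad M_\varepsilon>0,\quad m_\varepsilon+M_\varepsilon=1,\quad a_\varepsilon>0,\quad 0\le e_\varepsilon<1.$$ For $\varepsilon\in\,]0,1]$ let $X_\varepsilon,x_\varepsilon:\mathbb{R}\to\mathbb{R}^3$ be the circular or elliptic solution of the two-body problem with masses $M_\varepsilon,m_\varepsilon$ given by $$X_\varepsilon(t)=R_\varepsilon\bigl(a_\varepsilon(\cos v-e_\varepsilon),\ a_\varepsilon\sqrt{1-e_\varepsilon^2}\,\sin v,\ 0\bigr)^{*},\qquad M_\varepsilon X_\varepsilon(t)+m_\varepsilon x_\varepsilon(t)=0,$$ where $v=v_\varepsilon(t)$ is determined by $$v-e_\varepsilon\sin v=\frac{m_\varepsilon^{3/2}}{a_\varepsilon^{3/2}}\,t,$$ and let $T_\varepsilon=2\pi\, a_\varepsilon^{3/2}/m_\varepsilon^{3/2}$ be its period. Assume in addition that $$m_0=0,\qquad e_0<1,\qquad T_\varepsilon\to T_0>0\ \text{ as }\ \varepsilon\to0^+ .$$ Then, for any given integer $l\ge1$, there exists $\varepsilon_l\in\,]0,1]$ such that for each $\varepsilon\in\,]0,\varepsilon_l[$ the equation $$\ddot\xi=\frac{M_\varepsilon(X_\varepsilon(t)-\xi)}{|X_\varepsilon(t)-\xi|^3}+\frac{m_\varepsilon(x_\varepsilon(t)-\xi)}{|x_\varepsilon(t)-\xi|^3},\qquad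 \xi\in\mathbb{R}^3,$$ has at least $l$ generalized $T_\varepsilon$-periodic solutions of the first kind.
   Context: The superscript $*$ denotes transpose (column vector), $|\cdot|$ is the Euclidean norm on $\mathbb{R}^3$, and $]a,b[$ denotes an open interval. $T_0$ denotes a positive real number, the limit of $T_\varepsilon$. The limiting situation $\varepsilon=0$ corresponds to the primary $X_0$ being fixed at the origin and $x_0$ describing a circular or elliptic Keplerian orbit with mass $m_0=0$. Definition. Fix $\varepsilon\in\,]0,1]$ and write $X=X_\varepsilon$, $x=x_\varepsilon$, $M=M_\varepsilon$, $m=m_\varepsilon$, $T=T_\varepsilon$. A generalized $T$-periodic solution of the first kind of the equation $\ddot\xi=\frac{M(X(t)-\xi)}{|X(t)-\xi|^3}+\frac{m(x(t)-\xi)}{|x(t)-\xi|^3}$ is a continuous $T$-periodic function $\xi:\mathbb{R}\to\mathbb{R}^3$ such that: (i) $\mathcal{Z}_M=\{t\in\mathbb{R}:\xi(t)=X(t)\}$ is discrete; (ii) $\mathcal{Z}_m=\{t\in\mathbb{R}:\xi(t)=x(t)\}$ is empty; (iii) on each interval $I\subset\mathbb{R}\setminus\mathcal{Z}_M$ the function $\xi$ is $C^\infty$ and satisfies the equation; (iv) for each $t_0\in\mathcal{Z}_M$ the (two-sided) limits $$\lim_{t\to t_0}\frac{\xi(t)-X(t)}{|\xi(t)-X(t)|},\qquad \lim_{t\to t_0}\Bigl\{\frac12|\dot\xi(t)-\dot X(t)|^2-\frac{M}{|\xi(t)-X(t)|}\Bigr\}$$ exist. *)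

theory Defs
  imports "HOL-Analysis.Analysis"
begin

text \<open>
  \<open>C\<^sup>\<infinity>\<close> on an arbitrary interval: \<open>D n\<close> is the \<open>n\<close>-th derivative. Derivatives are taken
  within \<open>S\<close>, so they are one-sided at those endpoints that belong to \<open>S\<close> and two-sided
  elsewhere.
\<close>

definition smooth_on :: "real set \<Rightarrow> (real \<Rightarrow> 'a::real_normed_vector) \<Rightarrow> bool" where
  "smooth_on S f \<longleftrightarrow>
     (\<exists>D. D 0 = f \<and>
       (\<forall>n. \<forall>t\<in>S. (D n has_vector_derivative D (Suc n) t) (at t within S)))"

text \<open>Acceleration at \<open>q\<close> due to masses \<open>M\<close> at \<open>P\<close> and \<open>m\<close> at \<open>p\<close>.\<close>

definition force :: "real \<Rightarrow> real \<Rightarrow> real^3 \<Rightarrow> real^3 \<Rightarrow> real^3 \<Rightarrow> real^3" where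
  "force M m P p q =
     (M / norm (P - q) ^ 3) *\<^sub>R (P - q) + (m / norm (p - q) ^ 3) *\<^sub>R (p - q)"

text \<open>
  Solutions of the first kind: only collisions with the primary \<open>X\<close> of mass \<open>M\<close> are allowed.
  The complement of \<open>Z\<close> is open, since \<open>X\<close> is continuous for the orbits considered, so every
  \<open>t\<in>I\<close> lies in an open interval on which \<open>\<xi>\<close> is smooth and \<open>vel (vel \<xi>) t\<close> is the genuine
  two-sided second derivative, also at endpoints of \<open>I\<close> and for degenerate \<open>I\<close>.
  Since \<open>Z\<close> is discrete, the filter \<open>at t0\<close> only sees times at which \<open>\<xi> t \<noteq> X t\<close>.
\<close>

definition generalized_periodic_solution ::
  "real \<Rightarrow> real \<Rightarrow> (real \<Rightarrow> real^3) \<Rightarrow> (real \<Rightarrow> real^3) \<Rightarrow> real \<Rightarrow> (real \<Rightarrow> real^3) \<Rightarrow> bool" where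
  "generalized_periodic_solution M m X x T \<xi> \<longleftrightarrow>
     (let Z = {t. \<xi> t = X t};
          vel = (\<lambda>f t. vector_derivative f (at t)) in
      continuous_on UNIV \<xi> \<and>
      (\<forall>t. \<xi> (t + T) = \<xi> t) \<and>
      discrete Z \<and>
      {t. \<xi> t = x t} = {} \<and>
      (\<forall>I. is_interval I \<and> I \<subseteq> - Z \<longrightarrow>
         smooth_on I \<xi> \<and>
         (\<forall>t\<in>I. vel (vel \<xi>) t = force M m (X t) (x t) (\<xi> t))) \<and>
      (\<forall>t0\<in>Z.
         (\<exists>u. ((\<lambda>t. (1 / norm (\<xi> t - X t)) *\<^sub>R (\<xi> t - X t)) \<longlongrightarrow> u) (at t0)) \<and>
         (\<exists>h. ((\<lambda>t. (1/2) * (norm (vel \<xi> t - vel X t))\<^sup>2 - M / norm (\<xi> t - X t)) \<longlongrightarrow> h)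
            (at t0))))"

end

theory Submission
  imports Defs
begin

text \<open>
  Put \<open>q = \<xi> - X\<close> and scale time and length so that the relative orbit of the primaries has
  period \<open>2\<pi>\<close> and semi-major axis \<open>1\<close>. Then \<open>q\<close> solves the Kepler problem of mass \<open>1 - m\<close> perturbed by
  \<open>m F\<close>, where \<open>F\<close> is the tidal force of the secondary. For every large \<open>k\<close> there is a solution of small
  eccentricity, hence free of collisions, that makes \<open>k\<close> turns about the primary per period.

  With the polar angle as independent variable, the logarithm of the angular momentum and the
  eccentricity vector \<open>(A, B)\<close> have derivatives of order \<open>m\<close>, and the time is a quadrature of these
  three functions; fixing its total to \<open>2\<pi>\<close> determines the scale of the angular momentum. Among the
  curves invariant under time reversal combined with reflection in the line of apsides,
  periodicity amounts to one scalar equation: the mean of \<open>B'\<close> vanishes. The equation with that mean subtracted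
  is solved by contraction for every initial eccentricity \<open>A(0) = s \<in> [-1/4, 1/4]\<close>. For large \<open>k\<close> the
  quadrupole term of \<open>F\<close> dominates, and averaging it over both motions shows that at \<open>s = \<plusminus>1/4\<close>
  the subtracted mean has the sign of \<open>s\<close>, so it vanishes for some \<open>s\<close>. Orbits with different \<open>k\<close> have
  different sizes.
\<close>

section \<open>Antiderivatives\<close>

text \<open>At \<open>m = 0\<close> every Kepler ellipse that closes after \<open>k\<close> turns is
  a solution, whatever its eccentricity and the direction of its axis, so continuation from
  \<open>m = 0\<close> by implicit functions is degenerate. The reversal symmetry fixes the axis and
  the starting point; the eccentricity stays free and becomes the unknown \<open>s\<close> of the
  scalar equation. Intermediate values suit this equation because a change of sign survives small
  errors, so that no derivative at a zero has to be controlled.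

  After scaling, \<open>\<epsilon>\<close> enters only through the eccentricity \<open>e\<close> and
  the mass \<open>m\<close>. Hence all estimates are made uniform in
  \<open>0 \<le> e \<le> e1 < 1\<close> and in small \<open>m\<close>. The order of choices matters:
  first \<open>k\<close>, so large that the quadrupole outweighs both the higher terms of the force
  and the error of averaging; then \<open>m\<close>, small in terms of \<open>k\<close>, because the
  constants of the contraction depend on \<open>k\<close>. For \<open>l\<close> solutions,
  \<open>l\<close> values of \<open>k\<close> are fixed and the smallest of their bounds on
  \<open>m\<close> is taken.\<close>

text \<open>
  For every \<open>x\<close> at most one of the two integrals is nonzero, since \<open>{a..b}\<close> is empty for \<open>b < a\<close>.
\<close>

definition prim :: "(real \<Rightarrow> real) \<Rightarrow> real \<Rightarrow> real" where
  "prim f x = integral {0..x} f - integral {x..0} f"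

lemma prim_0 [simp]: "prim f 0 = 0"
  by (simp add: prim_def)

text \<open>Near \<open>x\<close>, \<open>prim f\<close> differs by a constant from the integral
  with fixed lower limit \<open>-N\<close>; the choice of \<open>N\<close> puts both
  \<open>0\<close> and \<open>x\<close> inside the interval.\<close>

lemma has_derivative_prim:
  assumes "continuous_on UNIV f"
  shows "(prim f has_real_derivative f x) (at x)"
proof -
  define N where "N = \<bar>x\<bar> + 1"
  have cont: "continuous_on S f" for S
    using assms continuous_on_subset by blast
  have "((\<lambda>u. integral {-N..u} f) has_real_derivative f x) (at x within {-N..N})"
    by (rule integral_has_real_derivative) (auto simp: N_def cont)
  hence "((\<lambda>u. integral {-N..u} f) has_real_derivative f x) (at x within {-N<..<N})"
    by (rule DERIV_subset) auto
  hence "((\<lambda>u. integral {-N..u} f) has_real_derivative f x) (at x)"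
    by (subst (asm) at_within_open) (auto simp: N_def)
  hence "((\<lambda>u. integral {-N..u} f - integral {-N..0} f) has_real_derivative f x) (at x)"
    using DERIV_diff[OF _ DERIV_const] by fastforce
  moreover have "integral {-N..u} f - integral {-N..0} f = prim f u" if "u \<in> {-N<..<N}" for u
  proof (cases "u \<ge> 0")
    case True
    have "integral {-N..0} f + integral {0..u} f = integral {-N..u} f"
      by (rule Henstock_Kurzweil_Integration.integral_combine)
        (use True cont in \<open>auto simp: N_def intro!: integrable_continuous_real\<close>)
    moreover have "integral {u..0} f = 0"
      using True by (cases "u = 0") auto
    ultimately show ?thesis by (simp add: prim_def)
  next
    case False
    have "integral {-N..u} f + integral {u..0} f = integral {-N..0} f"
      by (rule Henstock_Kurzweil_Integration.integral_combine)
        (use False that cont in \<open>auto simp: N_def intro!: integrable_continuous_real\<close>)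
    thus ?thesis using False by (simp add: prim_def)
  qed
  ultimately show ?thesis
    by (elim has_field_derivative_transform_within_open[where S = "{-N<..<N}"]) (auto simp: N_def)
qed

lemma prim_unique:
  assumes "\<And>x. (F has_real_derivative f x) (at x)" "continuous_on UNIV f"
  shows "prim f x = F x - F 0"
proof -
  have "\<forall>y. ((\<lambda>x. prim f x - F x) has_real_derivative 0) (at y)"
    using DERIV_diff[OF has_derivative_prim[OF assms(2)] assms(1)] by simp
  from DERIV_isconst_all[OF this, of x 0] show ?thesis by simp
qed

lemma continuous_on_prim [continuous_intros]:
  assumes "continuous_on UNIV f"
  shows "continuous_on S (prim f)"
  using has_derivative_prim[OF assms]
  by (meson DERIV_isCont continuous_at_imp_continuous_on)

lemma prim_add_period:
  assumes cont: "continuous_on UNIV f" and per: "\<And>x. f (x + p) = f x"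
  shows "prim f (x + p) = prim f x + prim f p"
proof -
  have "((\<lambda>x. prim f (x + p)) has_real_derivative f x) (at x)" for x
    using DERIV_chain2[OF has_derivative_prim[OF cont] DERIV_add[OF DERIV_ident DERIV_const[of p]]] per by simp
  from prim_unique[OF this cont, of x] show ?thesis by simp
qed

lemma prim_uminus_even:
  assumes cont: "continuous_on UNIV f" and ev: "\<And>x. f (- x) = f x"
  shows "prim f (- x) = - prim f x"
proof -
  have "((\<lambda>x. - prim f (- x)) has_real_derivative f x) (at x)" for x
    using DERIV_minus[OF DERIV_chain2[OF has_derivative_prim[OF cont] DERIV_minus[OF DERIV_ident]]] ev
    by simp
  from prim_unique[OF this cont, of x] show ?thesis by simp
qed

lemma prim_uminus_odd:
  assumes cont: "continuous_on UNIV f" and odd: "\<And>x. f (- x) = - f x"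
  shows "prim f (- x) = prim f x"
proof -
  have "((\<lambda>x. prim f (- x)) has_real_derivative f x) (at x)" for x
    using DERIV_chain2[OF has_derivative_prim[OF cont] DERIV_minus[OF DERIV_ident]] odd by simp
  from prim_unique[OF this cont, of x] show ?thesis by simp
qed

text \<open>The antiderivative of an odd function is even, so its values at \<open>-p/2\<close> and
  \<open>p/2\<close> agree. The increment over a period does not depend on the starting point and is
  therefore zero.\<close>

lemma prim_odd_period:
  assumes cont: "continuous_on UNIV f" and odd: "\<And>x. f (- x) = - f x"
    and per: "\<And>x. f (x + p) = f x"
  shows "prim f (x + p) = prim f x"
  using prim_add_period[OF cont per, of x] prim_add_period[OF cont per, of "- p/2"]
    prim_uminus_odd[OF cont odd, of "p/2"] by simp

lemma prim_mono:
  assumes "continuous_on UNIV f" "continuous_on UNIV g" "x \<ge> 0"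
    and "\<And>y. 0 \<le> y \<Longrightarrow> y \<le> x \<Longrightarrow> f y \<le> g y"
  shows "prim f x \<le> prim g x"
proof -
  have "prim g 0 - prim f 0 \<le> prim g x - prim f x"
  proof (rule DERIV_nonneg_imp_nondecreasing[OF assms(3)])
    fix y assume "0 \<le> y" "y \<le> x"
    thus "\<exists>z. ((\<lambda>x. prim g x - prim f x) has_real_derivative z) (at y) \<and> 0 \<le> z"
      using DERIV_diff[OF has_derivative_prim[OF assms(2)] has_derivative_prim[OF assms(1)]] assms(4)
      by (metis diff_ge_0_iff_ge)
  qed
  thus ?thesis by simp
qed

lemma prim_const: "prim (\<lambda>x. b) x = b * x"
  using prim_unique[of "\<lambda>x. b * x" "\<lambda>x. b"] by (auto intro!: derivative_eq_intros)

lemma prim_cmult: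
  assumes "continuous_on UNIV f"
  shows "prim (\<lambda>x. b * f x) x = b * prim f x"
  using prim_unique[OF DERIV_cmult[OF has_derivative_prim[OF assms]] continuous_on_mult_left[OF assms]]
  by simp

lemma prim_add:
  assumes "continuous_on UNIV f" "continuous_on UNIV g"
  shows "prim (\<lambda>x. f x + g x) x = prim f x + prim g x"
  using prim_unique[OF DERIV_add[OF has_derivative_prim[OF assms(1)] has_derivative_prim[OF assms(2)]]
      continuous_on_add[OF assms]] by simp

lemma prim_diff:
  assumes "continuous_on UNIV f" "continuous_on UNIV g"
  shows "prim (\<lambda>x. f x - g x) x = prim f x - prim g x"
  using prim_unique[OF DERIV_diff[OF has_derivative_prim[OF assms(1)] has_derivative_prim[OF assms(2)]]
      continuous_on_diff[OF assms]] by simp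

lemma abs_prim_le:
  assumes "continuous_on UNIV f" "x \<ge> 0" and le: "\<And>y. 0 \<le> y \<Longrightarrow> y \<le> x \<Longrightarrow> \<bar>f y\<bar> \<le> b"
  shows "\<bar>prim f x\<bar> \<le> b * x"
proof -
  have "prim f x \<le> prim (\<lambda>x. b) x" "prim (\<lambda>x. - b) x \<le> prim f x"
    by (rule prim_mono; use assms in \<open>force simp: abs_le_iff\<close>)+
  thus ?thesis by (simp add: prim_const abs_le_iff)
qed

lemma abs_prim_diff_le:
  assumes "continuous_on UNIV f" "continuous_on UNIV g" "x \<ge> 0"
    and "\<And>y. 0 \<le> y \<Longrightarrow> y \<le> x \<Longrightarrow> \<bar>f y - g y\<bar> \<le> b"
  shows "\<bar>prim f x - prim g x\<bar> \<le> b * x"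
  using abs_prim_le[of "\<lambda>x. f x - g x" x b] assms by (simp add: prim_diff continuous_intros)

lemma strict_mono_DERIV_pos:
  fixes f :: "real \<Rightarrow> real"
  assumes "\<And>x. (f has_real_derivative f' x) (at x)" "\<And>x. f' x > 0"
  shows "strict_mono f"
  using DERIV_pos_imp_increasing assms by (metis strict_monoI)

text \<open>Injectivity of \<open>f\<close> makes the right inverse two-sided, which yields the
  continuity of \<open>g\<close> that the inverse function rule asks for. It serves both the
  eccentric anomaly and the polar angle as functions of time.\<close>

lemma has_derivative_right_inverse:
  fixes f g :: "real \<Rightarrow> real"
  assumes der: "\<And>x. (f has_real_derivative f' x) (at x)" and pos: "\<And>x. f' x > 0"
    and inv: "\<And>t. f (g t) = t"
  shows "(g has_real_derivative inverse (f' (g t))) (at t)"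
proof -
  have sm: "strict_mono f" using strict_mono_DERIV_pos[OF der pos] .
  have gf: "g (f x) = x" for x
    using inv[of "f x"] strict_mono_eq[OF sm] by simp
  have "isCont g (f (g t))"
    by (rule isCont_inverse_function[where d = 1 and x = "g t"]) (use gf DERIV_isCont[OF der] in auto)
  hence "isCont g t" by (simp add: inv)
  from DERIV_inverse_function[OF der _ _ _ _ this, of "t - 1" "t + 1"] inv pos[of "g t"]
  show ?thesis by simp
qed

section \<open>Bounded Lipschitz families of functionals\<close>

text \<open>
  The index \<open>i\<close> carries the parameters (eccentricity, mass, angle) in which all bounds must be uniform.
\<close>

definition BL_bound :: "real \<Rightarrow> 'i set \<Rightarrow> 'w::metric_space set \<Rightarrow> ('i \<Rightarrow> 'w \<Rightarrow> real) \<Rightarrow> bool" where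
  "BL_bound C I S F \<longleftrightarrow> (\<forall>i\<in>I. \<forall>w\<in>S. \<bar>F i w\<bar> \<le> C \<and> (\<forall>w'\<in>S. \<bar>F i w - F i w'\<bar> \<le> C * dist w w'))"

definition BL :: "'i set \<Rightarrow> 'w::metric_space set \<Rightarrow> ('i \<Rightarrow> 'w \<Rightarrow> real) \<Rightarrow> bool" where
  "BL I S F \<longleftrightarrow> (\<exists>C\<ge>0. BL_bound C I S F)"

lemma BL_boundD:
  assumes "BL_bound C I S F" "i \<in> I" "w \<in> S"
  shows "\<bar>F i w\<bar> \<le> C" "w' \<in> S \<Longrightarrow> \<bar>F i w - F i w'\<bar> \<le> C * dist w w'"
  using assms unfolding BL_bound_def by blast+

lemma BLI:
  assumes "\<And>i w. i \<in> I \<Longrightarrow> w \<in> S \<Longrightarrow> \<bar>F i w\<bar> \<le> B"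
    and "\<And>i w w'. i \<in> I \<Longrightarrow> w \<in> S \<Longrightarrow> w' \<in> S \<Longrightarrow> \<bar>F i w - F i w'\<bar> \<le> C * dist w w'"
  shows "BL I S F"
  unfolding BL_def BL_bound_def
proof (intro exI[of _ "\<bar>B\<bar> + \<bar>C\<bar>"] conjI ballI)
  fix i w assume *: "i \<in> I" "w \<in> S"
  show "\<bar>F i w\<bar> \<le> \<bar>B\<bar> + \<bar>C\<bar>" using assms(1)[OF *] by linarith
  fix w' assume "w' \<in> S"
  hence "\<bar>F i w - F i w'\<bar> \<le> C * dist w w'" using * assms(2) by blast
  also have "\<dots> \<le> (\<bar>B\<bar> + \<bar>C\<bar>) * dist w w'" by (rule mult_right_mono) auto
  finally show "\<bar>F i w - F i w'\<bar> \<le> (\<bar>B\<bar> + \<bar>C\<bar>) * dist w w'" .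
qed auto

lemma BLE:
  assumes "BL I S F"
  obtains C where "C \<ge> 0" "BL_bound C I S F"
  using assms unfolding BL_def by blast

lemma BL_const:
  assumes "\<And>i. i \<in> I \<Longrightarrow> \<bar>f i\<bar> \<le> C"
  shows "BL I S (\<lambda>i w. f i)"
  by (rule BLI[where B = C and C = 0]) (use assms in auto)

lemma BL_add:
  assumes "BL I S F" "BL I S G"
  shows "BL I S (\<lambda>i w. F i w + G i w)"
proof -
  obtain C D where C: "BL_bound C I S F" and D: "BL_bound D I S G"
    using assms unfolding BL_def by blast
  show ?thesis
  proof (rule BLI)
    fix i w assume iw: "i \<in> I" "w \<in> S"
    show "\<bar>F i w + G i w\<bar> \<le> C + D"
      using BL_boundD(1)[OF C iw] BL_boundD(1)[OF D iw] by linarith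
    fix w' assume "w' \<in> S"
    from BL_boundD(2)[OF C iw this] BL_boundD(2)[OF D iw this]
    show "\<bar>F i w + G i w - (F i w' + G i w')\<bar> \<le> (C + D) * dist w w'"
      unfolding distrib_right by linarith
  qed
qed

lemma BL_mult:
  assumes "BL I S F" "BL I S G"
  shows "BL I S (\<lambda>i w. F i w * G i w)"
proof -
  obtain C D where CD: "C \<ge> 0" "D \<ge> 0" and F: "BL_bound C I S F" and G: "BL_bound D I S G"
    using assms unfolding BL_def by blast
  note F = CD BL_boundD[OF F] and G = BL_boundD[OF G]
  show ?thesis
  proof (rule BLI)
    fix i w assume i: "i \<in> I" and w: "w \<in> S"
    show "\<bar>F i w * G i w\<bar> \<le> C * D"
      unfolding abs_mult by (rule mult_mono) (use F G i w in auto)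
    fix w' assume w': "w' \<in> S"
    have "\<bar>F i w * G i w - F i w' * G i w'\<bar> = \<bar>F i w * (G i w - G i w') + (F i w - F i w') * G i w'\<bar>"
      by (simp add: algebra_simps)
    also have "\<dots> \<le> \<bar>F i w\<bar> * \<bar>G i w - G i w'\<bar> + \<bar>F i w - F i w'\<bar> * \<bar>G i w'\<bar>"
      by (simp flip: abs_mult)
    also have "\<dots> \<le> C * (D * dist w w') + (C * dist w w') * D"
      by (intro add_mono mult_mono) (use F G i w w' in auto)
    also have "\<dots> = (2 * C * D) * dist w w'" by (simp add: algebra_simps)
    finally show "\<bar>F i w * G i w - F i w' * G i w'\<bar> \<le> (2 * C * D) * dist w w'" .
  qed
qed

lemma BL_cmult: "BL I S F \<Longrightarrow> BL I S (\<lambda>i w. c * F i w)"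
  by (rule BL_mult[OF BL_const[where C = "\<bar>c\<bar>"]]) auto

lemma BL_uminus: "BL I S F \<Longrightarrow> BL I S (\<lambda>i w. - F i w)"
  using BL_cmult[of I S F "-1"] by simp

lemma BL_diff: "BL I S F \<Longrightarrow> BL I S G \<Longrightarrow> BL I S (\<lambda>i w. F i w - G i w)"
  using BL_add[OF _ BL_uminus, of I S F G] by simp

lemma BL_power: "BL I S F \<Longrightarrow> BL I S (\<lambda>i w. F i w ^ n)"
proof (induction n)
  case 0
  show ?case by (simp add: BL_const[where C = 1])
next
  case (Suc n)
  thus ?case by (simp add: BL_mult)
qed

lemma BL_index: "BL I S F \<Longrightarrow> (\<And>i. i \<in> J \<Longrightarrow> \<sigma> i \<in> I) \<Longrightarrow> BL J S (\<lambda>i w. F (\<sigma> i) w)"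
  unfolding BL_def BL_bound_def by blast

text \<open>The outer function may depend on the index, as the Kepler motion does on the
  eccentricity; compactness in \<open>x\<close> alone would not give uniform bounds, so they are
  hypotheses.\<close>

lemma BL_compose_local:
  assumes F: "BL I S F"
    and der: "\<And>i x. i \<in> I \<Longrightarrow> x \<in> {a..b} \<Longrightarrow> (f i has_real_derivative f' i x) (at x)"
    and bnd: "\<And>i x. i \<in> I \<Longrightarrow> x \<in> {a..b} \<Longrightarrow> \<bar>f i x\<bar> \<le> K \<and> \<bar>f' i x\<bar> \<le> L"
    and rng: "\<And>i w. i \<in> I \<Longrightarrow> w \<in> S \<Longrightarrow> F i w \<in> {a..b}"
  shows "BL I S (\<lambda>i w. f i (F i w))"
proof -
  obtain C where "C \<ge> 0" "BL_bound C I S F" using BLE[OF F] .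
  note C = this(1) BL_boundD(2)[OF this(2)]
  show ?thesis
  proof (rule BLI)
    fix i w assume i: "i \<in> I" and w: "w \<in> S"
    show "\<bar>f i (F i w)\<bar> \<le> K" using bnd rng i w by blast
    fix w' assume w': "w' \<in> S"
    have "norm (f i (F i w) - f i (F i w')) \<le> L * norm (F i w - F i w')"
      by (rule field_differentiable_bound[where S = "{a..b}" and f' = "f' i"])
        (use der bnd rng i w w' in \<open>auto intro: has_field_derivative_at_within\<close>)
    also have "\<dots> \<le> \<bar>L\<bar> * (C * dist w w')"
      by (intro mult_mono) (use C i w w' in auto)
    finally show "\<bar>f i (F i w) - f i (F i w')\<bar> \<le> (\<bar>L\<bar> * C) * dist w w'" by (simp add: ac_simps)
  qed
qed

lemma BL_compose:
  assumes F: "BL I S F"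
    and der: "\<And>x. x \<in> {a..b} \<Longrightarrow> (f has_real_derivative f' x) (at x)"
    and cont: "continuous_on {a..b} f'"
    and rng: "\<And>i w. i \<in> I \<Longrightarrow> w \<in> S \<Longrightarrow> F i w \<in> {a..b}"
  shows "BL I S (\<lambda>i w. f (F i w))"
proof -
  have "continuous_on {a..b} f"
    using der by (meson DERIV_isCont continuous_at_imp_continuous_on)
  hence "bounded (f ` {a..b})" "bounded (f' ` {a..b})"
    using cont by (auto intro: compact_imp_bounded compact_continuous_image)
  then obtain K L where "\<And>x. x \<in> {a..b} \<Longrightarrow> \<bar>f x\<bar> \<le> K" "\<And>x. x \<in> {a..b} \<Longrightarrow> \<bar>f' x\<bar> \<le> L"
    unfolding bounded_iff by (metis image_eqI real_norm_def)
  thus ?thesis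
    by (intro BL_compose_local[OF F, where f = "\<lambda>_. f" and f' = "\<lambda>_. f'"]) (use der rng in auto)
qed

lemma BL_bounded_range:
  assumes "BL I S F"
  obtains C where "\<And>i w. i \<in> I \<Longrightarrow> w \<in> S \<Longrightarrow> F i w \<in> {-C..C}"
  using BLE[OF assms] BL_boundD(1) by (metis abs_le_iff atLeastAtMost_iff minus_le_iff)

lemma BL_exp:
  assumes "BL I S F"
  shows "BL I S (\<lambda>i w. exp (F i w))"
proof -
  obtain C where "\<And>i w. i \<in> I \<Longrightarrow> w \<in> S \<Longrightarrow> F i w \<in> {-C..C}"
    using BL_bounded_range[OF assms] by blast
  thus ?thesis
    by (intro BL_compose[OF assms, where f' = exp])
      (auto intro!: derivative_eq_intros continuous_intros)
qed

lemma BL_on_positive: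
  assumes F: "BL I S F" and pos: "\<delta> > 0" "\<And>i w. i \<in> I \<Longrightarrow> w \<in> S \<Longrightarrow> F i w \<ge> \<delta>"
    and der: "\<And>x. x > 0 \<Longrightarrow> (f has_real_derivative f' x) (at x)"
    and cont: "continuous_on {0<..} f'"
  shows "BL I S (\<lambda>i w. f (F i w))"
proof -
  obtain C where "\<And>i w. i \<in> I \<Longrightarrow> w \<in> S \<Longrightarrow> F i w \<in> {-C..C}"
    using BL_bounded_range[OF F] by blast
  thus ?thesis
    by (intro BL_compose[OF F, where f' = f' and a = \<delta> and b = C])
      (use pos der in \<open>auto intro: continuous_on_subset[OF cont]\<close>)
qed

lemma BL_inverse:
  assumes "BL I S F" "\<delta> > 0" "\<And>i w. i \<in> I \<Longrightarrow> w \<in> S \<Longrightarrow> F i w \<ge> \<delta>"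
  shows "BL I S (\<lambda>i w. inverse (F i w))"
  by (rule BL_on_positive[OF assms, where f' = "\<lambda>x. - inverse (x\<^sup>2)"])
    (auto intro!: derivative_eq_intros continuous_intros simp: power2_eq_square)

lemma BL_divide:
  assumes "BL I S G" "BL I S F" "\<delta> > 0" "\<And>i w. i \<in> I \<Longrightarrow> w \<in> S \<Longrightarrow> F i w \<ge> \<delta>"
  shows "BL I S (\<lambda>i w. G i w / F i w)"
  using BL_mult[OF assms(1) BL_inverse[OF assms(2-)]] by (simp add: divide_inverse)

lemma BL_sqrt:
  assumes "BL I S F" "\<delta> > 0" "\<And>i w. i \<in> I \<Longrightarrow> w \<in> S \<Longrightarrow> F i w \<ge> \<delta>"
  shows "BL I S (\<lambda>i w. sqrt (F i w))"
  by (rule BL_on_positive[OF assms, where f' = "\<lambda>x. inverse (sqrt x) / 2"])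
    (auto intro!: derivative_eq_intros continuous_intros)

lemma BL_root3:
  assumes "BL I S F" "\<delta> > 0" "\<And>i w. i \<in> I \<Longrightarrow> w \<in> S \<Longrightarrow> F i w \<ge> \<delta>"
  shows "BL I S (\<lambda>i w. root 3 (F i w))"
  by (rule BL_on_positive[OF assms, where f' = "\<lambda>x. inverse (3 * root 3 x ^ 2)"])
    (auto intro!: derivative_eq_intros continuous_intros)

text \<open>Integration up to \<open>snd i \<le> P\<close> multiplies the constant by at most
  \<open>P\<close>; the upper limit is itself part of the index, so the bound holds for all of them
  at once.\<close>

lemma BL_prim:
  assumes F: "BL (J \<times> {0..P}) S (\<lambda>i w. F (fst i) w (snd i))"
    and cont: "\<And>j w. j \<in> J \<Longrightarrow> w \<in> S \<Longrightarrow> continuous_on UNIV (F j w)"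
  shows "BL (J \<times> {0..P}) S (\<lambda>i w. prim (F (fst i) w) (snd i))"
proof -
  obtain C where C0: "C \<ge> 0" "BL_bound C (J \<times> {0..P}) S (\<lambda>i w. F (fst i) w (snd i))"
    using BLE[OF F] .
  have C: "C \<ge> 0"
    "\<And>j x w. j \<in> J \<Longrightarrow> x \<in> {0..P} \<Longrightarrow> w \<in> S \<Longrightarrow> \<bar>F j w x\<bar> \<le> C"
    "\<And>j x w w'. j \<in> J \<Longrightarrow> x \<in> {0..P} \<Longrightarrow> w \<in> S \<Longrightarrow> w' \<in> S \<Longrightarrow> \<bar>F j w x - F j w' x\<bar> \<le> C * dist w w'"
    using C0 BL_boundD[OF C0(2)] by force+
  show ?thesis
  proof (rule BLI)
    fix i w assume i: "i \<in> J \<times> {0..P}" and w: "w \<in> S"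
    have "\<bar>prim (F (fst i) w) (snd i)\<bar> \<le> C * snd i"
      by (rule abs_prim_le) (use i w C cont in auto)
    also have "\<dots> \<le> C * P" by (rule mult_left_mono) (use i C in auto)
    finally show "\<bar>prim (F (fst i) w) (snd i)\<bar> \<le> C * P" .
    fix w' assume w': "w' \<in> S"
    have "\<bar>prim (F (fst i) w) (snd i) - prim (F (fst i) w') (snd i)\<bar> \<le> (C * dist w w') * snd i"
      by (rule abs_prim_diff_le) (use i w w' C cont in auto)
    also have "\<dots> \<le> (C * dist w w') * P" by (rule mult_left_mono) (use i C in auto)
    finally show "\<bar>prim (F (fst i) w) (snd i) - prim (F (fst i) w') (snd i)\<bar> \<le> (C * P) * dist w w'"
      by (simp add: ac_simps)
  qed
qed

section \<open>Kepler's equation and the tidal force\<close>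

definition kepE :: "real \<Rightarrow> real \<Rightarrow> real" where
  "kepE e t = (THE E. E - e * sin E = t)"

lemma kepler_deriv: "((\<lambda>E. E - e * sin E) has_real_derivative 1 - e * cos E) (at E)"
  by (auto intro!: derivative_eq_intros)

lemma kepler_rho_ge:
  fixes e e1 E :: real
  assumes "0 \<le> e" "e \<le> e1"
  shows "1 - e1 \<le> 1 - e * cos E" "1 - e * cos E \<le> 1 + e1"
proof -
  have "\<bar>e * cos E\<bar> \<le> e1 * 1"
    unfolding abs_mult by (rule mult_mono) (use assms in auto)
  thus "1 - e1 \<le> 1 - e * cos E" "1 - e * cos E \<le> 1 + e1" by linarith+
qed

lemma kepler_rho_pos:
  fixes e :: real
  assumes "0 \<le> e" "e < 1"
  shows "0 < 1 - e * cos E"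
  using kepler_rho_ge(1)[of e e E] assms by linarith

lemma kepler_strict_mono:
  fixes e :: real
  assumes "0 \<le> e" "e < 1"
  shows "strict_mono (\<lambda>E. E - e * sin E)"
  using strict_mono_DERIV_pos[of _ "\<lambda>E. 1 - e * cos E"] kepler_deriv kepler_rho_pos[OF assms] by blast

lemma kepE_unique:
  assumes "0 \<le> e" "e < 1" "E - e * sin E = t"
  shows "kepE e t = E"
  unfolding kepE_def
  by (rule the_equality) (use assms strict_mono_eq[OF kepler_strict_mono[OF assms(1,2)]] in auto)

lemma kepE_eq:
  assumes "0 \<le> e" "e < 1"
  shows "kepE e t - e * sin (kepE e t) = t"
proof -
  have b: "\<bar>e * sin x\<bar> \<le> 1" for x
    unfolding abs_mult using assms by (intro mult_le_one) auto
  have "\<exists>E. t - 1 \<le> E \<and> E \<le> t + 1 \<and> E - e * sin E = t"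
    using b[of "t-1"] b[of "t+1"] by (intro IVT') (auto intro!: continuous_intros)
  then obtain E where "E - e * sin E = t" by blast
  with kepE_unique[OF assms this] show ?thesis by simp
qed

lemma kepE_deriv:
  assumes "0 \<le> e" "e < 1"
  shows "(kepE e has_real_derivative inverse (1 - e * cos (kepE e t))) (at t)"
  by (rule has_derivative_right_inverse[where f = "\<lambda>E. E - e * sin E"])
    (use kepler_deriv kepE_eq[OF assms] kepler_rho_pos[OF assms] in auto)

lemma kepE_uminus: "0 \<le> e \<Longrightarrow> e < 1 \<Longrightarrow> kepE e (- t) = - kepE e t"
  using kepE_eq[of e t] by (intro kepE_unique) auto

lemma kepE_add_2pi: "0 \<le> e \<Longrightarrow> e < 1 \<Longrightarrow> kepE e (t + 2 * pi) = kepE e t + 2 * pi"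
  using kepE_eq[of e t] by (intro kepE_unique) auto

text \<open>
  Position \<open>(YX, YY)\<close> of the secondary relative to the primary, its length \<open>rho\<close> and (below) its
  velocity \<open>(VX, VY)\<close>. The signs are opposite to those of \<open>X\<close>, because \<open>x - X = - X / m\<close>.
\<close>

definition YX :: "real \<Rightarrow> real \<Rightarrow> real" where "YX e t = e - cos (kepE e t)"
definition YY :: "real \<Rightarrow> real \<Rightarrow> real" where "YY e t = - sqrt (1 - e\<^sup>2) * sin (kepE e t)"
definition rho :: "real \<Rightarrow> real \<Rightarrow> real" where "rho e t = 1 - e * cos (kepE e t)"

lemma rho_bounds:
  assumes "0 \<le> e" "e \<le> e1" "e1 < 1"
  shows "1 - e1 \<le> rho e t" "rho e t \<le> 2"
  using kepler_rho_ge[OF assms(1,2), of "kepE e t"] assms unfolding rho_def by linarith+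

lemma rho_pos: "0 \<le> e \<Longrightarrow> e < 1 \<Longrightarrow> rho e t > 0"
  using rho_bounds(1)[of e e t] by linarith

lemma sq_less_1: "0 \<le> e \<Longrightarrow> e < 1 \<Longrightarrow> (e::real)\<^sup>2 < 1"
  by (simp add: power_less_one_iff)

lemma YX_YY_sq:
  assumes "0 \<le> e" "e < 1"
  shows "(YX e t)\<^sup>2 + (YY e t)\<^sup>2 = (rho e t)\<^sup>2"
proof -
  have "(YY e t)\<^sup>2 = (1 - e\<^sup>2) * (1 - (cos (kepE e t))\<^sup>2)"
    unfolding YY_def using sq_less_1[OF assms] by (simp add: power_mult_distrib sin_squared_eq)
  thus ?thesis unfolding YX_def rho_def by (simp add: power2_eq_square algebra_simps)
qed

lemma abs_Y_le:
  assumes "0 \<le> e" "e < 1"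
  shows "\<bar>YX e t\<bar> \<le> rho e t" "\<bar>YY e t\<bar> \<le> rho e t"
proof -
  have "(YX e t)\<^sup>2 \<le> (rho e t)\<^sup>2" "(YY e t)\<^sup>2 \<le> (rho e t)\<^sup>2"
    unfolding YX_YY_sq[OF assms, symmetric] by simp_all
  thus "\<bar>YX e t\<bar> \<le> rho e t" "\<bar>YY e t\<bar> \<le> rho e t"
    using rho_pos[OF assms, of t] by (simp_all add: power2_le_iff_abs_le)
qed

lemma Y_even [simp]:
  assumes "0 \<le> e" "e < 1"
  shows "YX e (- t) = YX e t" "YY e (- t) = - YY e t" "rho e (- t) = rho e t"
  unfolding YX_def YY_def rho_def by (simp_all add: kepE_uminus[OF assms])

lemma Y_periodic [simp]:
  assumes "0 \<le> e" "e < 1"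
  shows "YX e (t + 2 * pi) = YX e t" "YY e (t + 2 * pi) = YY e t" "rho e (t + 2 * pi) = rho e t"
  unfolding YX_def YY_def rho_def by (simp_all add: kepE_add_2pi[OF assms])

definition VX :: "real \<Rightarrow> real \<Rightarrow> real" where "VX e t = sin (kepE e t) / rho e t"
definition VY :: "real \<Rightarrow> real \<Rightarrow> real" where "VY e t = - sqrt (1 - e\<^sup>2) * cos (kepE e t) / rho e t"

lemma Y_deriv:
  assumes "0 \<le> e" "e < 1"
  shows "(YX e has_real_derivative VX e t) (at t)"
    and "(YY e has_real_derivative VY e t) (at t)"
    and "(rho e has_real_derivative e * VX e t) (at t)"
  unfolding YX_def[abs_def] YY_def[abs_def] VX_def VY_def rho_def
  by (auto intro!: derivative_eq_intros kepE_deriv assms simp: divide_inverse)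

lemma V_bounds:
  assumes e: "0 \<le> e" "e \<le> e1" "e1 < 1"
  shows "\<bar>VX e t\<bar> \<le> 1 / (1 - e1)" "\<bar>VY e t\<bar> \<le> 1 / (1 - e1)"
proof -
  have e': "e < 1" using e by simp
  have r: "0 < rho e t" "1 - e1 \<le> rho e t" using rho_pos[OF e(1) e'] rho_bounds(1)[OF e] by auto
  have "\<bar>sqrt (1 - e\<^sup>2) * cos (kepE e t)\<bar> \<le> 1 * 1"
    unfolding abs_mult by (intro mult_mono) (use sq_less_1[OF e(1) e'] in auto)
  thus "\<bar>VX e t\<bar> \<le> 1 / (1 - e1)" "\<bar>VY e t\<bar> \<le> 1 / (1 - e1)"
    unfolding VX_def VY_def using r e by (auto simp: abs_divide simp del: abs_mult intro!: frac_le)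
qed

text \<open>The Kepler problem of total mass 1, as befits semi-major axis 1 and period
  \<open>2\<pi>\<close>. On the return to the inertial frame it cancels the last terms of
  \<open>FX\<close> and \<open>FY\<close>.\<close>

lemma V_deriv:
  assumes "0 \<le> e" "e < 1"
  shows "(VX e has_real_derivative - YX e t / rho e t ^ 3) (at t)"
    and "(VY e has_real_derivative - YY e t / rho e t ^ 3) (at t)"
proof -
  let ?E = "kepE e t"
  have r: "rho e t \<noteq> 0" using rho_pos[OF assms, of t] by simp
  have ik: "inverse (1 - e * cos ?E) = 1 / rho e t" by (simp add: rho_def divide_inverse)
  have cosE: "e * cos ?E = 1 - rho e t" by (simp add: rho_def)
  have sc: "sin ?E * sin ?E = 1 - cos ?E * cos ?E"
    using sin_squared_eq[of ?E] by (simp add: power2_eq_square)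
  have "((\<lambda>t. sin (kepE e t) / rho e t) has_real_derivative
     (cos ?E * (1 / rho e t) * rho e t - sin ?E * (e * VX e t)) / (rho e t * rho e t)) (at t)"
    using kepE_deriv[OF assms, of t] unfolding ik
    by (auto intro!: derivative_eq_intros Y_deriv assms r)
  moreover have "(cos ?E * (1 / rho e t) * rho e t - sin ?E * (e * VX e t)) / (rho e t * rho e t)
     = - YX e t / rho e t ^ 3"
  proof -
    have "cos ?E * rho e t - sin ?E * (e * sin ?E) = cos ?E * rho e t - e * (sin ?E * sin ?E)"
      by simp
    also have "\<dots> = cos ?E - e" unfolding sc rho_def by (simp add: algebra_simps)
    finally have "cos ?E * rho e t - sin ?E * (e * sin ?E) = - YX e t" by (simp add: YX_def)
    moreover have "cos ?E * (1 / rho e t) * rho e t - sin ?E * (e * VX e t)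
        = (cos ?E * rho e t - sin ?E * (e * sin ?E)) / rho e t"
      using r by (simp add: VX_def diff_divide_distrib)
    ultimately show ?thesis by (simp add: power3_eq_cube)
  qed
  ultimately show "(VX e has_real_derivative - YX e t / rho e t ^ 3) (at t)"
    by (simp add: VX_def[abs_def])
  have "((\<lambda>t. cos (kepE e t) / rho e t) has_real_derivative
     (- sin ?E * (1 / rho e t) * rho e t - cos ?E * (e * VX e t)) / (rho e t * rho e t)) (at t)"
    using kepE_deriv[OF assms, of t] unfolding ik
    by (auto intro!: derivative_eq_intros Y_deriv assms r)
  from DERIV_cmult[OF this, of "- sqrt (1 - e\<^sup>2)"]
  have "(VY e has_real_derivative - sqrt (1 - e\<^sup>2) *
     ((- sin ?E * (1 / rho e t) * rho e t - cos ?E * (e * VX e t)) / (rho e t * rho e t))) (at t)"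
    by (simp add: VY_def[abs_def])
  moreover have "- sqrt (1 - e\<^sup>2) * ((- sin ?E * (1 / rho e t) * rho e t - cos ?E * (e * VX e t)) / (rho e t * rho e t))
     = - YY e t / rho e t ^ 3"
  proof -
    have "- sin ?E * rho e t - cos ?E * (e * sin ?E) = - sin ?E"
      unfolding rho_def by (simp add: algebra_simps)
    moreover have "- sin ?E * (1 / rho e t) * rho e t - cos ?E * (e * VX e t)
        = (- sin ?E * rho e t - cos ?E * (e * sin ?E)) / rho e t"
      using r by (simp add: VX_def field_simps)
    ultimately show ?thesis by (simp add: power3_eq_cube YY_def)
  qed
  ultimately show "(VY e has_real_derivative - YY e t / rho e t ^ 3) (at t)"
    by simp
qed

text \<open>Kepler's second law; it determines how fast the direction \<open>(YX, YY) / rho\<close>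
  turns.\<close>

lemma Y_angular_momentum:
  assumes "0 \<le> e" "e < 1"
  shows "YX e t * VY e t - YY e t * VX e t = sqrt (1 - e\<^sup>2)"
proof -
  let ?E = "kepE e t"
  have sc: "sin ?E * sin ?E = 1 - cos ?E * cos ?E"
    using sin_squared_eq[of ?E] by (simp add: power2_eq_square)
  have r: "rho e t \<noteq> 0" using rho_pos[OF assms, of t] by simp
  have "YX e t * VY e t - YY e t * VX e t
      = sqrt (1 - e\<^sup>2) * (sin ?E * sin ?E - (e - cos ?E) * cos ?E) / rho e t"
    using r by (simp add: YX_def YY_def VX_def VY_def field_simps) (use sc in algebra)
  also have "sin ?E * sin ?E - (e - cos ?E) * cos ?E = rho e t"
    unfolding sc rho_def by (simp add: algebra_simps)
  finally show ?thesis using r by simp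
qed

text \<open>
  The last term comes from the acceleration of the primary.
\<close>

definition FX :: "real \<Rightarrow> real \<Rightarrow> real \<Rightarrow> real \<Rightarrow> real" where
  "FX e t a b = (YX e t - a) / sqrt ((YX e t - a)\<^sup>2 + (YY e t - b)\<^sup>2) ^ 3 - YX e t / rho e t ^ 3"
definition FY :: "real \<Rightarrow> real \<Rightarrow> real \<Rightarrow> real \<Rightarrow> real" where
  "FY e t a b = (YY e t - b) / sqrt ((YX e t - a)\<^sup>2 + (YY e t - b)\<^sup>2) ^ 3 - YY e t / rho e t ^ 3"

text \<open>Reversing time reflects the secondary in the line of apsides. This reversibility is the
  source of all the parities below.\<close>

lemma F_even [simp]:
  assumes "0 \<le> e" "e < 1"
  shows "FX e (- t) a (- b) = FX e t a b" "FY e (- t) a (- b) = - FY e t a b"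
  unfolding FX_def FY_def using assms
  by (simp_all add: power2_commute[of b] diff_divide_distrib)

lemma F_periodic [simp]:
  assumes "0 \<le> e" "e < 1"
  shows "FX e (t + 2 * pi) a b = FX e t a b" "FY e (t + 2 * pi) a b = FY e t a b"
  unfolding FX_def FY_def using assms by simp_all

lemma Y_minus_bounds:
  assumes "0 \<le> e" "e < 1"
  shows "rho e t - sqrt (a\<^sup>2 + b\<^sup>2) \<le> sqrt ((YX e t - a)\<^sup>2 + (YY e t - b)\<^sup>2)"
    and "sqrt ((YX e t - a)\<^sup>2 + (YY e t - b)\<^sup>2) \<le> rho e t + sqrt (a\<^sup>2 + b\<^sup>2)"
proof -
  have r: "sqrt ((YX e t)\<^sup>2 + (YY e t)\<^sup>2) = rho e t"
    unfolding YX_YY_sq[OF assms] using rho_pos[OF assms, of t] by simp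
  show "rho e t - sqrt (a\<^sup>2 + b\<^sup>2) \<le> sqrt ((YX e t - a)\<^sup>2 + (YY e t - b)\<^sup>2)"
    using real_sqrt_sum_squares_triangle_ineq[of "YX e t - a" a "YY e t - b" b] r by simp
  show "sqrt ((YX e t - a)\<^sup>2 + (YY e t - b)\<^sup>2) \<le> rho e t + sqrt (a\<^sup>2 + b\<^sup>2)"
    using real_sqrt_sum_squares_triangle_ineq[of "YX e t" "-a" "YY e t" "-b"] r by simp
qed

context
  fixes e1 :: real
  assumes e1: "0 \<le> e1" "e1 < 1"
begin

lemma Y_BL:
  assumes e: "\<And>i. i \<in> I \<Longrightarrow> 0 \<le> \<epsilon> i \<and> \<epsilon> i \<le> e1" and T: "BL I S T"
  shows "BL I S (\<lambda>i w. YX (\<epsilon> i) (T i w))" "BL I S (\<lambda>i w. YY (\<epsilon> i) (T i w))"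
    "BL I S (\<lambda>i w. rho (\<epsilon> i) (T i w))"
proof -
  have e': "0 \<le> \<epsilon> i" "\<epsilon> i < 1" "\<epsilon> i \<le> e1" if "i \<in> I" for i using e[OF that] e1 by auto
  obtain C where C: "\<And>i w. i \<in> I \<Longrightarrow> w \<in> S \<Longrightarrow> T i w \<in> {-C..C}"
    using BL_bounded_range[OF T] by blast
  have V: "\<bar>VX (\<epsilon> i) x\<bar> \<le> 1 / (1 - e1)" "\<bar>VY (\<epsilon> i) x\<bar> \<le> 1 / (1 - e1)" if "i \<in> I" for i x
    by (rule V_bounds[OF e'(1,3)[OF that] e1(2)])+
  have Yb: "\<bar>YX (\<epsilon> i) x\<bar> \<le> 2" "\<bar>YY (\<epsilon> i) x\<bar> \<le> 2" "\<bar>rho (\<epsilon> i) x\<bar> \<le> 2" if "i \<in> I" for i x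
    using abs_Y_le[OF e'(1,2)[OF that], of x]
      rho_bounds[OF e'(1,3)[OF that] e1(2), of x] e1 by linarith+
  have eV: "\<bar>\<epsilon> i * VX (\<epsilon> i) x\<bar> \<le> 1 / (1 - e1)" if "i \<in> I" for i x
    using mult_mono[OF less_imp_le[OF e'(2)[OF that]] V(1)[OF that, of x]] e'(1)[OF that] by (simp add: abs_mult)
  show "BL I S (\<lambda>i w. YX (\<epsilon> i) (T i w))"
    by (rule BL_compose_local[OF T, where f' = "\<lambda>i. VX (\<epsilon> i)" and a = "-C" and b = C and K = 2])
      (use Y_deriv e' V Yb C in auto)
  show "BL I S (\<lambda>i w. YY (\<epsilon> i) (T i w))"
    by (rule BL_compose_local[OF T, where f' = "\<lambda>i. VY (\<epsilon> i)" and a = "-C" and b = C and K = 2])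
      (use Y_deriv e' V Yb C in auto)
  show "BL I S (\<lambda>i w. rho (\<epsilon> i) (T i w))"
    by (rule BL_compose_local[OF T, where f' = "\<lambda>i x. \<epsilon> i * VX (\<epsilon> i) x" and a = "-C" and b = C and K = 2])
      (use Y_deriv e' eV Yb C in auto)
qed

text \<open>The secondary never comes closer than \<open>1 - e1\<close> to the primary; a particle
  within half of that distance leaves at least the other half between itself and the
  secondary.\<close>

lemma sep_lower:
  assumes "0 \<le> e" "e \<le> e1" "sqrt (a\<^sup>2 + b\<^sup>2) \<le> (1 - e1) / 2"
  shows "(1 - e1) / 2 \<le> sqrt ((YX e t - a)\<^sup>2 + (YY e t - b)\<^sup>2)"
  using Y_minus_bounds(1)[of e t a b] rho_bounds(1)[OF assms(1,2) e1(2), of t] assms e1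
  by (simp add: field_simps)

lemma F_BL:
  assumes e: "\<And>i. i \<in> I \<Longrightarrow> 0 \<le> \<epsilon> i \<and> \<epsilon> i \<le> e1" and T: "BL I S T"
    and a: "BL I S a" and b: "BL I S b"
    and sm: "\<And>i w. i \<in> I \<Longrightarrow> w \<in> S \<Longrightarrow> sqrt ((a i w)\<^sup>2 + (b i w)\<^sup>2) \<le> (1 - e1) / 2"
  shows "BL I S (\<lambda>i w. FX (\<epsilon> i) (T i w) (a i w) (b i w))"
    "BL I S (\<lambda>i w. FY (\<epsilon> i) (T i w) (a i w) (b i w))"
proof -
  let ?u = "\<lambda>i w. (YX (\<epsilon> i) (T i w) - a i w)\<^sup>2 + (YY (\<epsilon> i) (T i w) - b i w)\<^sup>2"
  note Y = Y_BL[of I \<epsilon>, OF e T]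
  have u: "BL I S ?u"
    by (intro BL_add BL_power BL_diff Y a b)
  have u1: "(1 - e1) / 2 \<le> sqrt (?u i w)" if "i \<in> I" "w \<in> S" for i w
    using sep_lower sm[OF that] e[OF that(1)] by blast
  have u2: "((1 - e1) / 2)\<^sup>2 \<le> ?u i w" if "i \<in> I" "w \<in> S" for i w
    using power_mono[OF u1[OF that], of 2] e1 by simp
  have su: "BL I S (\<lambda>i w. sqrt (?u i w) ^ 3)"
    by (intro BL_power BL_sqrt[OF u _ u2]) (use e1 in auto)
  have su2: "((1 - e1) / 2) ^ 3 \<le> sqrt (?u i w) ^ 3" if "i \<in> I" "w \<in> S" for i w
    by (rule power_mono[OF u1[OF that]]) (use e1 in auto)
  have r: "BL I S (\<lambda>i w. rho (\<epsilon> i) (T i w) ^ 3)"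
    by (intro BL_power Y)
  have r2: "(1 - e1) ^ 3 \<le> rho (\<epsilon> i) (T i w) ^ 3" if "i \<in> I" for i w
    by (rule power_mono) (use e1 e[OF that] rho_bounds in auto)
  show "BL I S (\<lambda>i w. FX (\<epsilon> i) (T i w) (a i w) (b i w))" "BL I S (\<lambda>i w. FY (\<epsilon> i) (T i w) (a i w) (b i w))"
    unfolding FX_def FY_def
    by (intro BL_diff BL_divide[OF _ su _ su2] BL_divide[OF _ r _ r2] Y a b; use e1 in simp)+
qed

end

section \<open>The quadrupole term\<close>

lemma inverse_cube_diff:
  fixes u r :: real
  assumes "u > 0" "r > 0"
  shows "1 / u ^ 3 - 1 / r ^ 3 = - (u - r) * (u\<^sup>2 + u * r + r\<^sup>2) / (u ^ 3 * r ^ 3)"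
    and "1 / u ^ 3 - 1 / r ^ 3 + 3 * (u - r) / r ^ 4
      = (u - r)\<^sup>2 * (3 * u\<^sup>2 + 2 * u * r + r\<^sup>2) / (u ^ 3 * r ^ 4)"
  using assms by (simp_all add: field_simps power2_eq_square power3_eq_cube power4_eq_xxxx)

text \<open>In the application \<open>r = |y|\<close>, \<open>u = |y - q|\<close>,
  \<open>s = |q|\<close> and \<open>d\<close> is the inner product of \<open>y\<close> and
  \<open>q\<close>. The expansion of the inverse cube at \<open>r\<close> has the linear term
  \<open>- 3 (u - r) / r^4\<close>, and \<open>u^2 - r^2 = s^2 - 2 d\<close> gives
  \<open>u - r = - d / r\<close> up to \<open>2 s^2 / r\<close>. The numerators 27 and 54 come from
  \<open>u, r \<le> 3\<close>.\<close>

lemma inverse_cube_taylor: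
  fixes u r d s \<delta> :: real
  assumes \<delta>: "\<delta> > 0" "\<delta> \<le> u" "\<delta> \<le> r" and ub: "u \<le> 3" "r \<le> 3"
    and s: "0 \<le> s" "\<bar>u - r\<bar> \<le> s" and d: "\<bar>d\<bar> \<le> r * s" "u\<^sup>2 = r\<^sup>2 - 2 * d + s\<^sup>2"
  shows "\<bar>1 / u ^ 3 - 1 / r ^ 3\<bar> \<le> 27 / \<delta> ^ 6 * s"
    and "\<bar>1 / u ^ 3 - 1 / r ^ 3 - 3 * d / r ^ 5\<bar> \<le> (54 / \<delta> ^ 7 + 6 / \<delta> ^ 5) * s\<^sup>2"
proof -
  have pos: "u > 0" "r > 0" using \<delta> by auto
  have sq: "u\<^sup>2 \<le> 9" "r\<^sup>2 \<le> 9" "u * r \<le> 9"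
    using power_mono[OF ub(1), of 2] power_mono[OF ub(2), of 2] mult_mono[OF ub(1) ub(2)] pos by auto
  have den: "\<delta> ^ 6 \<le> u ^ 3 * r ^ 3" "\<delta> ^ 7 \<le> u ^ 3 * r ^ 4"
    using mult_mono[OF power_mono[OF \<delta>(2), of 3] power_mono[OF \<delta>(3), of 3]]
      mult_mono[OF power_mono[OF \<delta>(2), of 3] power_mono[OF \<delta>(3), of 4]] \<delta> pos
    by (simp_all flip: power_add)
  have "\<bar>1 / u ^ 3 - 1 / r ^ 3\<bar> = \<bar>u - r\<bar> * (u\<^sup>2 + u * r + r\<^sup>2) / (u ^ 3 * r ^ 3)"
    unfolding inverse_cube_diff(1)[OF pos] using pos by (simp add: abs_mult abs_minus_commute)
  also have "\<dots> \<le> s * 27 / \<delta> ^ 6"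
    by (intro frac_le mult_mono) (use s sq den \<delta> pos in auto)
  finally show "\<bar>1 / u ^ 3 - 1 / r ^ 3\<bar> \<le> 27 / \<delta> ^ 6 * s" by (simp add: mult.commute)
  have "\<bar>1 / u ^ 3 - 1 / r ^ 3 + 3 * (u - r) / r ^ 4\<bar>
      = (u - r)\<^sup>2 * (3 * u\<^sup>2 + 2 * u * r + r\<^sup>2) / (u ^ 3 * r ^ 4)"
    unfolding inverse_cube_diff(2)[OF pos] using pos by (simp add: abs_mult abs_divide)
  also have "\<dots> \<le> s\<^sup>2 * 54 / \<delta> ^ 7"
    using power_mono[OF s(2), of 2] by (intro frac_le mult_mono) (use s sq den \<delta> pos in auto)
  finally have 1: "\<bar>1 / u ^ 3 - 1 / r ^ 3 + 3 * (u - r) / r ^ 4\<bar> \<le> s\<^sup>2 * 54 / \<delta> ^ 7" .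
  have "(u - r) + d / r = (r * s\<^sup>2 + d * (u - r)) / (r * (u + r))"
  proof -
    have "((u - r) + d / r) * (r * (u + r)) = r * (u\<^sup>2 - r\<^sup>2) + d * (u + r)"
      using pos by (simp add: field_simps power2_eq_square)
    also have "\<dots> = r * s\<^sup>2 + d * (u - r)"
      unfolding d(2) by (simp add: algebra_simps)
    finally show ?thesis using pos by (simp add: eq_divide_eq)
  qed
  hence "\<bar>(u - r) + d / r\<bar> = \<bar>r * s\<^sup>2 + d * (u - r)\<bar> / (r * (u + r))"
    using pos by (simp add: abs_mult)
  also have "\<dots> \<le> (2 * r * s\<^sup>2) / (r * r)"
  proof (intro frac_le)
    have "\<bar>d * (u - r)\<bar> \<le> (r * s) * s"
      unfolding abs_mult by (intro mult_mono) (use d s pos in auto)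
    moreover have "\<bar>r * s\<^sup>2\<bar> = r * s\<^sup>2" using pos by simp
    ultimately show "\<bar>r * s\<^sup>2 + d * (u - r)\<bar> \<le> 2 * r * s\<^sup>2"
      by (simp add: power2_eq_square)
  qed (use pos in auto)
  also have "\<dots> = 2 * s\<^sup>2 / r" using pos by simp
  finally have 2: "\<bar>(u - r) + d / r\<bar> \<le> 2 * s\<^sup>2 / r" .
  have "\<bar>3 / r ^ 4 * ((u - r) + d / r)\<bar> = 3 / r ^ 4 * \<bar>(u - r) + d / r\<bar>"
    by (subst abs_mult) (use pos in simp)
  also have "\<dots> \<le> 3 / r ^ 4 * (2 * s\<^sup>2 / r)"
    using pos by (intro mult_left_mono 2) auto
  also have "\<dots> = 6 * s\<^sup>2 / r ^ 5" by (simp add: eval_nat_numeral)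
  also have "\<dots> \<le> 6 * s\<^sup>2 / \<delta> ^ 5"
    using \<delta> by (intro frac_le power_mono) auto
  finally have 3: "\<bar>3 / r ^ 4 * ((u - r) + d / r)\<bar> \<le> 6 * s\<^sup>2 / \<delta> ^ 5" .
  have "1 / u ^ 3 - 1 / r ^ 3 - 3 * d / r ^ 5
      = (1 / u ^ 3 - 1 / r ^ 3 + 3 * (u - r) / r ^ 4) - 3 / r ^ 4 * ((u - r) + d / r)"
    using pos by (simp add: field_simps eval_nat_numeral)
  hence "\<bar>1 / u ^ 3 - 1 / r ^ 3 - 3 * d / r ^ 5\<bar> \<le> s\<^sup>2 * 54 / \<delta> ^ 7 + 6 * s\<^sup>2 / \<delta> ^ 5"
    using 1 3 by linarith
  thus "\<bar>1 / u ^ 3 - 1 / r ^ 3 - 3 * d / r ^ 5\<bar> \<le> (54 / \<delta> ^ 7 + 6 / \<delta> ^ 5) * s\<^sup>2"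
    by (simp add: algebra_simps)
qed

text \<open>
  The matrix \<open>(3 y y\<^sup>T / |y|\<^sup>2 - 1) / |y|\<^sup>3\<close> at \<open>y = (YX, YY)\<close>.
\<close>

definition QXX :: "real \<Rightarrow> real \<Rightarrow> real" where "QXX e t = (3 * (YX e t)\<^sup>2 / (rho e t)\<^sup>2 - 1) / rho e t ^ 3"
definition QYY :: "real \<Rightarrow> real \<Rightarrow> real" where "QYY e t = (3 * (YY e t)\<^sup>2 / (rho e t)\<^sup>2 - 1) / rho e t ^ 3"
definition QXY :: "real \<Rightarrow> real \<Rightarrow> real" where "QXY e t = 3 * YX e t * YY e t / rho e t ^ 5"

text \<open>Subtracting the acceleration of the primary removes the term of order zero. With
  \<open>E = 1/u^3 - 1/r^3\<close> the error in each component is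
  \<open>y (E - 3 d / r^5) - q E\<close>: the bracket is of second order, and in the last product
  both factors are of first order. This is also the origin of \<open>C\<close>.\<close>

lemma F_quadrupole:
  assumes e1: "0 \<le> e1" "e1 < 1"
  shows "\<exists>C\<ge>0. \<forall>e t a b. 0 \<le> e \<longrightarrow> e \<le> e1 \<longrightarrow> sqrt (a\<^sup>2 + b\<^sup>2) \<le> (1 - e1) / 2 \<longrightarrow>
    \<bar>FX e t a b - (QXX e t * a + QXY e t * b)\<bar> \<le> C * (a\<^sup>2 + b\<^sup>2) \<and>
    \<bar>FY e t a b - (QXY e t * a + QYY e t * b)\<bar> \<le> C * (a\<^sup>2 + b\<^sup>2)"
proof -
  define \<delta> where "\<delta> = (1 - e1) / 2"
  define C where "C = 2 * (54 / \<delta> ^ 7 + 6 / \<delta> ^ 5) + 27 / \<delta> ^ 6"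
  have \<delta>: "\<delta> > 0" "\<delta> \<le> 1" using e1 by (auto simp: \<delta>_def)
  have main: "\<bar>FX e t a b - (QXX e t * a + QXY e t * b)\<bar> \<le> C * (a\<^sup>2 + b\<^sup>2) \<and>
    \<bar>FY e t a b - (QXY e t * a + QYY e t * b)\<bar> \<le> C * (a\<^sup>2 + b\<^sup>2)"
    if e: "0 \<le> e" "e \<le> e1" and sm: "sqrt (a\<^sup>2 + b\<^sup>2) \<le> (1 - e1) / 2" for e t a b
  proof -
    have e': "0 \<le> e" "e < 1" using e e1 by auto
    define y1 y2 r u s d where "y1 = YX e t" and "y2 = YY e t" and "r = rho e t"
      and "u = sqrt ((y1 - a)\<^sup>2 + (y2 - b)\<^sup>2)" and "s = sqrt (a\<^sup>2 + b\<^sup>2)" and "d = y1 * a + y2 * b"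
    have r: "r > 0" "2 * \<delta> \<le> r" "r \<le> 2"
      using rho_pos[OF e'] rho_bounds[OF e e1(2), of t] by (auto simp: r_def \<delta>_def)
    have y: "y1\<^sup>2 + y2\<^sup>2 = r\<^sup>2" "\<bar>y1\<bar> \<le> 2" "\<bar>y2\<bar> \<le> 2"
      using YX_YY_sq[OF e', of t] abs_Y_le[OF e', of t] r by (auto simp: y1_def y2_def r_def)
    have s2: "s\<^sup>2 = a\<^sup>2 + b\<^sup>2" "0 \<le> s" "s \<le> \<delta>" "\<bar>a\<bar> \<le> s" "\<bar>b\<bar> \<le> s"
      using sm by (auto simp: s_def \<delta>_def real_le_rsqrt)
    have us: "\<bar>u - r\<bar> \<le> s"
      using Y_minus_bounds[OF e', of t a b] unfolding u_def r_def y1_def y2_def s_def by linarith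
    have u2: "u\<^sup>2 = r\<^sup>2 - 2 * d + s\<^sup>2"
      unfolding u_def s2 y(1)[symmetric] d_def
      by simp (simp add: power2_eq_square algebra_simps)
    have "d\<^sup>2 \<le> (r * s)\<^sup>2"
    proof -
      \<comment> \<open>Lagrange's identity, which gives the Cauchy-Schwarz inequality for
        \<open>d\<close>.\<close>
      have "(r * s)\<^sup>2 - d\<^sup>2 = (y1 * b - y2 * a)\<^sup>2"
        unfolding power_mult_distrib s2 y(1)[symmetric] d_def
        by (simp add: power2_eq_square algebra_simps)
      thus ?thesis by (metis diff_ge_0_iff_ge zero_le_power2)
    qed
    hence d: "\<bar>d\<bar> \<le> r * s" using r s2 by (simp add: power2_le_iff_abs_le)
    define E where "E = 1 / u ^ 3 - 1 / r ^ 3"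
    have ur: "\<delta> \<le> u" "\<delta> \<le> r" "u \<le> 3" "r \<le> 3" using us r s2 \<delta> by linarith+
    have E: "\<bar>E\<bar> \<le> 27 / \<delta> ^ 6 * s" "\<bar>E - 3 * d / r ^ 5\<bar> \<le> (54 / \<delta> ^ 7 + 6 / \<delta> ^ 5) * s\<^sup>2"
      using inverse_cube_taylor[OF \<delta>(1) ur s2(2) us d u2] unfolding E_def by auto
    have *: "\<bar>y * (E - 3 * d / r ^ 5) - z * E\<bar> \<le> C * s\<^sup>2" if "\<bar>y\<bar> \<le> 2" "\<bar>z\<bar> \<le> s" for y z
    proof -
      have "\<bar>y * (E - 3 * d / r ^ 5)\<bar> \<le> 2 * ((54 / \<delta> ^ 7 + 6 / \<delta> ^ 5) * s\<^sup>2)"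
        unfolding abs_mult by (intro mult_mono) (use that E in auto)
      moreover have "\<bar>z * E\<bar> \<le> s * (27 / \<delta> ^ 6 * s)"
        unfolding abs_mult by (intro mult_mono) (use that E s2 in auto)
      moreover have "C * s\<^sup>2 = 2 * ((54 / \<delta> ^ 7 + 6 / \<delta> ^ 5) * s\<^sup>2) + s * (27 / \<delta> ^ 6 * s)"
        unfolding C_def by (simp add: algebra_simps power2_eq_square)
      ultimately show ?thesis by linarith
    qed
    have "FX e t a b = (y1 - a) * (1 / u ^ 3) - y1 / r ^ 3"
      by (simp add: FX_def y1_def y2_def r_def u_def)
    also have "\<dots> = (y1 - a) * E - a / r ^ 3" unfolding E_def by (simp add: algebra_simps diff_divide_distrib)
    moreover have "QXX e t * a + QXY e t * b = y1 * (3 * d / r ^ 5) - a / r ^ 3"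
      unfolding QXX_def QXY_def y1_def[symmetric] y2_def[symmetric] r_def[symmetric] d_def
      using r by (simp add: field_simps eval_nat_numeral)
    ultimately have "FX e t a b - (QXX e t * a + QXY e t * b) = y1 * (E - 3 * d / r ^ 5) - a * E"
      by (simp add: algebra_simps)
    hence 1: "\<bar>FX e t a b - (QXX e t * a + QXY e t * b)\<bar> \<le> C * s\<^sup>2"
      using *[of y1 a] y s2 by simp
    have "FY e t a b = (y2 - b) * (1 / u ^ 3) - y2 / r ^ 3"
      by (simp add: FY_def y1_def y2_def r_def u_def)
    also have "\<dots> = (y2 - b) * E - b / r ^ 3" unfolding E_def by (simp add: algebra_simps diff_divide_distrib)
    moreover have "QXY e t * a + QYY e t * b = y2 * (3 * d / r ^ 5) - b / r ^ 3"
      unfolding QYY_def QXY_def y1_def[symmetric] y2_def[symmetric] r_def[symmetric] d_def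
      using r by (simp add: field_simps eval_nat_numeral)
    ultimately have "FY e t a b - (QXY e t * a + QYY e t * b) = y2 * (E - 3 * d / r ^ 5) - b * E"
      by (simp add: algebra_simps)
    hence "\<bar>FY e t a b - (QXY e t * a + QYY e t * b)\<bar> \<le> C * s\<^sup>2"
      using *[of y2 b] y s2 by simp
    with 1 show ?thesis unfolding s2(1) by blast
  qed
  have "C \<ge> 0" unfolding C_def using \<delta> by simp
  with main show ?thesis by blast
qed

definition bounded_deriv :: "(real \<Rightarrow> real) \<Rightarrow> real \<Rightarrow> bool" where
  "bounded_deriv f C \<longleftrightarrow> (\<forall>t. \<exists>d. (f has_real_derivative d) (at t) \<and> \<bar>d\<bar> \<le> C)"

lemma bounded_deriv_continuous: "bounded_deriv f C \<Longrightarrow> continuous_on S f"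
  unfolding bounded_deriv_def by (meson DERIV_isCont continuous_at_imp_continuous_on)

text \<open>All three entries have the form \<open>3 P Q / rho^5 + c / rho^3\<close> with
  \<open>P\<close>, \<open>Q\<close> among \<open>YX\<close>, \<open>YY\<close> and \<open>c\<close>
  either \<open>0\<close> or \<open>-1\<close>, so one computation covers them. The constant must
  not depend on \<open>e\<close>, since it measures the error of averaging.\<close>

lemma Q_deriv_bound:
  assumes e1: "0 \<le> e1" "e1 < 1"
  shows "\<exists>C\<ge>0. \<forall>e. 0 \<le> e \<longrightarrow> e \<le> e1 \<longrightarrow>
    bounded_deriv (QXX e) C \<and> bounded_deriv (QXY e) C \<and> bounded_deriv (QYY e) C"
proof -
  define N where "N = 1 / (1 - e1)"
  have N: "N > 0" using e1 by (simp add: N_def)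
  define C where "C = 30 * 2 * 2 * N ^ 7 + 20 * 2 * N ^ 6 + 5 * N ^ 5"
  have main: "\<exists>d. ((\<lambda>t. 3 * P t * Q t / rho e t ^ 5 + c / rho e t ^ 3) has_real_derivative d) (at t) \<and> \<bar>d\<bar> \<le> C"
    if e: "0 \<le> e" "e \<le> e1" and P: "(P has_real_derivative p) (at t)" "\<bar>P t\<bar> \<le> 2" "\<bar>p\<bar> \<le> N"
      and Q: "(Q has_real_derivative q) (at t)" "\<bar>Q t\<bar> \<le> 2" "\<bar>q\<bar> \<le> N" and c: "\<bar>c\<bar> \<le> 1"
    for e t P Q p q c
  proof -
    have e': "0 \<le> e" "e < 1" using e e1 by auto
    define r r' where "r = rho e t" and "r' = e * VX e t"
    have r: "r > 0" "1 / r \<le> N"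
      using rho_pos[OF e', of t] rho_bounds[OF e e1(2), of t] e1 by (auto simp: r_def N_def intro!: frac_le)
    have "\<bar>r'\<bar> \<le> 1 * N" unfolding r'_def abs_mult N_def
      by (intro mult_mono V_bounds[OF e e1(2)]) (use e' in auto)
    hence r': "\<bar>r'\<bar> \<le> N" by simp
    define d where "d = 3 * p * Q t * (1 / r) ^ 5 + 3 * P t * q * (1 / r) ^ 5
        - 15 * P t * Q t * r' * (1 / r) ^ 6 - 3 * c * r' * (1 / r) ^ 4"
    have "((\<lambda>t. 3 * P t * Q t / rho e t ^ 5 + c / rho e t ^ 3) has_real_derivative d) (at t)"
    proof -
      have "((\<lambda>t. 3 * P t * Q t / rho e t ^ 5 + c / rho e t ^ 3) has_real_derivative
        ((3 * p * Q t + 3 * P t * q) * r ^ 5 - 3 * P t * Q t * (5 * r ^ 4 * r')) / (r ^ 5 * r ^ 5)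
        + (0 * r ^ 3 - c * (3 * r ^ 2 * r')) / (r ^ 3 * r ^ 3)) (at t)"
        using Y_deriv(3)[OF e', of t] P(1) Q(1) r
        unfolding r_def r'_def by (auto intro!: derivative_eq_intros simp: algebra_simps)
      also have "((3 * p * Q t + 3 * P t * q) * r ^ 5 - 3 * P t * Q t * (5 * r ^ 4 * r')) / (r ^ 5 * r ^ 5)
        + (0 * r ^ 3 - c * (3 * r ^ 2 * r')) / (r ^ 3 * r ^ 3) = d"
        unfolding d_def using r by (simp add: field_simps eval_nat_numeral)
      finally show ?thesis .
    qed
    moreover have "\<bar>d\<bar> \<le> C"
    proof -
      have n: "0 \<le> 1 / r" using r by simp
      have pw: "\<bar>(1 / r) ^ k\<bar> \<le> N ^ k" for k
        using power_mono[OF r(2) n, of k] n by simp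
      have "\<bar>3 * p * Q t * (1 / r) ^ 5\<bar> \<le> 3 * N * 2 * N ^ 5"
        "\<bar>3 * P t * q * (1 / r) ^ 5\<bar> \<le> 3 * 2 * N * N ^ 5"
        "\<bar>15 * P t * Q t * r' * (1 / r) ^ 6\<bar> \<le> 15 * 2 * 2 * N * N ^ 6"
        "\<bar>3 * c * r' * (1 / r) ^ 4\<bar> \<le> 3 * 1 * N * N ^ 4"
        unfolding abs_mult by (intro mult_mono pw P Q r' c; use N in simp)+
      hence "\<bar>d\<bar> \<le> 3 * N * 2 * N ^ 5 + 3 * 2 * N * N ^ 5 + 15 * 2 * 2 * N * N ^ 6 + 3 * 1 * N * N ^ 4"
        unfolding d_def by linarith
      also have "\<dots> = 12 * N ^ 6 + 60 * N ^ 7 + 3 * N ^ 5" by (simp add: eval_nat_numeral)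
      also have "\<dots> \<le> C" unfolding C_def using N zero_le_power[of N 5] zero_le_power[of N 6] zero_le_power[of N 7] by linarith
      finally show ?thesis .
    qed
    ultimately show ?thesis by blast
  qed
  show ?thesis
  proof (rule exI[of _ C], intro conjI allI impI)
    show "0 \<le> C" unfolding C_def using N by simp
    fix e assume e: "0 \<le> e" "e \<le> e1"
    have e': "0 \<le> e" "e < 1" using e e1 by auto
    have Y: "\<bar>YX e t\<bar> \<le> 2" "\<bar>YY e t\<bar> \<le> 2" for t
      using abs_Y_le[OF e', of t] rho_bounds[OF e e1(2), of t] by linarith+
    have V: "\<bar>VX e t\<bar> \<le> N" "\<bar>VY e t\<bar> \<le> N" for t
      unfolding N_def by (rule V_bounds[OF e e1(2)])+
    have rn: "rho e t \<noteq> 0" for t using rho_pos[OF e', of t] by simp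
    have eq: "QXX e = (\<lambda>t. 3 * YX e t * YX e t / rho e t ^ 5 + (-1) / rho e t ^ 3)"
      "QXY e = (\<lambda>t. 3 * YX e t * YY e t / rho e t ^ 5 + 0 / rho e t ^ 3)"
      "QYY e = (\<lambda>t. 3 * YY e t * YY e t / rho e t ^ 5 + (-1) / rho e t ^ 3)"
      unfolding QXX_def[abs_def] QXY_def[abs_def] QYY_def[abs_def] using rn
      by (simp_all add: fun_eq_iff field_simps eval_nat_numeral)
    show "bounded_deriv (QXX e) C"
      unfolding eq bounded_deriv_def by (intro allI, rule main[OF e Y_deriv(1)[OF e'] Y(1) V(1) Y_deriv(1)[OF e'] Y(1) V(1)]) simp
    show "bounded_deriv (QXY e) C"
      unfolding eq bounded_deriv_def by (intro allI, rule main[OF e Y_deriv(1)[OF e'] Y(1) V(1) Y_deriv(2)[OF e'] Y(2) V(2)]) simp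
    show "bounded_deriv (QYY e) C"
      unfolding eq bounded_deriv_def by (intro allI, rule main[OF e Y_deriv(2)[OF e'] Y(2) V(2) Y_deriv(2)[OF e'] Y(2) V(2)]) simp
  qed
qed

lemma Q_periodic [simp]:
  assumes "0 \<le> e" "e < 1"
  shows "QXX e (t + 2 * pi) = QXX e t" "QXY e (t + 2 * pi) = QXY e t" "QYY e (t + 2 * pi) = QYY e t"
  unfolding QXX_def QXY_def QYY_def using assms by simp_all

lemma Q_continuous:
  assumes "0 \<le> e" "e < 1"
  shows "continuous_on UNIV (QXX e)" "continuous_on UNIV (QXY e)" "continuous_on UNIV (QYY e)"
  using Q_deriv_bound[OF assms] assms(1) bounded_deriv_continuous by (meson order_refl)+

text \<open>
  With \<open>(c, s)\<close> the cosine and sine of the true anomaly, the difference is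
  \<open>3 (c\<^sup>2 - s\<^sup>2) (1 - e c) / (\<kappa>\<^sup>2 rho\<^sup>2)\<close>, and \<open>c' = - \<kappa> s / rho\<^sup>2\<close>, \<open>s' = \<kappa> c / rho\<^sup>2\<close>; this suggests
  the periodic antiderivative \<open>Z\<close>.
\<close>

lemma prim_QXX_minus_QYY:
  assumes "0 \<le> e" "e < 1"
  shows "prim (\<lambda>t. QXX e t - QYY e t) (2 * pi) = 0"
proof -
  define \<kappa> where "\<kappa> = sqrt (1 - e\<^sup>2)"
  have \<kappa>: "\<kappa> > 0" "\<kappa>\<^sup>2 = 1 - e\<^sup>2" using sq_less_1[OF assms] by (auto simp: \<kappa>_def)
  define c s where "c = (\<lambda>t. YX e t / rho e t)" and "s = (\<lambda>t. YY e t / rho e t)"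
  have rn: "rho e t \<noteq> 0" for t using rho_pos[OF assms, of t] by simp
  have cs: "c t * c t + s t * s t = 1" for t
    using YX_YY_sq[OF assms, of t] rn[of t] unfolding c_def s_def
    by (simp add: field_simps power2_eq_square)
  have yv: "YX e t * VX e t + YY e t * VY e t = rho e t * (e * VX e t)" for t
  proof -
    have "((\<lambda>t. (YX e t)\<^sup>2 + (YY e t)\<^sup>2) has_real_derivative 2 * (YX e t * VX e t + YY e t * VY e t)) (at t)"
      by (auto intro!: derivative_eq_intros Y_deriv assms)
    moreover have "((\<lambda>t. (rho e t)\<^sup>2) has_real_derivative 2 * (rho e t * (e * VX e t))) (at t)"
      by (auto intro!: derivative_eq_intros Y_deriv assms)
    ultimately show ?thesis
      unfolding YX_YY_sq[OF assms] using DERIV_unique by fastforce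
  qed
  have c': "(c has_real_derivative - \<kappa> * s t / (rho e t)\<^sup>2) (at t)" for t
  proof -
    have "(c has_real_derivative (VX e t * rho e t - YX e t * (e * VX e t)) / (rho e t * rho e t)) (at t)"
      unfolding c_def using rn by (auto intro!: derivative_eq_intros Y_deriv assms)
    moreover have "rho e t * (VX e t * rho e t - YX e t * (e * VX e t)) = - \<kappa> * YY e t"
      using yv[of t] Y_angular_momentum[OF assms, of t] YX_YY_sq[OF assms, of t]
      unfolding \<kappa>_def[symmetric] by algebra
    hence "VX e t * rho e t - YX e t * (e * VX e t) = - \<kappa> * s t"
      using rn[of t] unfolding s_def by (simp add: field_simps)
    ultimately show ?thesis by (simp add: power2_eq_square)
  qed
  have s': "(s has_real_derivative \<kappa> * c t / (rho e t)\<^sup>2) (at t)" for t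
  proof -
    have "(s has_real_derivative (VY e t * rho e t - YY e t * (e * VX e t)) / (rho e t * rho e t)) (at t)"
      unfolding s_def using rn by (auto intro!: derivative_eq_intros Y_deriv assms)
    moreover have "rho e t * (VY e t * rho e t - YY e t * (e * VX e t)) = \<kappa> * YX e t"
      using yv[of t] Y_angular_momentum[OF assms, of t] YX_YY_sq[OF assms, of t]
      unfolding \<kappa>_def[symmetric] by algebra
    hence "VY e t * rho e t - YY e t * (e * VX e t) = \<kappa> * c t"
      using rn[of t] unfolding c_def by (simp add: field_simps)
    ultimately show ?thesis by (simp add: power2_eq_square)
  qed
  define Z where "Z = (\<lambda>t. 3 / \<kappa> ^ 3 * (s t * c t - e * (s t - 2/3 * s t ^ 3)))"
  have "(Z has_real_derivative QXX e t - QYY e t) (at t)" for t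
  proof -
    let ?r = "rho e t"
    have "(Z has_real_derivative 3 / \<kappa> ^ 3 * ((\<kappa> * c t / ?r\<^sup>2 * c t + s t * (- \<kappa> * s t / ?r\<^sup>2))
       - e * (\<kappa> * c t / ?r\<^sup>2 - 2/3 * (3 * s t ^ 2 * (\<kappa> * c t / ?r\<^sup>2))))) (at t)"
      unfolding Z_def by (rule DERIV_cmult) (auto intro!: derivative_eq_intros c' s')
    also have "(\<kappa> * c t / ?r\<^sup>2 * c t + s t * (- \<kappa> * s t / ?r\<^sup>2))
       - e * (\<kappa> * c t / ?r\<^sup>2 - 2/3 * (3 * s t ^ 2 * (\<kappa> * c t / ?r\<^sup>2)))
       = \<kappa> / ?r\<^sup>2 * ((c t * c t - s t * s t) - e * c t * (1 - 2 * (s t * s t)))"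
      by (simp add: algebra_simps power2_eq_square)
    also have "1 - 2 * (s t * s t) = c t * c t - s t * s t" using cs[of t] by simp
    also have "(c t * c t - s t * s t) - e * c t * (c t * c t - s t * s t) = (c t * c t - s t * s t) * (1 - e * c t)"
      by (simp add: algebra_simps)
    \<comment> \<open>The polar equation of the ellipse,
      \<open>rho = \<kappa>^2 / (1 - e c)\<close>.\<close>
    also have "1 - e * c t = \<kappa>\<^sup>2 / ?r"
      using rn[of t] \<kappa>(2) unfolding c_def YX_def rho_def
      by (simp add: field_simps power2_eq_square)
    also have "3 / \<kappa> ^ 3 * (\<kappa> / ?r\<^sup>2 * ((c t * c t - s t * s t) * (\<kappa>\<^sup>2 / ?r))) = QXX e t - QYY e t"
      using \<kappa>(1) rn[of t] unfolding QXX_def QYY_def c_def s_def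
      by (simp add: field_simps eval_nat_numeral)
    finally show ?thesis .
  qed
  from prim_unique[OF this, of "2 * pi"] Q_continuous[OF assms]
  have "prim (\<lambda>t. QXX e t - QYY e t) (2 * pi) = Z (2 * pi) - Z 0"
    by (auto intro: continuous_intros)
  also have "\<dots> = 0"
    using Y_periodic[OF assms, of 0] unfolding Z_def c_def s_def by simp
  finally show ?thesis .
qed

lemma prim_QXX_eq_QYY:
  assumes "0 \<le> e" "e < 1"
  shows "prim (QXX e) (2 * pi) = prim (QYY e) (2 * pi)"
  using prim_QXX_minus_QYY[OF assms] prim_diff[OF Q_continuous(1,3)[OF assms]] by simp

text \<open>The diagonal entries add up to \<open>(3 - 2) / rho^3 \<ge> 1/8\<close>, and by
  \<open>prim_QXX_eq_QYY\<close> each contributes half of the integral.\<close>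

lemma prim_QXX_ge:
  assumes "0 \<le> e" "e < 1"
  shows "pi / 8 \<le> prim (QXX e) (2 * pi)"
proof -
  have "prim (\<lambda>t. 1/8) (2 * pi) \<le> prim (\<lambda>t. QXX e t + QYY e t) (2 * pi)"
  proof (rule prim_mono)
    fix t
    have r: "rho e t > 0" "rho e t \<le> 2" using rho_pos[OF assms] rho_bounds(2)[OF assms(1) order_refl assms(2)] by auto
    have "QXX e t + QYY e t = (3 * ((YX e t)\<^sup>2 + (YY e t)\<^sup>2) / (rho e t)\<^sup>2 - 2) / rho e t ^ 3"
      unfolding QXX_def QYY_def by (simp add: add_divide_distrib diff_divide_distrib)
    also have "\<dots> = 1 / rho e t ^ 3" unfolding YX_YY_sq[OF assms] using r by simp
    also have "1 / rho e t ^ 3 \<ge> 1 / 2 ^ 3" by (intro frac_le power_mono) (use r in auto)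
    finally show "1/8 \<le> QXX e t + QYY e t" by simp
  qed (auto intro!: continuous_intros Q_continuous[OF assms])
  thus ?thesis using prim_QXX_eq_QYY[OF assms]
    by (simp add: prim_add[OF Q_continuous(1,3)[OF assms]] prim_const)
qed

section \<open>Orbital elements as functions of the polar angle\<close>

text \<open>
  A curve gives the elements at polar angle \<open>x\<close>: \<open>gW\<close> is the logarithm of the angular momentum \<open>cW\<close>
  up to a constant, \<open>(aW, bW)\<close> the eccentricity vector. On an orbit with these osculating elements,
  \<open>rW = cW\<^sup>2 / ((1 - m) DW)\<close> is the distance from the primary and \<open>dt/dx = rW\<^sup>2 / cW = lamW hW\<close>; the factor
  \<open>lamW\<close> makes \<open>k\<close> turns take time \<open>2\<pi>\<close>. \<open>KW\<close> is the torque, and \<open>m G1\<close>, \<open>m G2\<close>, \<open>m G3\<close> are the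
  derivatives of \<open>gW\<close>, \<open>aW\<close>, \<open>bW\<close> with respect to \<open>x\<close> that the perturbed Kepler equation prescribes.
\<close>

type_synonym curve = "real \<Rightarrow>\<^sub>C (real \<times> real \<times> real)"

abbreviation turns :: "nat \<Rightarrow> real" where "turns k \<equiv> 2 * pi * real k"

definition gW :: "curve \<Rightarrow> real \<Rightarrow> real" where "gW W x = fst (apply_bcontfun W x)"
definition aW :: "curve \<Rightarrow> real \<Rightarrow> real" where "aW W x = fst (snd (apply_bcontfun W x))"
definition bW :: "curve \<Rightarrow> real \<Rightarrow> real" where "bW W x = snd (snd (apply_bcontfun W x))"
definition DW :: "curve \<Rightarrow> real \<Rightarrow> real" where "DW W x = 1 + aW W x * cos x + bW W x * sin x"
definition hW :: "curve \<Rightarrow> real \<Rightarrow> real" where "hW W x = exp (3 * gW W x) / (DW W x)\<^sup>2"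
definition lamW :: "nat \<Rightarrow> curve \<Rightarrow> real" where "lamW k W = 2 * pi / prim (hW W) (turns k)"
definition tW :: "nat \<Rightarrow> curve \<Rightarrow> real \<Rightarrow> real" where "tW k W x = lamW k W * prim (hW W) x"
definition cW :: "nat \<Rightarrow> real \<Rightarrow> curve \<Rightarrow> real \<Rightarrow> real" where
  "cW k m W x = root 3 ((1 - m)\<^sup>2 * lamW k W) * exp (gW W x)"
definition rW :: "nat \<Rightarrow> real \<Rightarrow> curve \<Rightarrow> real \<Rightarrow> real" where
  "rW k m W x = (cW k m W x)\<^sup>2 / ((1 - m) * DW W x)"
definition qX :: "nat \<Rightarrow> real \<Rightarrow> curve \<Rightarrow> real \<Rightarrow> real" where "qX k m W x = rW k m W x * cos x"
definition qY :: "nat \<Rightarrow> real \<Rightarrow> curve \<Rightarrow> real \<Rightarrow> real" where "qY k m W x = rW k m W x * sin x"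
definition fX :: "nat \<Rightarrow> real \<Rightarrow> real \<Rightarrow> curve \<Rightarrow> real \<Rightarrow> real" where
  "fX k e m W x = FX e (tW k W x) (qX k m W x) (qY k m W x)"
definition fY :: "nat \<Rightarrow> real \<Rightarrow> real \<Rightarrow> curve \<Rightarrow> real \<Rightarrow> real" where
  "fY k e m W x = FY e (tW k W x) (qX k m W x) (qY k m W x)"
definition KW :: "nat \<Rightarrow> real \<Rightarrow> real \<Rightarrow> curve \<Rightarrow> real \<Rightarrow> real" where
  "KW k e m W x = qX k m W x * fY k e m W x - qY k m W x * fX k e m W x"
definition G1 :: "nat \<Rightarrow> real \<Rightarrow> real \<Rightarrow> curve \<Rightarrow> real \<Rightarrow> real" where
  "G1 k e m W x = lamW k W * hW W x * (KW k e m W x / cW k m W x)"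
definition G2 :: "nat \<Rightarrow> real \<Rightarrow> real \<Rightarrow> curve \<Rightarrow> real \<Rightarrow> real" where
  "G2 k e m W x = lamW k W * hW W x *
     ((cos x + aW W x) * (KW k e m W x / cW k m W x) + cW k m W x * fY k e m W x / (1 - m))"
definition G3 :: "nat \<Rightarrow> real \<Rightarrow> real \<Rightarrow> curve \<Rightarrow> real \<Rightarrow> real" where
  "G3 k e m W x = lamW k W * hW W x *
     ((sin x + bW W x) * (KW k e m W x / cW k m W x) - cW k m W x * fX k e m W x / (1 - m))"
definition meanG3 :: "nat \<Rightarrow> real \<Rightarrow> real \<Rightarrow> curve \<Rightarrow> real" where
  "meanG3 k e m W = prim (G3 k e m W) (turns k) / (turns k)"

text \<open>The bound \<open>3/8\<close> leaves room \<open>1/8\<close> around every initial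
  eccentricity in \<open>[-1/4, 1/4]\<close>, and \<open>3/8 + 1/8 = 1/2\<close> keeps
  \<open>DW\<close> away from zero. The parities express invariance under the reversal.\<close>

definition Wdom :: "nat \<Rightarrow> curve set" where
  "Wdom k = {W. \<forall>x. \<bar>gW W x\<bar> \<le> 1/8 \<and> \<bar>aW W x\<bar> \<le> 3/8 \<and> \<bar>bW W x\<bar> \<le> 1/8 \<and>
     gW W (x + turns k) = gW W x \<and> aW W (x + turns k) = aW W x \<and>
     bW W (x + turns k) = bW W x \<and>
     gW W (- x) = gW W x \<and> aW W (- x) = aW W x \<and> bW W (- x) = - bW W x}"

lemma WdomD:
  assumes "W \<in> Wdom k"
  shows "\<bar>gW W x\<bar> \<le> 1/8" "\<bar>aW W x\<bar> \<le> 3/8" "\<bar>bW W x\<bar> \<le> 1/8"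
    "gW W (x + turns k) = gW W x" "aW W (x + turns k) = aW W x"
    "bW W (x + turns k) = bW W x"
    "gW W (- x) = gW W x" "aW W (- x) = aW W x" "bW W (- x) = - bW W x"
  using assms unfolding Wdom_def by blast+

lemma continuous_curve [continuous_intros]:
  "continuous_on S (gW W)" "continuous_on S (aW W)" "continuous_on S (bW W)"
  unfolding gW_def[abs_def] aW_def[abs_def] bW_def[abs_def]
  by (intro continuous_on_fst continuous_on_snd continuous_on_apply_bcontfun)+

lemma DW_bounds:
  assumes "W \<in> Wdom k"
  shows "1/2 \<le> DW W x" "DW W x \<le> 3/2"
proof -
  have "\<bar>aW W x * cos x\<bar> \<le> 3/8 * 1" "\<bar>bW W x * sin x\<bar> \<le> 1/8 * 1"
    unfolding abs_mult by (intro mult_mono WdomD[OF assms]; simp)+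
  thus "1/2 \<le> DW W x" "DW W x \<le> 3/2" unfolding DW_def by linarith+
qed

lemma exp3g_bounds:
  assumes "W \<in> Wdom k"
  shows "5/8 \<le> exp (3 * gW W x)" "exp (3 * gW W x) \<le> 8/5"
proof -
  have g: "- 3/8 \<le> 3 * gW W x" "3 * gW W x \<le> 3/8" using WdomD(1)[OF assms, of x] by linarith+
  show "5/8 \<le> exp (3 * gW W x)" using exp_ge_add_one_self[of "3 * gW W x"] g by linarith
  have "exp (3 * gW W x) \<le> exp (3/8)" using g by simp
  also have "\<dots> \<le> 8/5" using exp_bound[of "3/8"] by (simp add: power2_eq_square)
  finally show "exp (3 * gW W x) \<le> 8/5" .
qed

lemma hW_bounds:
  assumes "W \<in> Wdom k"
  shows "1/4 \<le> hW W x" "hW W x \<le> 7"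
proof -
  have D: "(1/2)\<^sup>2 \<le> (DW W x)\<^sup>2" "(DW W x)\<^sup>2 \<le> (3/2)\<^sup>2"
    using DW_bounds[OF assms, of x] by (auto intro!: power_mono)
  have "1/4 \<le> (5/8) / (3/2 :: real)\<^sup>2" by (simp add: power2_eq_square)
  also have "\<dots> \<le> hW W x" unfolding hW_def
    by (intro frac_le) (use exp3g_bounds[OF assms, of x] D DW_bounds[OF assms, of x] in auto)
  finally show "1/4 \<le> hW W x" .
  have "hW W x \<le> (8/5) / (1/2)\<^sup>2" unfolding hW_def
    by (intro frac_le) (use exp3g_bounds[OF assms, of x] D DW_bounds[OF assms, of x] in auto)
  also have "\<dots> \<le> 7" by (simp add: power2_eq_square)
  finally show "hW W x \<le> 7" .
qed

lemma continuous_hW: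
  assumes "W \<in> Wdom k"
  shows "continuous_on S (DW W)" "continuous_on S (hW W)"
proof -
  show D: "continuous_on S (DW W)"
    unfolding DW_def[abs_def] by (intro continuous_intros)
  have "DW W x \<noteq> 0" for x using DW_bounds(1)[OF assms, of x] by linarith
  thus "continuous_on S (hW W)"
    unfolding hW_def[abs_def] by (intro continuous_intros D) auto
qed

lemma prim_hW_bounds:
  assumes "W \<in> Wdom k" "x \<ge> 0"
  shows "x / 4 \<le> prim (hW W) x" "prim (hW W) x \<le> 7 * x"
proof -
  have "prim (\<lambda>x. 1/4) x \<le> prim (hW W) x" "prim (hW W) x \<le> prim (\<lambda>x. 7) x"
    by (rule prim_mono; use continuous_hW[OF assms(1)] assms(2) hW_bounds[OF assms(1)] in simp)+
  thus "x / 4 \<le> prim (hW W) x" "prim (hW W) x \<le> 7 * x" by (simp_all add: prim_const)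
qed

context
  fixes k :: nat
  assumes k1: "k \<ge> 1"
begin

lemma lamW_bounds:
  assumes W: "W \<in> Wdom k"
  shows "1 / (7 * k) \<le> lamW k W" "lamW k W \<le> 4 / k"
proof -
  have p: "0 < turns k" using k1 by simp
  note b = prim_hW_bounds[OF W, of "turns k"]
  have "2 * pi / (7 * (turns k)) \<le> lamW k W" unfolding lamW_def
    by (intro frac_le) (use b p in auto)
  thus "1 / (7 * k) \<le> lamW k W" by simp
  have "lamW k W \<le> 2 * pi / ((turns k) / 4)" unfolding lamW_def
    by (intro frac_le) (use b p in auto)
  thus "lamW k W \<le> 4 / k" by simp
qed

lemma lamW_pos: "W \<in> Wdom k \<Longrightarrow> lamW k W > 0"
  using lamW_bounds(1)[of W] k1 by (intro less_le_trans[OF _ lamW_bounds(1)]) auto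

lemma trig_period [simp]:
  "cos (x + turns k) = cos x" "sin (x + turns k) = sin x"
proof -
  have "cos (turns k) = 1" "sin (turns k) = 0"
    using cos_2npi[of k] sin_2npi[of k] by (metis mult.assoc mult.commute)+
  thus "cos (x + turns k) = cos x" "sin (x + turns k) = sin x"
    by (simp_all add: cos_add sin_add)
qed

lemma hW_symm:
  assumes W: "W \<in> Wdom k"
  shows "DW W (x + turns k) = DW W x" "DW W (- x) = DW W x"
    "hW W (x + turns k) = hW W x" "hW W (- x) = hW W x"
proof -
  show "DW W (x + turns k) = DW W x" "DW W (- x) = DW W x"
    unfolding DW_def by (simp_all add: WdomD[OF W])
  thus "hW W (x + turns k) = hW W x" "hW W (- x) = hW W x"
    unfolding hW_def by (simp_all add: WdomD[OF W])
qed

lemma tW_deriv: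
  assumes W: "W \<in> Wdom k"
  shows "(tW k W has_real_derivative lamW k W * hW W x) (at x)"
  unfolding tW_def[abs_def] by (intro DERIV_cmult has_derivative_prim continuous_hW[OF W])

lemma tW_speed_pos: "W \<in> Wdom k \<Longrightarrow> lamW k W * hW W x > 0"
  using lamW_pos[of W] hW_bounds(1)[of W k x] by simp

lemma tW_symm:
  assumes W: "W \<in> Wdom k"
  shows "tW k W (x + turns k) = tW k W x + 2 * pi" "tW k W (- x) = - tW k W x" "tW k W 0 = 0"
proof -
  have "prim (hW W) (turns k) > 0"
    using prim_hW_bounds(1)[OF W, of "turns k"] k1 by (intro less_le_trans[OF _ prim_hW_bounds(1)[OF W]]) auto
  hence "lamW k W * prim (hW W) (turns k) = 2 * pi" by (simp add: lamW_def)
  thus "tW k W (x + turns k) = tW k W x + 2 * pi"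
    unfolding tW_def prim_add_period[OF continuous_hW(2)[OF W] hW_symm(3)[OF W]]
    by (simp add: distrib_left)
  show "tW k W (- x) = - tW k W x"
    unfolding tW_def prim_uminus_even[OF continuous_hW(2)[OF W] hW_symm(4)[OF W]] by simp
  show "tW k W 0 = 0" by (simp add: tW_def)
qed

lemma cW_cube: "W \<in> Wdom k \<Longrightarrow> cW k m W x ^ 3 = (1 - m)\<^sup>2 * lamW k W * exp (3 * gW W x)"
  unfolding cW_def by (simp add: power_mult_distrib odd_real_root_pow exp_of_nat_mult[of 3, simplified])

lemma cW_pos:
  assumes W: "W \<in> Wdom k" and m: "0 \<le> m" "m \<le> 1/2"
  shows "cW k m W x > 0"
  using lamW_pos[OF W] m by (simp add: cW_def)

lemma rW_cube:
  assumes W: "W \<in> Wdom k" and m: "0 \<le> m" "m \<le> 1/2"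
  shows "rW k m W x ^ 3 = (1 - m) * (lamW k W * exp (3 * gW W x))\<^sup>2 / DW W x ^ 3"
proof -
  have "rW k m W x ^ 3 = (cW k m W x ^ 3)\<^sup>2 / ((1 - m) ^ 3 * DW W x ^ 3)"
    unfolding rW_def by (simp add: power_divide power_mult_distrib flip: power_mult)
  also have "\<dots> = (1 - m) ^ 4 * (lamW k W * exp (3 * gW W x))\<^sup>2 / ((1 - m) ^ 3 * DW W x ^ 3)"
    unfolding cW_cube[OF W] by (simp add: power_mult_distrib flip: power_mult)
  also have "\<dots> = (1 - m) * (lamW k W * exp (3 * gW W x))\<^sup>2 / DW W x ^ 3"
    using m by (simp add: eval_nat_numeral)
  finally show ?thesis .
qed

lemma rW_pos:
  assumes W: "W \<in> Wdom k" and m: "0 \<le> m" "m \<le> 1/2"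
  shows "rW k m W x > 0"
  using cW_pos[OF W m, of x] DW_bounds(1)[OF W, of x] m unfolding rW_def by (simp add: divide_pos_pos)

text \<open>Kepler's third law up to constants: \<open>k\<close> turns in time \<open>2\<pi>\<close>
  force \<open>r^3\<close> to be of order \<open>1/k^2\<close>. The numbers result from
  \<open>1/4 \<le> hW \<le> 7\<close>, which confines \<open>lamW\<close> to
  \<open>[1/(7k), 4/k]\<close>.\<close>

lemma rW_bounds:
  assumes W: "W \<in> Wdom k" and m: "0 \<le> m" "m \<le> 1/2"
  shows "1 / (1000 * k ^ 2) \<le> rW k m W x ^ 3" "rW k m W x ^ 3 \<le> 330 / k ^ 2"
proof -
  have k: "real k > 0" using k1 by simp
  note b = lamW_bounds[OF W] exp3g_bounds[OF W, of x] DW_bounds[OF W, of x]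
  have le: "1 / (7 * k) * (5/8) \<le> lamW k W * exp (3 * gW W x)"
    by (intro mult_mono) (use b lamW_pos[OF W] in auto)
  have ge: "lamW k W * exp (3 * gW W x) \<le> 4 / k * (8/5)"
    by (intro mult_mono) (use b k in auto)
  have p: "0 < lamW k W * exp (3 * gW W x)" using lamW_pos[OF W] by simp
  have D: "(1/2) ^ 3 \<le> DW W x ^ 3" "DW W x ^ 3 \<le> (3/2) ^ 3"
    using b by (auto intro!: power_mono)
  have "1 / (1000 * k ^ 2) \<le> 1/2 * (1 / (7 * k) * (5/8))\<^sup>2 / (3/2) ^ 3"
    using k by (simp add: field_simps power2_eq_square power3_eq_cube)
  also have "\<dots> \<le> rW k m W x ^ 3"
    unfolding rW_cube[OF W m] by (intro frac_le mult_mono power_mono le) (use m b D p in auto)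
  finally show "1 / (1000 * k ^ 2) \<le> rW k m W x ^ 3" .
  have "rW k m W x ^ 3 \<le> 1 * (4 / k * (8/5))\<^sup>2 / (1/2) ^ 3"
    unfolding rW_cube[OF W m] by (intro frac_le mult_mono power_mono ge) (use m b D p k in auto)
  also have "\<dots> \<le> 330 / k ^ 2"
    using k by (simp add: field_simps power2_eq_square power3_eq_cube)
  finally show "rW k m W x ^ 3 \<le> 330 / k ^ 2" .
qed

text \<open>This is why \<open>cW\<close> contains a cube root:
  \<open>r^2 / c = c^3 / ((1 - m) D)^2\<close>, and the cube of \<open>cW\<close> supplies
  \<open>(1 - m)^2\<close>. The time \<open>tW\<close> is thus determined by the curve without
  reference to the mass.\<close>

lemma r_c_relation:
  assumes W: "W \<in> Wdom k" and m: "0 \<le> m" "m \<le> 1/2"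
  shows "lamW k W * hW W x = (rW k m W x)\<^sup>2 / cW k m W x"
proof -
  have c: "cW k m W x \<noteq> 0" using cW_pos[OF W m, of x] by simp
  have D: "DW W x \<noteq> 0" using DW_bounds(1)[OF W, of x] by auto
  have "(rW k m W x)\<^sup>2 / cW k m W x = cW k m W x ^ 3 / ((1 - m)\<^sup>2 * (DW W x)\<^sup>2)"
    unfolding rW_def using c by (simp add: power_divide power_mult_distrib eval_nat_numeral)
  also have "\<dots> = lamW k W * hW W x"
    unfolding cW_cube[OF W] hW_def using m D by (simp add: field_simps)
  finally show ?thesis ..
qed

end

section \<open>Contraction in the space of curves\<close>

lemma periodic_reduce:
  fixes f :: "real \<Rightarrow> 'a"
  assumes per: "\<And>x. f (x + p) = f x" and p: "p > 0"
  shows "\<exists>y\<in>{0..p}. f x = f y"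
proof -
  interpret periodic_fun_simple f p
    by unfold_locales (rule per)
  have "f (x - of_int \<lfloor>x / p\<rfloor> * p) = f x"
    by (rule minus_of_int)
  moreover have "x - of_int \<lfloor>x / p\<rfloor> * p \<in> {0..p}"
    using floor_divide_lower[OF p, of x] floor_divide_upper[OF p, of x] by (auto simp: algebra_simps)
  ultimately show ?thesis by metis
qed

lemma dist_Pair_le: "dist (x, y) (x', y') \<le> dist x x' + dist y y'"
  unfolding dist_Pair_Pair by (rule sqrt_sum_squares_le_sum) auto

lemma FX_continuous:
  assumes e: "0 \<le> e" "e < 1" and cont: "continuous_on S t" "continuous_on S a" "continuous_on S b"
    and sep: "\<And>x. x \<in> S \<Longrightarrow> sqrt ((YX e (t x) - a x)\<^sup>2 + (YY e (t x) - b x)\<^sup>2) \<noteq> 0"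
  shows "continuous_on S (\<lambda>x. FX e (t x) (a x) (b x))" "continuous_on S (\<lambda>x. FY e (t x) (a x) (b x))"
proof -
  have Y: "continuous_on UNIV (YX e)" "continuous_on UNIV (YY e)" "continuous_on UNIV (rho e)"
    using Y_deriv[OF e] by (meson DERIV_isCont continuous_at_imp_continuous_on)+
  have "continuous_on S (\<lambda>x. YX e (t x))" "continuous_on S (\<lambda>x. YY e (t x))" "continuous_on S (\<lambda>x. rho e (t x))"
    by (rule continuous_on_compose2[OF Y(1) cont(1)] continuous_on_compose2[OF Y(2) cont(1)]
        continuous_on_compose2[OF Y(3) cont(1)]; simp)+
  moreover have "rho e s \<noteq> 0" for s using rho_pos[OF e, of s] by simp
  ultimately show "continuous_on S (\<lambda>x. FX e (t x) (a x) (b x))" "continuous_on S (\<lambda>x. FY e (t x) (a x) (b x))"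
    unfolding FX_def FY_def using sep by (auto intro!: continuous_intros cont)
qed

text \<open>The unperturbed solution: a Kepler ellipse whose apsides lie on the symmetry axis. A
  negative \<open>s\<close> exchanges pericentre and apocentre.\<close>

definition cconst :: "real \<Rightarrow> curve" where "cconst s = Bcontfun (\<lambda>_. (0, s, 0))"

lemma cconst_apply:
  "gW (cconst s) x = 0" "aW (cconst s) x = s" "bW (cconst s) x = 0"
  unfolding gW_def aW_def bW_def cconst_def
  by (simp_all add: Bcontfun_inverse const_bcontfun)

lemma cconst_Wdom: "s \<in> {-1/4..1/4} \<Longrightarrow> cconst s \<in> Wdom k"
  unfolding Wdom_def by (auto simp: cconst_apply)

lemma curve_eval_le:
  "\<bar>gW W x - gW W' x\<bar> \<le> dist W W'" "\<bar>aW W x - aW W' x\<bar> \<le> dist W W'" "\<bar>bW W x - bW W' x\<bar> \<le> dist W W'"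
proof -
  let ?u = "apply_bcontfun W x" and ?v = "apply_bcontfun W' x"
  have d: "dist ?u ?v \<le> dist W W'" by (rule dist_bounded)
  have s: "dist (snd ?u) (snd ?v) \<le> dist ?u ?v" by (rule dist_snd_le)
  show "\<bar>gW W x - gW W' x\<bar> \<le> dist W W'"
    using dist_fst_le[of ?u ?v] d unfolding gW_def dist_real_def by linarith
  show "\<bar>aW W x - aW W' x\<bar> \<le> dist W W'"
    using dist_fst_le[of "snd ?u" "snd ?v"] s d unfolding aW_def dist_real_def by linarith
  show "\<bar>bW W x - bW W' x\<bar> \<le> dist W W'"
    using dist_snd_le[of "snd ?u" "snd ?v"] s d unfolding bW_def dist_real_def by linarith
qed

lemma complete_Wdom: "complete (Wdom k)"
proof -
  have c: "continuous_on UNIV (\<lambda>W. gW W x)" "continuous_on UNIV (\<lambda>W. aW W x)" "continuous_on UNIV (\<lambda>W. bW W x)" for x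
    by (rule lipschitz_on_continuous_on[where L = 1], rule lipschitz_onI;
        use curve_eval_le in \<open>simp add: dist_real_def\<close>)+
  have "closed (Wdom k)"
    unfolding Wdom_def
    by (intro closed_Collect_all closed_Collect_conj closed_Collect_le closed_Collect_eq
        continuous_intros c)
  thus ?thesis by (simp add: complete_eq_closed)
qed

definition N3 :: "nat \<Rightarrow> real \<Rightarrow> real \<Rightarrow> curve \<Rightarrow> real \<Rightarrow> real" where
  "N3 k e m W x = prim (G3 k e m W) x - meanG3 k e m W * x"

definition NW :: "nat \<Rightarrow> real \<Rightarrow> real \<Rightarrow> curve \<Rightarrow> real \<Rightarrow> real \<times> real \<times> real" where
  "NW k e m W x = (prim (G1 k e m W) x, prim (G2 k e m W) x, N3 k e m W x)"

context
  fixes k :: nat and e1 :: real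
  assumes k1: "k \<ge> 1" and e1: "0 \<le> e1" "e1 < 1" and kL: "330 / real k ^ 2 \<le> ((1 - e1) / 2) ^ 3"
begin

lemma period_pos: "0 < turns k" using k1 by simp

text \<open>The purpose of the assumption \<open>kL\<close>: it keeps the orbit within the distance
  that \<open>sep_lower\<close> allows.\<close>

lemma rW_le:
  assumes "W \<in> Wdom k" "0 \<le> m" "m \<le> 1/2"
  shows "rW k m W x \<le> (1 - e1) / 2"
proof -
  have "rW k m W x ^ 3 \<le> ((1 - e1) / 2) ^ 3"
    using rW_bounds(2)[OF k1 assms, of x] kL by simp
  moreover have "0 \<le> (1 - e1) / 2" using e1 by simp
  ultimately show ?thesis by (rule power_le_imp_le_base[of _ 2, unfolded Suc_eq_plus1, simplified])
qed

lemma q_norm: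
  assumes "W \<in> Wdom k" "0 \<le> m" "m \<le> 1/2"
  shows "sqrt ((qX k m W x)\<^sup>2 + (qY k m W x)\<^sup>2) = rW k m W x"
proof -
  have "(qX k m W x)\<^sup>2 + (qY k m W x)\<^sup>2 = (rW k m W x)\<^sup>2 * ((cos x)\<^sup>2 + (sin x)\<^sup>2)"
    unfolding qX_def qY_def by (simp only: power_mult_distrib distrib_left)
  thus ?thesis using rW_pos[OF k1 assms, of x] by simp
qed

lemma q_sep:
  assumes "W \<in> Wdom k" "0 \<le> m" "m \<le> 1/2" "0 \<le> e" "e \<le> e1"
  shows "(1 - e1) / 2 \<le> sqrt ((YX e t - qX k m W x)\<^sup>2 + (YY e t - qY k m W x)\<^sup>2)"
  by (rule sep_lower[OF e1 assms(4,5)]) (simp only: q_norm[OF assms(1-3)] rW_le[OF assms(1-3)])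

context
  fixes W :: curve and m e :: real
  assumes W: "W \<in> Wdom k" and m: "0 \<le> m" "m \<le> 1/2" and e: "0 \<le> e" "e \<le> e1"
begin

lemma e_less: "e < 1" using e e1 by simp

lemma cont_basic [continuous_intros]:
  "continuous_on S (tW k W)" "continuous_on S (cW k m W)" "continuous_on S (rW k m W)"
  "continuous_on S (qX k m W)" "continuous_on S (qY k m W)"
proof -
  show "continuous_on S (tW k W)"
    using tW_deriv[OF k1 W] by (meson DERIV_isCont continuous_at_imp_continuous_on)
  show c: "continuous_on S (cW k m W)" unfolding cW_def[abs_def] by (intro continuous_intros)
  have "(1 - m) * DW W x \<noteq> 0" for x using DW_bounds(1)[OF W, of x] m by auto
  thus r: "continuous_on S (rW k m W)" unfolding rW_def[abs_def]
    by (intro continuous_intros c continuous_hW(1)[OF W]) auto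
  show "continuous_on S (qX k m W)" "continuous_on S (qY k m W)"
    unfolding qX_def[abs_def] qY_def[abs_def] by (intro continuous_intros r)+
qed

lemma cont_f [continuous_intros]: "continuous_on S (fX k e m W)" "continuous_on S (fY k e m W)"
proof -
  have *: "sqrt ((YX e (tW k W x) - qX k m W x)\<^sup>2 + (YY e (tW k W x) - qY k m W x)\<^sup>2) \<noteq> 0" for x
    using q_sep[OF W m e, of "tW k W x" x] e1 by auto
  show "continuous_on S (fX k e m W)" "continuous_on S (fY k e m W)"
    unfolding fX_def[abs_def] fY_def[abs_def]
    by (rule FX_continuous[OF e(1) e_less]; intro cont_basic * )+
qed

lemma cont_G [continuous_intros]:
  "continuous_on S (G1 k e m W)" "continuous_on S (G2 k e m W)" "continuous_on S (G3 k e m W)"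
proof -
  have c: "cW k m W x \<noteq> 0" for x using cW_pos[OF k1 W m, of x] by simp
  show "continuous_on S (G1 k e m W)" "continuous_on S (G2 k e m W)" "continuous_on S (G3 k e m W)"
    unfolding G1_def[abs_def] G2_def[abs_def] G3_def[abs_def] KW_def[abs_def]
    by (intro continuous_intros continuous_hW(2)[OF W] ballI c; use m in simp)+
qed

lemma basic_symm:
  "cW k m W (x + turns k) = cW k m W x" "cW k m W (- x) = cW k m W x"
  "rW k m W (x + turns k) = rW k m W x" "rW k m W (- x) = rW k m W x"
  "qX k m W (x + turns k) = qX k m W x" "qX k m W (- x) = qX k m W x"
  "qY k m W (x + turns k) = qY k m W x" "qY k m W (- x) = - qY k m W x"
proof -
  show c: "cW k m W (x + turns k) = cW k m W x" "cW k m W (- x) = cW k m W x"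
    unfolding cW_def by (simp_all add: WdomD[OF W])
  thus r: "rW k m W (x + turns k) = rW k m W x" "rW k m W (- x) = rW k m W x"
    unfolding rW_def by (simp_all add: hW_symm[OF k1 W])
  show "qX k m W (x + turns k) = qX k m W x" "qX k m W (- x) = qX k m W x"
    "qY k m W (x + turns k) = qY k m W x" "qY k m W (- x) = - qY k m W x"
    unfolding qX_def qY_def by (simp_all add: r trig_period[OF k1])
qed

lemma f_symm:
  "fX k e m W (x + turns k) = fX k e m W x" "fX k e m W (- x) = fX k e m W x"
  "fY k e m W (x + turns k) = fY k e m W x" "fY k e m W (- x) = - fY k e m W x"
  unfolding fX_def fY_def tW_symm[OF k1 W] basic_symm
  by (simp_all add: e(1) e_less)

lemma G_symm:
  "G1 k e m W (x + turns k) = G1 k e m W x" "G1 k e m W (- x) = - G1 k e m W x"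
  "G2 k e m W (x + turns k) = G2 k e m W x" "G2 k e m W (- x) = - G2 k e m W x"
  "G3 k e m W (x + turns k) = G3 k e m W x" "G3 k e m W (- x) = G3 k e m W x"
  unfolding G1_def G2_def G3_def KW_def basic_symm f_symm hW_symm[OF k1 W] WdomD(4-9)[OF W]
    trig_period[OF k1] cos_minus sin_minus
  by (simp_all add: diff_divide_distrib add_divide_distrib algebra_simps)

end

section \<open>Uniform Lipschitz dependence on the curve\<close>

definition Jdom :: "(real \<times> real) set" where "Jdom = {0..e1} \<times> {0..1/2}"
text \<open>The angle is confined to one period to keep the bounds finite; periodicity extends them
  to all angles in \<open>NW_bounds\<close>.\<close>

definition Idom :: "((real \<times> real) \<times> real) set" where "Idom = Jdom \<times> {0..turns k}"

abbreviation ie :: "(real \<times> real) \<times> real \<Rightarrow> real" where "ie i \<equiv> fst (fst i)"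
abbreviation im :: "(real \<times> real) \<times> real \<Rightarrow> real" where "im i \<equiv> snd (fst i)"
abbreviation BLW :: "((real \<times> real) \<times> real \<Rightarrow> curve \<Rightarrow> real) \<Rightarrow> bool" where "BLW \<equiv> BL Idom (Wdom k)"

lemma IdomD:
  assumes "i \<in> Idom"
  shows "0 \<le> fst (fst i)" "fst (fst i) \<le> e1" "0 \<le> snd (fst i)" "snd (fst i) \<le> 1/2"
    "0 \<le> snd i" "snd i \<le> turns k" "fst i \<in> Jdom"
  using assms unfolding Idom_def Jdom_def by auto

lemma BL_curve:
  "BLW (\<lambda>i W. gW W (snd i))" "BLW (\<lambda>i W. aW W (snd i))"
  "BLW (\<lambda>i W. bW W (snd i))"
proof -
  have "\<bar>gW W x\<bar> \<le> 3/8" "\<bar>aW W x\<bar> \<le> 3/8" "\<bar>bW W x\<bar> \<le> 3/8" if "W \<in> Wdom k" for W x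
    using WdomD(1-3)[OF that, of x] by linarith+
  thus "BLW (\<lambda>i W. gW W (snd i))" "BLW (\<lambda>i W. aW W (snd i))"
    "BLW (\<lambda>i W. bW W (snd i))"
    by (auto intro!: BLI[where B = "3/8" and C = 1] simp: curve_eval_le)
qed

lemma BL_trig: "BLW (\<lambda>i W. cos (snd i))" "BLW (\<lambda>i W. sin (snd i))"
  by (rule BL_const[where C = 1]; simp)+

lemma BL_DW: "BLW (\<lambda>i W. DW W (snd i))"
  unfolding DW_def by (intro BL_add BL_mult BL_curve BL_trig BL_const[where C = 1]) auto

lemma BL_hW: "BLW (\<lambda>i W. hW W (snd i))"
proof -
  have "(1/2)\<^sup>2 \<le> (DW W x)\<^sup>2" if "W \<in> Wdom k" for W x
    using DW_bounds(1)[OF that, of x] by (intro power_mono) auto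
  thus ?thesis unfolding hW_def
    by (intro BL_divide[where \<delta> = "(1/2)\<^sup>2"] BL_exp BL_cmult BL_curve BL_power BL_DW) auto
qed

lemma BL_prim_Idom:
  assumes "BLW (\<lambda>i W. F (fst i) W (snd i))"
    and "\<And>j w. j \<in> Jdom \<Longrightarrow> w \<in> Wdom k \<Longrightarrow> continuous_on UNIV (F j w)"
  shows "BLW (\<lambda>i W. prim (F (fst i) W) (snd i))"
    "BLW (\<lambda>i W. prim (F (fst i) W) (turns k))"
proof -
  show 1: "BLW (\<lambda>i W. prim (F (fst i) W) (snd i))"
    unfolding Idom_def by (rule BL_prim[where F = F, OF assms(1)[unfolded Idom_def] assms(2)])
  have "BLW (\<lambda>i W. prim (F (fst (fst i, turns k)) W) (snd (fst i, turns k)))"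
    by (rule BL_index[OF 1]) (auto simp: Idom_def)
  thus "BLW (\<lambda>i W. prim (F (fst i) W) (turns k))" by simp
qed

lemma BL_prim_hW:
  "BLW (\<lambda>i W. prim (hW W) (snd i))"
  "BLW (\<lambda>i W. prim (hW W) (turns k))"
  by (rule BL_prim_Idom[where F = "\<lambda>_. hW", OF BL_hW continuous_hW(2)]; assumption)+

lemma BL_lamW: "BLW (\<lambda>i W. lamW k W)"
  unfolding lamW_def
proof (rule BL_divide[OF _ BL_prim_hW(2)])
  show "BLW (\<lambda>i W. 2 * pi)" by (rule BL_const[where C = "2 * pi"]) simp
  show "turns k / 4 \<le> prim (hW W) (turns k)" if "W \<in> Wdom k" for W
    by (rule prim_hW_bounds[OF that]) simp
qed (use period_pos in simp)

lemma BL_tW: "BLW (\<lambda>i W. tW k W (snd i))"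
  unfolding tW_def by (rule BL_mult[OF BL_lamW BL_prim_hW(1)])

lemma m_BL: "BLW (\<lambda>i W. 1 - snd (fst i))" "BLW (\<lambda>i W. snd (fst i))"
  by (rule BL_const[where C = 1]; use IdomD in fastforce)+

lemma m2lam_ge:
  assumes "0 \<le> m" "m \<le> 1/2" "W \<in> Wdom k"
  shows "1 / (28 * real k) \<le> (1 - m)\<^sup>2 * lamW k W"
proof -
  have "(1/2)\<^sup>2 * (1 / (7 * real k)) \<le> (1 - m)\<^sup>2 * lamW k W"
    using lamW_bounds(1)[OF k1 assms(3)] by (intro mult_mono power_mono) (use assms in auto)
  thus ?thesis by (simp add: power2_eq_square)
qed

lemma cW_lower: "\<exists>\<delta>>0. \<forall>m W x. 0 \<le> m \<longrightarrow> m \<le> 1/2 \<longrightarrow> W \<in> Wdom k \<longrightarrow> \<delta> \<le> cW k m W x"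
proof (intro exI conjI allI impI)
  let ?\<delta> = "root 3 (1 / (28 * real k)) * (7/8)"
  show "0 < ?\<delta>" using k1 by simp
  fix m x :: real and W assume m: "0 \<le> m" "m \<le> 1/2" and W: "W \<in> Wdom k"
  show "?\<delta> \<le> cW k m W x" unfolding cW_def
  proof (intro mult_mono)
    show "root 3 (1 / (28 * real k)) \<le> root 3 ((1 - m)\<^sup>2 * lamW k W)"
      using m2lam_ge[OF m W] by simp
    show "7/8 \<le> exp (gW W x)"
      using exp_ge_add_one_self[of "gW W x"] WdomD(1)[OF W, of x] by linarith
    show "0 \<le> root 3 ((1 - m)\<^sup>2 * lamW k W)" using lamW_pos[OF k1 W] by simp
  qed simp
qed

lemma BL_cW: "BLW (\<lambda>i W. cW k (im i) W (snd i))"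
  unfolding cW_def
  by (intro BL_mult BL_exp BL_curve BL_root3[where \<delta> = "1 / (28 * real k)"] BL_power m_BL BL_lamW)
    (use k1 m2lam_ge IdomD in auto)

lemma BL_rW: "BLW (\<lambda>i W. rW k (im i) W (snd i))"
proof -
  have "1/2 * (1/2) \<le> (1 - snd (fst i)) * DW W (snd i)" if "i \<in> Idom" "W \<in> Wdom k" for i W
    by (rule mult_mono) (use DW_bounds[OF that(2), of "snd i"] IdomD[OF that(1)] in auto)
  thus ?thesis unfolding rW_def
    by (intro BL_divide[where \<delta> = "1/2 * (1/2)"] BL_power BL_cW BL_mult m_BL BL_DW) auto
qed

lemma BL_q: "BLW (\<lambda>i W. qX k (im i) W (snd i))"
  "BLW (\<lambda>i W. qY k (im i) W (snd i))"
  unfolding qX_def qY_def by (intro BL_mult BL_rW BL_trig)+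

lemma BL_f: "BLW (\<lambda>i W. fX k (ie i) (im i) W (snd i))"
  "BLW (\<lambda>i W. fY k (ie i) (im i) W (snd i))"
  unfolding fX_def fY_def
  by (rule F_BL[OF e1 _ BL_tW BL_q]; use IdomD q_norm rW_le in simp)+

lemma BL_G: "BLW (\<lambda>i W. G1 k (ie i) (im i) W (snd i))"
  "BLW (\<lambda>i W. G2 k (ie i) (im i) W (snd i))"
  "BLW (\<lambda>i W. G3 k (ie i) (im i) W (snd i))"
proof -
  obtain \<delta> where "\<delta> > 0" "\<And>m W x. 0 \<le> m \<Longrightarrow> m \<le> 1/2 \<Longrightarrow> W \<in> Wdom k \<Longrightarrow> \<delta> \<le> cW k m W x"
    using cW_lower by blast
  hence K: "BLW (\<lambda>i W. KW k (ie i) (im i) W (snd i) / cW k (im i) W (snd i))"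
    unfolding KW_def
    by (intro BL_divide[where \<delta> = \<delta>] BL_diff BL_mult BL_q BL_f BL_cW) (use IdomD in auto)
  have A: "BLW (\<lambda>i W. cW k (im i) W (snd i) * fX k (ie i) (im i) W (snd i) / (1 - snd (fst i)))"
    "BLW (\<lambda>i W. cW k (im i) W (snd i) * fY k (ie i) (im i) W (snd i) / (1 - snd (fst i)))"
    by (rule BL_divide[OF BL_mult[OF BL_cW BL_f(1)] m_BL(1), of "1/2"] BL_divide[OF BL_mult[OF BL_cW BL_f(2)] m_BL(1), of "1/2"];
        use IdomD(4) in force)+
  show "BLW (\<lambda>i W. G1 k (ie i) (im i) W (snd i))"
    unfolding G1_def by (intro BL_mult BL_lamW BL_hW K)
  show "BLW (\<lambda>i W. G2 k (ie i) (im i) W (snd i))"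
    "BLW (\<lambda>i W. G3 k (ie i) (im i) W (snd i))"
    unfolding G2_def G3_def
    by (rule BL_mult[OF BL_mult[OF BL_lamW BL_hW] BL_add[OF BL_mult[OF BL_add[OF BL_trig(1) BL_curve(2)] K] A(2)]]
        BL_mult[OF BL_mult[OF BL_lamW BL_hW] BL_diff[OF BL_mult[OF BL_add[OF BL_trig(2) BL_curve(3)] K] A(1)]])+
qed

lemma BL_prim_G:
  "BLW (\<lambda>i W. prim (G1 k (ie i) (im i) W) (snd i))"
  "BLW (\<lambda>i W. prim (G2 k (ie i) (im i) W) (snd i))"
  "BLW (\<lambda>i W. prim (G3 k (ie i) (im i) W) (snd i))"
  "BLW (\<lambda>i W. meanG3 k (ie i) (im i) W)"
proof -
  have c: "continuous_on UNIV (G1 k (fst j) (snd j) W)" "continuous_on UNIV (G2 k (fst j) (snd j) W)"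
    "continuous_on UNIV (G3 k (fst j) (snd j) W)" if "j \<in> Jdom" "W \<in> Wdom k" for j W
    by (rule cont_G; use that in \<open>auto simp: Jdom_def\<close>)+
  show "BLW (\<lambda>i W. prim (G1 k (ie i) (im i) W) (snd i))"
    by (rule BL_prim_Idom(1)[where F = "\<lambda>j. G1 k (fst j) (snd j)"]) (use BL_G c in auto)
  show "BLW (\<lambda>i W. prim (G2 k (ie i) (im i) W) (snd i))"
    by (rule BL_prim_Idom(1)[where F = "\<lambda>j. G2 k (fst j) (snd j)"]) (use BL_G c in auto)
  show "BLW (\<lambda>i W. prim (G3 k (ie i) (im i) W) (snd i))"
    by (rule BL_prim_Idom(1)[where F = "\<lambda>j. G3 k (fst j) (snd j)"]) (use BL_G c in auto)
  have "BLW (\<lambda>i W. prim (G3 k (ie i) (im i) W) (turns k))"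
    by (rule BL_prim_Idom(2)[where F = "\<lambda>j. G3 k (fst j) (snd j)"]) (use BL_G c in auto)
  from BL_cmult[OF this, of "1 / (turns k)"]
  show "BLW (\<lambda>i W. meanG3 k (ie i) (im i) W)"
    unfolding meanG3_def by simp
qed

text \<open>Here the reversal pays off. \<open>G1\<close> and \<open>G2\<close> are odd, so their
  antiderivatives are even and periodic without correction. \<open>G3\<close> is even; its
  antiderivative is odd but gains \<open>turns k * meanG3\<close> per period, and this drift is what
  \<open>N3\<close> removes.\<close>

lemma NW_symm:
  assumes "W \<in> Wdom k" "0 \<le> m" "m \<le> 1/2" "0 \<le> e" "e \<le> e1"
  shows "prim (G1 k e m W) (x + turns k) = prim (G1 k e m W) x"
    "prim (G2 k e m W) (x + turns k) = prim (G2 k e m W) x"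
    "N3 k e m W (x + turns k) = N3 k e m W x"
    "prim (G1 k e m W) (- x) = prim (G1 k e m W) x"
    "prim (G2 k e m W) (- x) = prim (G2 k e m W) x"
    "N3 k e m W (- x) = - N3 k e m W x"
proof -
  note c = cont_G[OF assms, of UNIV] and s = G_symm[OF assms]
  show "prim (G1 k e m W) (x + turns k) = prim (G1 k e m W) x"
    "prim (G2 k e m W) (x + turns k) = prim (G2 k e m W) x"
    using prim_odd_period[OF c(1) s(2,1)] prim_odd_period[OF c(2) s(4,3)] by blast+
  show "prim (G1 k e m W) (- x) = prim (G1 k e m W) x"
    "prim (G2 k e m W) (- x) = prim (G2 k e m W) x"
    using prim_uminus_odd[OF c(1) s(2)] prim_uminus_odd[OF c(2) s(4)] by blast+
  show "N3 k e m W (- x) = - N3 k e m W x"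
    unfolding N3_def prim_uminus_even[OF c(3) s(6)] by simp
  have "meanG3 k e m W * (turns k) = prim (G3 k e m W) (turns k)"
    unfolding meanG3_def using period_pos by simp
  thus "N3 k e m W (x + turns k) = N3 k e m W x"
    unfolding N3_def prim_add_period[OF c(3) s(5)] distrib_left by simp
qed

text \<open>The constant depends on \<open>k\<close> and \<open>e1\<close> but not on
  \<open>e\<close>, \<open>m\<close> or the angle, so the factor \<open>m\<close> in the fixed point
  equation produces a contraction for small \<open>m\<close>, uniformly in the eccentricity.\<close>

lemma NW_bounds:
  "\<exists>C>0. \<forall>e\<in>{0..e1}. \<forall>m\<in>{0..1/2}. \<forall>W\<in>Wdom k. \<forall>W'\<in>Wdom k. \<forall>x.
     \<bar>prim (G1 k e m W) x\<bar> \<le> C \<and> \<bar>prim (G2 k e m W) x\<bar> \<le> C \<and> \<bar>N3 k e m W x\<bar> \<le> C \<and>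
     dist (NW k e m W x) (NW k e m W' x) \<le> C * dist W W' \<and>
     \<bar>meanG3 k e m W - meanG3 k e m W'\<bar> \<le> C * dist W W'"
proof -
  have "BLW (\<lambda>i W. snd i)"
    by (rule BL_const[where C = "turns k"]) (use IdomD in auto)
  hence "BLW (\<lambda>i W. N3 k (ie i) (im i) W (snd i))"
    unfolding N3_def by (intro BL_diff BL_mult BL_prim_G)
  then obtain C3 where C3: "C3 \<ge> 0" "BL_bound C3 Idom (Wdom k) (\<lambda>i W. N3 k (ie i) (im i) W (snd i))"
    by (rule BLE)
  obtain C1 where C1: "C1 \<ge> 0" "BL_bound C1 Idom (Wdom k) (\<lambda>i W. prim (G1 k (ie i) (im i) W) (snd i))"
    using BLE[OF BL_prim_G(1)] .
  obtain C2 where C2: "C2 \<ge> 0" "BL_bound C2 Idom (Wdom k) (\<lambda>i W. prim (G2 k (ie i) (im i) W) (snd i))"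
    using BLE[OF BL_prim_G(2)] .
  obtain C4 where C4: "C4 \<ge> 0" "BL_bound C4 Idom (Wdom k) (\<lambda>i W. meanG3 k (ie i) (im i) W)"
    using BLE[OF BL_prim_G(4)] .
  define C where "C = C1 + C2 + C3 + C4 + 1"
  have C: "C1 \<le> C" "C2 \<le> C" "C3 \<le> C" "C4 \<le> C" "C1 + C2 + C3 \<le> C" "C > 0"
    unfolding C_def using C1(1) C2(1) C3(1) C4(1) by linarith+
  show ?thesis
  proof (rule exI[of _ C], intro conjI ballI allI)
    show "C > 0" by (rule C)
    fix e m :: real and W W' :: curve and x :: real
    assume em: "e \<in> {0..e1}" "m \<in> {0..1/2}" and W: "W \<in> Wdom k" and W': "W' \<in> Wdom k"
    have em': "0 \<le> m" "m \<le> 1/2" "0 \<le> e" "e \<le> e1" using em by auto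
    have in_I: "((e, m), y) \<in> Idom" if "y \<in> {0..turns k}" for y
      using em that unfolding Idom_def Jdom_def by auto
    \<comment> \<open>Treating the pair of values as one periodic function yields a single
      representative \<open>y\<close> for both curves.\<close>
    have "\<exists>y\<in>{0..turns k}. (\<lambda>x. (NW k e m W x, NW k e m W' x)) x = (\<lambda>x. (NW k e m W x, NW k e m W' x)) y"
      by (rule periodic_reduce[OF _ period_pos])
        (simp add: NW_def NW_symm[OF W em'] NW_symm[OF W' em'])
    then obtain y where y: "y \<in> {0..turns k}" "NW k e m W x = NW k e m W y" "NW k e m W' x = NW k e m W' y"
      by auto
    note yI = in_I[OF y(1)]
    have eq: "prim (G1 k e m W) x = prim (G1 k e m W) y" "prim (G2 k e m W) x = prim (G2 k e m W) y"
      "N3 k e m W x = N3 k e m W y" using y(2) unfolding NW_def by auto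
    show "\<bar>prim (G1 k e m W) x\<bar> \<le> C" "\<bar>prim (G2 k e m W) x\<bar> \<le> C" "\<bar>N3 k e m W x\<bar> \<le> C"
      unfolding eq using BL_boundD(1)[OF C1(2) yI W] BL_boundD(1)[OF C2(2) yI W]
        BL_boundD(1)[OF C3(2) yI W] C by auto
    have "dist (NW k e m W x) (NW k e m W' x)
        \<le> \<bar>prim (G1 k e m W) y - prim (G1 k e m W') y\<bar> + (\<bar>prim (G2 k e m W) y - prim (G2 k e m W') y\<bar> + \<bar>N3 k e m W y - N3 k e m W' y\<bar>)"
      unfolding y(2,3) unfolding NW_def dist_real_def[symmetric]
      by (rule order_trans[OF dist_Pair_le add_left_mono[OF dist_Pair_le]])
    also have "\<dots> \<le> C1 * dist W W' + (C2 * dist W W' + C3 * dist W W')"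
      using BL_boundD(2)[OF C1(2) yI W W'] BL_boundD(2)[OF C2(2) yI W W']
        BL_boundD(2)[OF C3(2) yI W W'] by (intro add_mono) auto
    also have "\<dots> = (C1 + C2 + C3) * dist W W'" by (simp add: algebra_simps)
    also have "\<dots> \<le> C * dist W W'" by (intro mult_right_mono C) auto
    finally show "dist (NW k e m W x) (NW k e m W' x) \<le> C * dist W W'" .
    have "\<bar>meanG3 k e m W - meanG3 k e m W'\<bar> \<le> C4 * dist W W'"
      using BL_boundD(2)[OF C4(2) yI W W'] by simp
    also have "\<dots> \<le> C * dist W W'" by (intro mult_right_mono C) auto
    finally show "\<bar>meanG3 k e m W - meanG3 k e m W'\<bar> \<le> C * dist W W'" .
  qed
qed

end

lemma NW_continuous:
  assumes "k \<ge> 1" "0 \<le> e1" "e1 < 1" "330 / real k ^ 2 \<le> ((1 - e1) / 2) ^ 3"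
    and W: "W \<in> Wdom k" "0 \<le> m" "m \<le> 1/2" "0 \<le> e" "e \<le> e1"
  shows "continuous_on S (NW k e m W)"
  unfolding NW_def[abs_def] N3_def[abs_def]
  by (intro continuous_intros cont_G[OF assms])

text \<open>Collects what the intermediate value argument needs: continuity of the mean in
  \<open>s\<close>, and its closeness to the value on the unperturbed ellipse, where its sign is
  known.\<close>

definition fixed_branch :: "nat \<Rightarrow> real \<Rightarrow> real \<Rightarrow> real \<Rightarrow> (real \<Rightarrow> curve) \<Rightarrow> bool" where
  "fixed_branch k e m L Ws \<longleftrightarrow> (\<forall>s\<in>{-1/4..1/4}. Ws s \<in> Wdom k \<and>
      (\<forall>x. apply_bcontfun (Ws s) x = (0, s, 0) + m *\<^sub>R NW k e m (Ws s) x) \<and>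
      \<bar>meanG3 k e m (Ws s) - meanG3 k e m (cconst s)\<bar> \<le> L * m) \<and>
    continuous_on {-1/4..1/4} (\<lambda>s. meanG3 k e m (Ws s))"

lemma NW_fixed_points:
  assumes k: "k \<ge> 1" and e1: "0 \<le> e1" "e1 < 1" and kL: "330 / real k ^ 2 \<le> ((1 - e1) / 2) ^ 3"
  shows "\<exists>m1>0. m1 \<le> 1/2 \<and> (\<exists>L\<ge>0. \<forall>e\<in>{0..e1}. \<forall>m\<in>{0..m1}. \<exists>Ws. fixed_branch k e m L Ws)"
proof -
  obtain C where C: "C > 0" and CB: "\<And>e m W W' x. e \<in> {0..e1} \<Longrightarrow> m \<in> {0..1/2} \<Longrightarrow> W \<in> Wdom k \<Longrightarrow> W' \<in> Wdom k \<Longrightarrow>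
     \<bar>prim (G1 k e m W) x\<bar> \<le> C \<and> \<bar>prim (G2 k e m W) x\<bar> \<le> C \<and> \<bar>N3 k e m W x\<bar> \<le> C \<and>
     dist (NW k e m W x) (NW k e m W' x) \<le> C * dist W W' \<and>
     \<bar>meanG3 k e m W - meanG3 k e m W'\<bar> \<le> C * dist W W'"
    using NW_bounds[OF k e1 kL] by blast
  \<comment> \<open>The bound \<open>m C \<le> 1/8\<close> serves twice: it keeps the image within
    the box of \<open>Wdom\<close>, and it is the contraction constant.\<close>
  define m1 where "m1 = min (1/2) (1 / (8 * C))"
  have m1: "m1 > 0" "m1 \<le> 1/2" "m1 * C \<le> 1/8"
    using C by (auto simp: m1_def min_def field_simps)
  have main: "\<exists>Ws. fixed_branch k e m (C * (3 * C)) Ws"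
    if e: "e \<in> {0..e1}" and m: "m \<in> {0..m1}" for e m
  proof -
    have m2: "m \<in> {0..1/2}" using m m1 by auto
    have me: "0 \<le> m" "m \<le> 1/2" "0 \<le> e" "e \<le> e1" using e m2 by auto
    have mC: "0 \<le> m * C" "m * C \<le> 1/8"
    proof -
      have "m * C \<le> m1 * C" using m C by (intro mult_right_mono) auto
      thus "m * C \<le> 1/8" using m1 by linarith
      show "0 \<le> m * C" using m C by simp
    qed
    define F where "F = (\<lambda>s W. Bcontfun (\<lambda>x. (0, s, 0) + m *\<^sub>R NW k e m W x) :: curve)"
    have nrm: "norm (NW k e m W x) \<le> 3 * C" if "W \<in> Wdom k" for W x
    proof -
      have "norm (NW k e m W x) \<le> \<bar>prim (G1 k e m W) x\<bar> + (\<bar>prim (G2 k e m W) x\<bar> + \<bar>N3 k e m W x\<bar>)"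
        unfolding real_norm_def[symmetric] NW_def
        by (rule order_trans[OF norm_Pair_le add_left_mono[OF norm_Pair_le]])
      thus ?thesis using CB[OF e m2 that that, of x] by linarith
    qed
    have F: "apply_bcontfun (F s W) x = (0, s, 0) + m *\<^sub>R NW k e m W x" if W: "W \<in> Wdom k" for s W x
    proof -
      have "(\<lambda>x. (0, s, 0) + m *\<^sub>R NW k e m W x) \<in> bcontfun"
      proof (rule bcontfun_normI)
        show "continuous_on UNIV (\<lambda>x. (0, s, 0) + m *\<^sub>R NW k e m W x)"
          by (intro continuous_intros NW_continuous[OF k e1 kL W me])
        fix x
        have "norm ((0, s, 0) + m *\<^sub>R NW k e m W x) \<le> norm (0::real, s, 0::real) + norm (m *\<^sub>R NW k e m W x)"
          by (rule norm_triangle_ineq)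
        also have "\<dots> \<le> norm (0::real, s, 0::real) + m * (3 * C)"
          using nrm[OF W] me by (auto intro!: mult_left_mono)
        finally show "norm ((0, s, 0) + m *\<^sub>R NW k e m W x) \<le> norm (0::real, s, 0::real) + m * (3 * C)" .
      qed
      thus ?thesis unfolding F_def by (simp add: Bcontfun_inverse)
    qed
    have FD: "F s W \<in> Wdom k" if W: "W \<in> Wdom k" and s: "s \<in> {-1/4..1/4}" for s W
    proof -
      have c: "gW (F s W) x = m * prim (G1 k e m W) x" "aW (F s W) x = s + m * prim (G2 k e m W) x"
        "bW (F s W) x = m * N3 k e m W x" for x
        unfolding gW_def aW_def bW_def F[OF W] NW_def by simp_all
      have b: "\<bar>m * x\<bar> \<le> 1/8" if "\<bar>x\<bar> \<le> C" for x
      proof -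
        have "\<bar>m * x\<bar> \<le> m * C" unfolding abs_mult using that me by (intro mult_mono) auto
        thus ?thesis using mC by linarith
      qed
      have b1: "\<bar>m * prim (G1 k e m W) x\<bar> \<le> 1/8" "\<bar>m * prim (G2 k e m W) x\<bar> \<le> 1/8" "\<bar>m * N3 k e m W x\<bar> \<le> 1/8" for x
        using CB[OF e m2 W W, of x] by (blast intro: b)+
      have "\<bar>s + m * prim (G2 k e m W) x\<bar> \<le> 3/8" for x
        using b1(2)[of x] s by (simp only: atLeastAtMost_iff) linarith
      thus ?thesis unfolding Wdom_def mem_Collect_eq c
        using b1 NW_symm[OF k e1 kL W me] by simp
    qed
    have Flip: "dist (F s W) (F s' W') \<le> \<bar>s - s'\<bar> + m * C * dist W W'"
      if W: "W \<in> Wdom k" and W': "W' \<in> Wdom k" for s s' W W'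
    proof (rule dist_bound)
      fix x
      have "dist (F s W x) (F s' W' x) = norm (((0, s, 0) - (0, s', 0)) + m *\<^sub>R (NW k e m W x - NW k e m W' x))"
        unfolding F[OF W] F[OF W'] dist_norm add_diff_add scaleR_diff_right ..
      also have "\<dots> \<le> norm ((0, s, 0) - (0, s', 0) :: real \<times> real \<times> real) + norm (m *\<^sub>R (NW k e m W x - NW k e m W' x))"
        by (rule norm_triangle_ineq)
      also have "norm ((0, s, 0) - (0, s', 0) :: real \<times> real \<times> real) = \<bar>s - s'\<bar>"
        by (simp add: norm_Pair)
      also have "norm (m *\<^sub>R (NW k e m W x - NW k e m W' x)) = m * dist (NW k e m W x) (NW k e m W' x)"
        using me by (simp add: dist_norm)
      also have "\<dots> \<le> m * (C * dist W W')"
        using CB[OF e m2 W W', of x] me by (intro mult_left_mono) auto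
      finally show "dist (F s W x) (F s' W' x) \<le> \<bar>s - s'\<bar> + m * C * dist W W'" by simp
    qed
    have "\<exists>!W. W \<in> Wdom k \<and> F s W = W" if s: "s \<in> {-1/4..1/4}" for s
    proof -
      have "\<exists>!W\<in>Wdom k. F s W = W"
      proof (rule Banach_fix[where c = "1/8"])
        show "complete (Wdom k)" by (rule complete_Wdom)
        show "Wdom k \<noteq> {}" using cconst_Wdom[OF s] by blast
        show "F s ` Wdom k \<subseteq> Wdom k" using FD s by blast
        have "dist (F s W) (F s W') \<le> 1/8 * dist W W'" if "W \<in> Wdom k" "W' \<in> Wdom k" for W W'
        proof -
          have "m * C * dist W W' \<le> 1/8 * dist W W'" using mC by (intro mult_right_mono) auto
          thus ?thesis using Flip[OF that, of s s] by simp
        qed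
        thus "dist (F s W) (F s W') \<le> 1/8 * dist W W'" if "W \<in> Wdom k" "W' \<in> Wdom k" for W W' using that by blast
      qed auto
      thus ?thesis by blast
    qed
    then obtain Ws where Ws: "\<And>s. s \<in> {-1/4..1/4} \<Longrightarrow> Ws s \<in> Wdom k \<and> F s (Ws s) = Ws s"
      by metis
    have eq: "apply_bcontfun (Ws s) x = (0, s, 0) + m *\<^sub>R NW k e m (Ws s) x" if "s \<in> {-1/4..1/4}" for s x
      using F[of "Ws s" s x] Ws[OF that] by simp
    have "\<bar>meanG3 k e m (Ws s) - meanG3 k e m (cconst s)\<bar> \<le> (C * (3 * C)) * m" if s: "s \<in> {-1/4..1/4}" for s
    proof -
      have "dist (Ws s) (cconst s) \<le> m * (3 * C)"
      proof (rule dist_bound)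
        fix x
        have "dist (apply_bcontfun (Ws s) x) (apply_bcontfun (cconst s) x) = m * norm (NW k e m (Ws s) x)"
          unfolding eq[OF s] cconst_def using me
          by (simp add: Bcontfun_inverse const_bcontfun dist_norm)
        also have "\<dots> \<le> m * (3 * C)" using nrm Ws[OF s] me by (intro mult_left_mono) auto
        finally show "dist (apply_bcontfun (Ws s) x) (apply_bcontfun (cconst s) x) \<le> m * (3 * C)" .
      qed
      hence "C * dist (Ws s) (cconst s) \<le> C * (m * (3 * C))" using C by (intro mult_left_mono) auto
      thus ?thesis using CB[OF e m2 conjunct1[OF Ws[OF s]] cconst_Wdom[OF s], of 0] by (simp add: algebra_simps)
    qed
    \<comment> \<open>Changing \<open>s\<close> shifts the contraction by
      \<open>\<bar>s - s'\<bar>\<close>; absorbing \<open>1/8\<close> of the distance of the fixed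
      points makes them Lipschitz in \<open>s\<close>.\<close>
    moreover have "continuous_on {-1/4..1/4} (\<lambda>s. meanG3 k e m (Ws s))"
    proof (rule lipschitz_on_continuous_on[OF lipschitz_onI])
      show "0 \<le> C * 2" using C by simp
      fix s s' :: real assume s: "s \<in> {-1/4..1/4}" and s': "s' \<in> {-1/4..1/4}"
      have "dist (Ws s) (Ws s') \<le> \<bar>s - s'\<bar> + m * C * dist (Ws s) (Ws s')"
        using Flip[of "Ws s" "Ws s'" s s'] Ws[OF s] Ws[OF s'] by simp
      moreover have "m * C * dist (Ws s) (Ws s') \<le> 1/8 * dist (Ws s) (Ws s')" using mC by (intro mult_right_mono) auto
      ultimately have "dist (Ws s) (Ws s') \<le> 2 * \<bar>s - s'\<bar>"
        using zero_le_dist[of "Ws s" "Ws s'"] abs_ge_zero[of "s - s'"] by argo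
      hence "C * dist (Ws s) (Ws s') \<le> C * (2 * \<bar>s - s'\<bar>)" using C by (intro mult_left_mono) auto
      thus "dist (meanG3 k e m (Ws s)) (meanG3 k e m (Ws s')) \<le> C * 2 * dist s s'"
        using CB[OF e m2 conjunct1[OF Ws[OF s]] conjunct1[OF Ws[OF s']], of 0] by (simp add: dist_real_def)
    qed
    ultimately show ?thesis unfolding fixed_branch_def using Ws eq by blast
  qed
  have "0 \<le> C * (3 * C)" using C by simp
  with main m1 show ?thesis by blast
qed

section \<open>Averaging over the fast motion\<close>

text \<open>
  Here \<open>t\<close> is the time as a function of the angle; \<open>H (x) Q (t x)\<close> is replaced by its mean up to an
  error that stays bounded as the number \<open>k\<close> of turns grows, while the mean grows like \<open>k\<close>.
\<close>

definition averages :: "(real \<Rightarrow> real) \<Rightarrow> (real \<Rightarrow> real) \<Rightarrow> real \<Rightarrow> real \<Rightarrow> bool" where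
  "averages w H c B \<longleftrightarrow> (\<forall>k lam t Q C. k \<ge> 1 \<longrightarrow> 0 < lam \<longrightarrow> lam \<le> 4 / real k \<longrightarrow>
    (\<forall>x. (t has_real_derivative lam * w x) (at x)) \<longrightarrow> t 0 = 0 \<longrightarrow> t (turns k) = 2 * pi \<longrightarrow>
    C \<ge> 0 \<longrightarrow> bounded_deriv Q C \<longrightarrow>
    \<bar>prim (\<lambda>x. H x * Q (t x)) (turns k) - c / lam * prim Q (2 * pi)\<bar> \<le> B * C)"

text \<open>Split \<open>H = c w + N\<close> with \<open>N\<close> of mean zero over a turn. The
  part with \<open>w\<close> is exact by the substitution \<open>t' = lam w\<close>. The
  antiderivative of \<open>N\<close> is periodic, hence bounded by some \<open>B0\<close>, and
  vanishes at \<open>turns k\<close>. Integration by parts then differentiates only the slow factor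
  \<open>Q (t x)\<close>, which costs \<open>2 lam C \<le> 8 C / k\<close>; over the length
  \<open>2\<pi> k\<close> this adds up to \<open>16 \<pi> B0 C\<close>.\<close>

lemma averaging:
  assumes w: "continuous_on UNIV w" "\<And>x. 0 \<le> w x" "\<And>x. w x \<le> 2" "\<And>x. w (x + 2 * pi) = w x"
    and H: "continuous_on UNIV H" "\<And>x. H (x + 2 * pi) = H x"
    and mean: "prim H (2 * pi) = c * prim w (2 * pi)"
  shows "\<exists>B\<ge>0. averages w H c B"
proof -
  define N where "N = (\<lambda>x. H x - c * w x)"
  have N: "continuous_on UNIV N" "\<And>x. N (x + 2 * pi) = N x"
    unfolding N_def using w H by (auto intro!: continuous_intros)
  have "prim N (2 * pi) = 0"
    unfolding N_def using mean prim_diff[OF H(1) continuous_on_mult_left[OF w(1)]] prim_cmult[OF w(1)] by simp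
  hence per: "prim N (x + 2 * pi) = prim N x" for x
    using prim_add_period[OF N, of x] by simp
  have "continuous_on {0..2 * pi} (prim N)" by (intro continuous_intros N)
  hence "bounded (prim N ` {0..2 * pi})" by (intro compact_imp_bounded compact_continuous_image) auto
  then obtain B0 where B0: "\<And>x. x \<in> {0..2 * pi} \<Longrightarrow> \<bar>prim N x\<bar> \<le> B0"
    unfolding bounded_iff by (metis image_eqI real_norm_def)
  have B: "\<bar>prim N x\<bar> \<le> B0" for x
    using periodic_reduce[of "prim N" "2 * pi" x, OF per] B0 by force
  have B0': "B0 \<ge> 0" using B[of 0] by simp
  interpret periodic_fun_simple "prim N" "2 * pi"
    by unfold_locales (rule per)
  have zero: "prim N (turns k) = 0" for k
    using plus_of_nat[of 0 k] by (simp add: mult.commute)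
  show ?thesis unfolding averages_def
  proof (rule exI[of _ "16 * pi * B0"], intro conjI allI impI)
    show "0 \<le> 16 * pi * B0" using B0' by simp
    fix k :: nat and lam C :: real and t Q :: "real \<Rightarrow> real"
    assume k: "k \<ge> 1" and lam: "0 < lam" "lam \<le> 4 / k"
      and t: "\<forall>x. (t has_real_derivative lam * w x) (at x)" "t 0 = 0" "t (turns k) = 2 * pi"
      and C: "C \<ge> 0" and Q: "bounded_deriv Q C"
    have Qc: "continuous_on UNIV Q" by (rule bounded_deriv_continuous[OF Q])
    have tc: "continuous_on UNIV t"
      using t(1) by (meson DERIV_isCont continuous_at_imp_continuous_on)
    have Qt: "continuous_on UNIV (\<lambda>x. Q (t x))"
      by (rule continuous_on_compose2[OF Qc tc]) auto
    let ?P = "turns k"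
    define Y where "Y = (\<lambda>x. prim (\<lambda>x. N x * Q (t x)) x - prim N x * Q (t x))"
    have "norm (Y ?P - Y 0) \<le> (B0 * (C * (lam * 2))) * norm (?P - 0)"
    proof (rule field_differentiable_bound[of "{0..?P}"])
      fix x
      obtain d where d: "(Q has_real_derivative d) (at (t x))" "\<bar>d\<bar> \<le> C"
        using Q unfolding bounded_deriv_def by blast
      have "(Y has_real_derivative N x * Q (t x) - (N x * Q (t x) + d * (lam * w x) * prim N x)) (at x)"
        unfolding Y_def
        using DERIV_diff[OF has_derivative_prim[OF continuous_on_mult[OF N(1) Qt]]
            DERIV_mult[OF has_derivative_prim[OF N(1)] DERIV_chain2[OF d(1) spec[OF t(1), of x]]]] .
      hence "(Y has_real_derivative - (prim N x * (d * (lam * w x)))) (at x)" by (simp add: mult.commute)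
      hence der: "deriv Y x = - (prim N x * (d * (lam * w x)))" "(Y has_real_derivative deriv Y x) (at x)"
        by (auto simp: DERIV_imp_deriv)
      show "(Y has_real_derivative deriv Y x) (at x within {0..?P})"
        using der(2) by (rule has_field_derivative_at_within)
      have "\<bar>prim N x * (d * (lam * w x))\<bar> \<le> B0 * (C * (lam * 2))"
        unfolding abs_mult by (intro mult_mono B) (use d w lam C B0' in auto)
      thus "norm (deriv Y x) \<le> B0 * (C * (lam * 2))" unfolding der(1) by simp
    qed auto
    also have "\<dots> \<le> (B0 * (C * (4 / k * 2))) * norm (?P - 0)"
      using lam B0' C by (intro mult_mono) auto
    also have "\<dots> = 16 * pi * B0 * C" using k by simp
    finally have 1: "\<bar>prim (\<lambda>x. N x * Q (t x)) ?P\<bar> \<le> 16 * pi * B0 * C"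
      unfolding Y_def zero by simp
    have wQ: "continuous_on UNIV (\<lambda>x. w x * Q (t x))" by (intro continuous_intros w Qt)
    have "prim (\<lambda>x. w x * Q (t x)) ?P = 1 / lam * prim Q (t ?P) - 1 / lam * prim Q (t 0)"
    proof (rule prim_unique)
      fix x
      show "((\<lambda>x. 1 / lam * prim Q (t x)) has_real_derivative w x * Q (t x)) (at x)"
        using DERIV_cmult[OF DERIV_chain2[OF has_derivative_prim[OF Qc] spec[OF t(1), of x]], of "1 / lam"] lam
        by (simp add: mult.commute)
    qed (rule wQ)
    hence 2: "c * prim (\<lambda>x. w x * Q (t x)) ?P = c / lam * prim Q (2 * pi)" using t by simp
    have "(\<lambda>x. H x * Q (t x)) = (\<lambda>x. N x * Q (t x) + c * (w x * Q (t x)))"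
      unfolding N_def by (simp add: algebra_simps)
    hence "prim (\<lambda>x. H x * Q (t x)) ?P = prim (\<lambda>x. N x * Q (t x)) ?P + c * prim (\<lambda>x. w x * Q (t x)) ?P"
      using prim_add[OF continuous_on_mult[OF N(1) Qt] continuous_on_mult_left[OF wQ]] prim_cmult[OF wQ] by simp
    thus "\<bar>prim (\<lambda>x. H x * Q (t x)) ?P - c / lam * prim Q (2 * pi)\<bar> \<le> 16 * pi * B0 * C"
      using 1 2 by simp
  qed
qed

lemma trig_integrals:
  "prim cos (2 * pi) = 0" "prim (\<lambda>x. (cos x)\<^sup>2) (2 * pi) = pi"
proof -
  show "prim cos (2 * pi) = 0"
    using prim_unique[OF DERIV_sin continuous_on_cos[OF continuous_on_id], of "2 * pi"] by simp
  have "((\<lambda>x. (x + sin x * cos x) / 2) has_real_derivative (cos x)\<^sup>2) (at x)" for x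
  proof -
    have "((\<lambda>x. (x + sin x * cos x) / 2) has_real_derivative (1 + (cos x * cos x + - sin x * sin x)) / 2) (at x)"
      by (auto intro!: derivative_eq_intros)
    moreover have "(1 + (cos x * cos x + - sin x * sin x)) / 2 = (cos x)\<^sup>2"
      using sin_squared_eq[of x] by (simp add: power2_eq_square field_simps)
    ultimately show ?thesis by simp
  qed
  moreover have "continuous_on UNIV (\<lambda>x::real. (cos x)\<^sup>2)"
    by (intro continuous_intros)
  ultimately show "prim (\<lambda>x. (cos x)\<^sup>2) (2 * pi) = pi"
    using prim_unique[of "\<lambda>x. (x + sin x * cos x) / 2" "\<lambda>x. (cos x)\<^sup>2" "2 * pi"] by simp
qed

text \<open>
  Weights of \<open>QYY - QXX\<close>, \<open>QXY\<close> and \<open>- QXX\<close> in the quadrupole part of \<open>G3\<close> along a Kepler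
  ellipse of eccentricity \<open>s\<close> (see \<open>lead_G3\<close>).
\<close>

definition Dk :: "real \<Rightarrow> real \<Rightarrow> real" where "Dk s x = 1 + s * cos x"
definition wk :: "real \<Rightarrow> real \<Rightarrow> real" where "wk s x = 1 / (Dk s x)\<^sup>2"
definition H1 :: "real \<Rightarrow> real \<Rightarrow> real" where "H1 s x = sin x * (sin x * cos x) / Dk s x ^ 4"
definition H2 :: "real \<Rightarrow> real \<Rightarrow> real" where "H2 s x = sin x * ((cos x)\<^sup>2 - (sin x)\<^sup>2) / Dk s x ^ 4 - sin x / Dk s x ^ 3"
definition H3 :: "real \<Rightarrow> real \<Rightarrow> real" where "H3 s x = cos x / Dk s x ^ 3"

text \<open>The entries \<open>XX\<close>, \<open>XY\<close>, \<open>YY\<close> are arbitrary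
  functions of time here, so that \<open>B\<close> can be chosen in terms of \<open>s\<close> alone,
  before the eccentricity of the primaries is known.\<close>

definition kernel_bound :: "real \<Rightarrow> real \<Rightarrow> bool" where
  "kernel_bound s B \<longleftrightarrow> (\<forall>k lam t A XX XY YY C. k \<ge> 1 \<longrightarrow> 0 < lam \<longrightarrow> lam \<le> 4 / real k \<longrightarrow>
    (\<forall>x. (t has_real_derivative lam * wk s x) (at x)) \<longrightarrow> t 0 = 0 \<longrightarrow> t (turns k) = 2 * pi \<longrightarrow>
    C \<ge> 0 \<longrightarrow> bounded_deriv XX C \<longrightarrow> bounded_deriv XY C \<longrightarrow> bounded_deriv YY C \<longrightarrow>
    prim XX (2 * pi) = A \<longrightarrow> prim YY (2 * pi) = A \<longrightarrow> pi / 8 \<le> A \<longrightarrow>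
    pi * real k / 2048 - B * C \<le> s * prim (\<lambda>x. (YY (t x) - XX (t x)) * H1 s x + XY (t x) * H2 s x
      - XX (t x) * H3 s x) (turns k))"

context
  fixes s :: real
  assumes s: "s = 1/4 \<or> s = -1/4"
begin

lemma s_cos_le: "\<bar>s * cos x\<bar> \<le> 1/4"
proof -
  have "\<bar>s * cos x\<bar> \<le> 1/4 * 1"
    unfolding abs_mult by (intro mult_mono) (use s in auto)
  thus ?thesis by simp
qed

lemma Dk_bounds: "3/4 \<le> Dk s x" "Dk s x \<le> 5/4"
  using s_cos_le[of x] unfolding Dk_def by linarith+

lemma Dk_nz: "Dk s x \<noteq> 0"
  using Dk_bounds(1)[of x] by auto

lemma wk_bounds: "1/4 \<le> wk s x" "wk s x \<le> 2" "0 \<le> wk s x"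
proof -
  have D: "(3/4)\<^sup>2 \<le> (Dk s x)\<^sup>2" "(Dk s x)\<^sup>2 \<le> (5/4)\<^sup>2"
    using Dk_bounds[of x] by (auto intro!: power_mono)
  have "1 / (5/4)\<^sup>2 \<le> wk s x" "wk s x \<le> 1 / (3/4)\<^sup>2"
    unfolding wk_def by (intro frac_le; use D Dk_nz[of x] in simp)+
  moreover have "1/4 \<le> 1 / (5/4 :: real)\<^sup>2" "1 / (3/4 :: real)\<^sup>2 \<le> 2" by (simp_all add: power2_eq_square)
  ultimately show "1/4 \<le> wk s x" "wk s x \<le> 2" "0 \<le> wk s x" by linarith+
qed

lemma kepler_kernels_cont:
  "continuous_on S (Dk s)" "continuous_on S (wk s)" "continuous_on S (H1 s)" "continuous_on S (H2 s)" "continuous_on S (H3 s)"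
proof -
  show D: "continuous_on S (Dk s)" unfolding Dk_def[abs_def] by (intro continuous_intros)
  show "continuous_on S (wk s)" "continuous_on S (H1 s)" "continuous_on S (H2 s)" "continuous_on S (H3 s)"
    unfolding wk_def[abs_def] H1_def[abs_def] H2_def[abs_def] H3_def[abs_def]
    by (intro continuous_intros D; simp add: Dk_nz)+
qed

lemma kepler_kernels_periodic:
  "Dk s (x + 2 * pi) = Dk s x" "wk s (x + 2 * pi) = wk s x" "H1 s (x + 2 * pi) = H1 s x"
  "H2 s (x + 2 * pi) = H2 s x" "H3 s (x + 2 * pi) = H3 s x"
  unfolding wk_def H1_def H2_def H3_def Dk_def by simp_all

lemma prim_wk_bounds: "0 < prim (wk s) (2 * pi)" "prim (wk s) (2 * pi) \<le> 4 * pi"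
proof -
  have "prim (\<lambda>x. 1/4) (2 * pi) \<le> prim (wk s) (2 * pi)" "prim (wk s) (2 * pi) \<le> prim (\<lambda>x. 2) (2 * pi)"
    by (rule prim_mono; use kepler_kernels_cont wk_bounds in simp)+
  moreover have "0 < pi" by simp
  ultimately show "0 < prim (wk s) (2 * pi)" "prim (wk s) (2 * pi) \<le> 4 * pi"
    unfolding prim_const by linarith+
qed

lemma prim_H2: "prim (H2 s) (2 * pi) = 0"
proof -
  have "H2 s (- x) = - H2 s x" for x unfolding H2_def Dk_def by simp
  from prim_odd_period[OF kepler_kernels_cont(4) this kepler_kernels_periodic(4), of 0]
  show ?thesis by simp
qed

text \<open>With \<open>z = s cos x\<close> the pointwise bound is
  \<open>z / (1 + z)^3 \<le> z - z^2\<close>, equivalent to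
  \<open>z^2 (1 + z)^3 \<le> z ((1 + z)^3 - 1)\<close>; for \<open>\<bar>z\<bar> \<le> 1/4\<close>
  it follows from \<open>(1 + z)^3 \<le> 3 + 3 z + z^2\<close>. Integration leaves
  \<open>- s^2 \<pi>\<close>.\<close>

lemma prim_H3: "s * prim (H3 s) (2 * pi) \<le> - pi / 16"
proof -
  have s2: "s * s = 1/16"
  proof -
    have a: "\<bar>s\<bar> = 1/4" using s by auto
    have "s * s = \<bar>s\<bar> * \<bar>s\<bar>" by simp
    also have "\<dots> = 1/16" unfolding a by simp
    finally show ?thesis .
  qed
  have "s * H3 s x \<le> s * cos x - 1/16 * (cos x)\<^sup>2" for x
  proof -
    let ?x = "s * cos x"
    have b: "- 1/4 \<le> ?x" "?x \<le> 1/4" using s_cos_le[of x] by linarith+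
    have D: "0 < (1 + ?x) ^ 3" "(1 + ?x) ^ 3 \<le> (5/4) ^ 3"
      using b by (auto intro!: power_mono)
    have "(1 + ?x) ^ 3 \<le> 3 + 3 * ?x + ?x\<^sup>2"
    proof -
      have "(5/4 :: real) ^ 3 \<le> 3 + 3 * (-1/4)" by (simp add: power3_eq_cube)
      moreover have "0 \<le> ?x\<^sup>2" by simp
      ultimately show ?thesis using D b by linarith
    qed
    hence "?x\<^sup>2 * (1 + ?x) ^ 3 \<le> ?x\<^sup>2 * (3 + 3 * ?x + ?x\<^sup>2)" by (intro mult_left_mono) auto
    also have "\<dots> = ?x * ((1 + ?x) ^ 3 - 1)" by (simp add: power2_eq_square power3_eq_cube algebra_simps)
    finally have "?x \<le> (?x - ?x\<^sup>2) * (1 + ?x) ^ 3" by (simp add: algebra_simps)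
    hence "?x / (1 + ?x) ^ 3 \<le> ?x - ?x\<^sup>2" using D by (simp add: pos_divide_le_eq)
    moreover have "?x\<^sup>2 = 1/16 * (cos x)\<^sup>2" using s2 by (simp add: power_mult_distrib power2_eq_square)
    ultimately show ?thesis unfolding H3_def Dk_def by simp
  qed
  hence "prim (\<lambda>x. s * H3 s x) (2 * pi) \<le> prim (\<lambda>x. s * cos x - 1/16 * (cos x)\<^sup>2) (2 * pi)"
    by (intro prim_mono continuous_intros kepler_kernels_cont) auto
  also have "prim (\<lambda>x. s * cos x - 1/16 * (cos x)\<^sup>2) (2 * pi) = s * prim cos (2 * pi) - 1/16 * prim (\<lambda>x. (cos x)\<^sup>2) (2 * pi)"
  proof -
    have c: "continuous_on UNIV (cos :: real \<Rightarrow> real)" "continuous_on UNIV (\<lambda>x::real. (cos x)\<^sup>2)"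
      by (intro continuous_intros)+
    show ?thesis
      using prim_diff[OF continuous_on_mult_left[OF c(1)] continuous_on_mult_left[OF c(2)]]
        prim_cmult[OF c(1)] prim_cmult[OF c(2)] by (simp only:)
  qed
  also have "\<dots> = - pi / 16" unfolding trig_integrals by simp
  finally show ?thesis using prim_cmult[OF kepler_kernels_cont(5), of s] by simp
qed

text \<open>The two averages with \<open>H1\<close> cancel because \<open>XX\<close> and
  \<open>YY\<close> have equal means, and \<open>H2\<close> is odd. What remains is
  \<open>H3\<close>, whose mean has the sign opposite to \<open>s\<close> and which enters with a
  minus sign. The main term is at least
  \<open>1/64 * (\<pi>/8) / (4/k) = \<pi> k / 2048\<close>.\<close>

lemma averaged_kernels: "\<exists>B\<ge>0. kernel_bound s B"
proof -
  define c1 c3 where "c1 = prim (H1 s) (2 * pi) / prim (wk s) (2 * pi)" and "c3 = prim (H3 s) (2 * pi) / prim (wk s) (2 * pi)"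
  have m: "prim (H1 s) (2 * pi) = c1 * prim (wk s) (2 * pi)" "prim (H2 s) (2 * pi) = 0 * prim (wk s) (2 * pi)"
    "prim (H3 s) (2 * pi) = c3 * prim (wk s) (2 * pi)"
    using prim_wk_bounds(1) prim_H2 by (simp_all add: c1_def c3_def)
  note av = averaging[OF kepler_kernels_cont(2) wk_bounds(3,2) kepler_kernels_periodic(2)]
  obtain B1 where B1: "B1 \<ge> 0" "averages (wk s) (H1 s) c1 B1"
    using av[OF kepler_kernels_cont(3) kepler_kernels_periodic(3) m(1)] by blast
  obtain B2 where B2: "B2 \<ge> 0" "averages (wk s) (H2 s) 0 B2"
    using av[OF kepler_kernels_cont(4) kepler_kernels_periodic(4) m(2)] by blast
  obtain B3 where B3: "B3 \<ge> 0" "averages (wk s) (H3 s) c3 B3"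
    using av[OF kepler_kernels_cont(5) kepler_kernels_periodic(5) m(3)] by blast
  note avD = averages_def[THEN iffD1, rule_format]
  have sc3: "s * c3 \<le> - 1/64"
  proof -
    have "s * c3 = s * prim (H3 s) (2 * pi) / prim (wk s) (2 * pi)" by (simp add: c3_def)
    also have "\<dots> \<le> (- pi / 16) / prim (wk s) (2 * pi)"
      using prim_H3 prim_wk_bounds by (intro divide_right_mono) auto
    also have "\<dots> \<le> (- pi / 16) / (4 * pi)"
      using prim_wk_bounds by (intro divide_left_mono_neg) auto
    finally show ?thesis by simp
  qed
  have sabs: "\<bar>s\<bar> \<le> 1" using s by auto
  show ?thesis unfolding kernel_bound_def
  proof (rule exI[of _ "2 * B1 + B2 + B3"], intro conjI allI impI)
    show "0 \<le> 2 * B1 + B2 + B3" using B1 B2 B3 by simp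
    fix k :: nat and lam A C :: real and t XX XY YY :: "real \<Rightarrow> real"
    assume k: "k \<ge> 1" and lam: "0 < lam" "lam \<le> 4 / k"
      and t: "\<forall>x. (t has_real_derivative lam * wk s x) (at x)" "t 0 = 0" "t (turns k) = 2 * pi"
      and C: "C \<ge> 0"
      and X: "bounded_deriv XX C" "bounded_deriv XY C" "bounded_deriv YY C"
      and A: "prim XX (2 * pi) = A" "prim YY (2 * pi) = A" "pi / 8 \<le> A"
    let ?P = "turns k"
    note prem = k lam t(1)[rule_format] t(2,3) C
    define a b c d where "a = prim (\<lambda>x. H1 s x * YY (t x)) ?P" and "b = prim (\<lambda>x. H1 s x * XX (t x)) ?P"
      and "c = prim (\<lambda>x. H2 s x * XY (t x)) ?P" and "d = prim (\<lambda>x. H3 s x * XX (t x)) ?P"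
    have est: "\<bar>a - c1 / lam * A\<bar> \<le> B1 * C" "\<bar>b - c1 / lam * A\<bar> \<le> B1 * C"
      "\<bar>c\<bar> \<le> B2 * C" "\<bar>d - c3 / lam * A\<bar> \<le> B3 * C"
      using avD[OF B1(2) prem X(3)] avD[OF B1(2) prem X(1)] avD[OF B2(2) prem X(2)] avD[OF B3(2) prem X(1)]
      unfolding a_def b_def c_def d_def A by simp_all
    have Xc: "continuous_on UNIV XX" "continuous_on UNIV XY" "continuous_on UNIV YY"
      using X bounded_deriv_continuous by blast+
    have tc: "continuous_on UNIV t"
      using t(1) by (meson DERIV_isCont continuous_at_imp_continuous_on)
    have Xtc: "continuous_on UNIV (\<lambda>x. XX (t x))" "continuous_on UNIV (\<lambda>x. XY (t x))" "continuous_on UNIV (\<lambda>x. YY (t x))"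
      by (rule continuous_on_compose2[OF Xc(1) tc] continuous_on_compose2[OF Xc(2) tc] continuous_on_compose2[OF Xc(3) tc]; simp)+
    have split: "prim (\<lambda>x. (YY (t x) - XX (t x)) * H1 s x + XY (t x) * H2 s x - XX (t x) * H3 s x) ?P = ((a - b) + c) - d"
    proof -
      have "(\<lambda>x. (YY (t x) - XX (t x)) * H1 s x + XY (t x) * H2 s x - XX (t x) * H3 s x)
        = (\<lambda>x. ((H1 s x * YY (t x) - H1 s x * XX (t x)) + H2 s x * XY (t x)) - H3 s x * XX (t x))"
        by (simp add: algebra_simps)
      moreover have "continuous_on UNIV (\<lambda>x. H1 s x * YY (t x))" "continuous_on UNIV (\<lambda>x. H1 s x * XX (t x))"
        "continuous_on UNIV (\<lambda>x. H2 s x * XY (t x))" "continuous_on UNIV (\<lambda>x. H3 s x * XX (t x))"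
        by (intro continuous_intros Xtc kepler_kernels_cont)+
      ultimately show ?thesis
        unfolding a_def b_def c_def d_def by (simp add: prim_add prim_diff continuous_intros)
    qed
    define E where "E = ((a - b) + c) - d + c3 / lam * A"
    have "E \<le> (2 * B1 + B2 + B3) * C" "- E \<le> (2 * B1 + B2 + B3) * C"
      unfolding E_def distrib_right using est[unfolded abs_le_iff] by linarith+
    hence E: "\<bar>E\<bar> \<le> (2 * B1 + B2 + B3) * C" by linarith
    have "\<bar>s * E\<bar> \<le> 1 * \<bar>E\<bar>" unfolding abs_mult using sabs by (intro mult_right_mono) auto
    with E have 1: "- ((2 * B1 + B2 + B3) * C) \<le> s * E" by linarith
    have "1/64 * ((pi / 8) / (4 / k)) \<le> - (s * c3) * (A / lam)"
    proof -
      have "0 < A" using A(3) pi_gt_zero by linarith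
      thus ?thesis using sc3 A(3) lam by (intro mult_mono frac_le) auto
    qed
    hence 2: "pi * k / 2048 \<le> - (s * c3) * (A / lam)" using k by simp
    have 3: "s * (((a - b) + c) - d) = s * E + - (s * c3) * (A / lam)"
      unfolding E_def by (simp add: algebra_simps)
    show "pi * real k / 2048 - (2 * B1 + B2 + B3) * C
        \<le> s * prim (\<lambda>x. (YY (t x) - XX (t x)) * H1 s x + XY (t x) * H2 s x - XX (t x) * H3 s x) ?P"
      unfolding split 3 using add_mono[OF 1 2] by simp
  qed
qed

end

section \<open>The sign of the subtracted mean\<close>

text \<open>The right-hand side of \<open>G3_eq\<close> with the force replaced by its quadrupole
  part; \<open>p\<close> is the semi-latus rectum. Everything scales like \<open>p^3\<close>,
  whereas the neglected part of the force contributes order \<open>p^4\<close>, so small orbits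
  favour the quadrupole.\<close>

lemma lead_G3:
  fixes p D e t x M :: real
  assumes D: "D > 0" and p: "p > 0" and M: "M > 0"
    and r: "r = p / D"
    and fx: "fx0 = QXX e t * (r * cos x) + QXY e t * (r * sin x)"
    and fy: "fy0 = QXY e t * (r * cos x) + QYY e t * (r * sin x)"
  shows "r\<^sup>2 / M * (sin x * (r * cos x * fy0 - r * sin x * fx0) / p - fx0) =
    p ^ 3 / M * ((QYY e t - QXX e t) * (sin x * (sin x * cos x) / D ^ 4)
      + QXY e t * (sin x * ((cos x)\<^sup>2 - (sin x)\<^sup>2) / D ^ 4 - sin x / D ^ 3) - QXX e t * (cos x / D ^ 3))"
  unfolding fx fy r using D p M
  by (simp add: field_simps power2_eq_square power3_eq_cube power4_eq_xxxx)

lemma G3_eq: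
  assumes k: "k \<ge> 1" and W: "W \<in> Wdom k" and m: "0 \<le> m" "m \<le> 1/2"
    and b: "bW W x = 0"
  shows "G3 k e m W x = (rW k m W x)\<^sup>2 / (1 - m) *
    (sin x * KW k e m W x / ((cW k m W x)\<^sup>2 / (1 - m)) - fX k e m W x)"
proof -
  have "G3 k e m W x = (rW k m W x)\<^sup>2 / cW k m W x *
      (sin x * (KW k e m W x / cW k m W x) - cW k m W x * fX k e m W x / (1 - m))"
    unfolding G3_def r_c_relation[OF k W m] b by simp
  also have "\<dots> = (rW k m W x)\<^sup>2 / (1 - m) *
    (sin x * KW k e m W x / ((cW k m W x)\<^sup>2 / (1 - m)) - fX k e m W x)"
    using cW_pos[OF k W m, of x] m by (simp add: field_simps power2_eq_square)
  finally show ?thesis .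
qed

text \<open>The factor \<open>p^3 / (1 - m)\<close> equals \<open>lam^2\<close>. After division by
  it, the averaged quadrupole contributes at least \<open>\<pi> k / 2048\<close> minus a constant,
  and half of this pays for the higher terms of the force. At least 1 is left, hence
  \<open>\<eta> = 1 / (49 k^2) / turns k\<close>, which is independent of \<open>e\<close> and
  \<open>m\<close>.\<close>

lemma sign_estimate:
  fixes e1 s :: real
  assumes e1: "0 \<le> e1" "e1 < 1" and s: "s = 1/4 \<or> s = -1/4"
  shows "\<exists>K. \<forall>k::nat. k \<ge> K \<longrightarrow> k \<ge> 1 \<longrightarrow> 330 / real k ^ 2 \<le> ((1 - e1) / 2) ^ 3 \<longrightarrow>
    (\<exists>\<eta>>0. \<forall>e\<in>{0..e1}. \<forall>m\<in>{0..1/2}. \<eta> \<le> s * meanG3 k e m (cconst s))"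
proof -
  obtain C where C: "C \<ge> 0" and quad: "\<And>e t a b. 0 \<le> e \<Longrightarrow> e \<le> e1 \<Longrightarrow> sqrt (a\<^sup>2 + b\<^sup>2) \<le> (1 - e1) / 2 \<Longrightarrow>
    \<bar>FX e t a b - (QXX e t * a + QXY e t * b)\<bar> \<le> C * (a\<^sup>2 + b\<^sup>2) \<and>
    \<bar>FY e t a b - (QXY e t * a + QYY e t * b)\<bar> \<le> C * (a\<^sup>2 + b\<^sup>2)"
    using F_quadrupole[OF e1] by blast
  obtain C' where C': "C' \<ge> 0" and Qd: "\<And>e. 0 \<le> e \<Longrightarrow> e \<le> e1 \<Longrightarrow>
    bounded_deriv (QXX e) C' \<and> bounded_deriv (QXY e) C' \<and> bounded_deriv (QYY e) C'"
    using Q_deriv_bound[OF e1] by blast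
  obtain B where B: "B \<ge> 0" and av: "kernel_bound s B"
    using averaged_kernels[OF s] by blast
  \<comment> \<open>For \<open>p \<le> p0\<close> the remainder \<open>80 C p\<close>, integrated
    over \<open>2\<pi> k\<close>, is at most \<open>\<pi> k / 4096\<close>, half of the main
    term.\<close>
  define p0 where "p0 = 1 / (2 * 4096 * 80 * (C + 1))"
  have p0: "p0 > 0" using C by (simp add: p0_def)
  \<comment> \<open>\<open>k \<ge> u\<close> gives \<open>p^3 \<le> 16 / k^2 \<le> p0^3\<close>, and
    \<open>k \<ge> v\<close> makes the other half of the main term exceed the averaging error by at
    least 1.\<close>
  define u v where "u = 4 / sqrt (p0 ^ 3)" and "v = 4096 * 2 * (B * C' + 1)"
  have uv: "u > 0" "v > 0"
    using p0 B C' by (auto simp: u_def v_def intro!: add_nonneg_pos)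
  define K where "K = nat \<lceil>u + v\<rceil>"
  have Kprop: "16 / real k ^ 2 \<le> p0 ^ 3 \<and> 2 * (B * C' + 1) \<le> real k / 4096" if "k \<ge> K" for k :: nat
  proof -
    have kk: "u + v \<le> real k"
      using that unfolding K_def by linarith
    hence k0: "0 < real k" "u \<le> real k" "v \<le> real k" using uv by linarith+
    have q: "0 < sqrt (p0 ^ 3)" using p0 by simp
    have "4 / real k \<le> sqrt (p0 ^ 3)" using k0(1,2) q unfolding u_def by (simp add: field_simps)
    hence "(4 / real k)\<^sup>2 \<le> (sqrt (p0 ^ 3))\<^sup>2" using k0 by (intro power_mono) auto
    hence "16 / real k ^ 2 \<le> p0 ^ 3" using p0 by (simp add: power_divide)
    moreover have "4096 * 2 * (B * C' + 1) \<le> real k" using k0(3) unfolding v_def .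
    ultimately show ?thesis by simp
  qed
  have main: "1 / (49 * real k ^ 2) / (turns k) \<le> s * meanG3 k e m (cconst s)"
    if kK: "k \<ge> K" and k: "k \<ge> 1" and kL: "330 / real k ^ 2 \<le> ((1 - e1) / 2) ^ 3"
      and e: "e \<in> {0..e1}" and mm: "m \<in> {0..1/2}" for k :: nat and e m
  proof -
    have e': "0 \<le> e" "e \<le> e1" "e < 1" and m: "0 \<le> m" "m \<le> 1/2" using e mm e1 by auto
    define W where "W = cconst s"
    have W: "W \<in> Wdom k" unfolding W_def by (rule cconst_Wdom) (use s in auto)
    define lam where "lam = lamW k W"
    define P where "P = turns k"
    have P: "P > 0" using k by (simp add: P_def)
    have k0: "real k > 0" using k by simp
    have DW: "DW W x = Dk s x" for x unfolding DW_def W_def Dk_def by (simp add: cconst_apply)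
    have hW: "hW W x = wk s x" for x
      unfolding hW_def DW wk_def unfolding W_def by (simp add: cconst_apply)
    have lam: "0 < lam" "1 / (7 * real k) \<le> lam" "lam \<le> 4 / real k"
      using lamW_pos[OF k W] lamW_bounds[OF k W] by (simp_all add: lam_def)
    define p where "p = (cW k m W 0)\<^sup>2 / (1 - m)"
    have cc: "cW k m W x = cW k m W 0" for x unfolding cW_def unfolding W_def by (simp add: cconst_apply)
    have p: "(cW k m W x)\<^sup>2 / (1 - m) = p" for x unfolding p_def cc[of x] ..
    have ppos: "p > 0" unfolding p_def using cW_pos[OF k W m, of 0] m by simp
    have r: "rW k m W x = p / Dk s x" for x
      unfolding rW_def DW p[of x, symmetric] by simp
    have p3: "p ^ 3 = (1 - m) * lam\<^sup>2"
    proof -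
      have "(p / Dk s 0) ^ 3 = (1 - m) * (lam * exp (3 * gW W 0))\<^sup>2 / Dk s 0 ^ 3"
        using rW_cube[OF k W m, of 0] unfolding r DW lam_def .
      thus ?thesis using Dk_nz[OF s, of 0] unfolding W_def by (simp add: cconst_apply power_divide)
    qed
    have "p ^ 3 \<le> 1 * (4 / real k)\<^sup>2"
      unfolding p3 by (intro mult_mono power_mono) (use lam m in auto)
    also have "\<dots> = 16 / real k ^ 2" by (simp add: power_divide)
    also have "\<dots> \<le> p0 ^ 3" using Kprop[OF kK] by simp
    finally have pp0: "p \<le> p0" using p0 by (intro power_le_imp_le_base[of p 2 p0]) (auto simp: eval_nat_numeral)
    define L where "L = (\<lambda>x. (QYY e (tW k W x) - QXX e (tW k W x)) * H1 s x + QXY e (tW k W x) * H2 s x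
        - QXX e (tW k W x) * H3 s x)"
    \<comment> \<open>From \<open>r \<le> 2 p\<close>, a force error of \<open>C r^2\<close> and a
      torque error of \<open>2 C r^3\<close>:
      \<open>4 p^2 (16 C p^2 + 4 C p^2) = 80 C p^4\<close>.\<close>
    have err: "\<bar>G3 k e m W x - p ^ 3 / (1 - m) * L x\<bar> \<le> 80 * C * p ^ 4 / (1 - m)" for x
    proof -
      let ?r = "rW k m W x"
      have rp: "0 < ?r" "?r \<le> 2 * p"
      proof -
        show "0 < ?r" by (rule rW_pos[OF k W m])
        have "p / Dk s x \<le> p / (1/2)" using Dk_bounds(1)[OF s, of x] ppos by (intro divide_left_mono) auto
        thus "?r \<le> 2 * p" unfolding r by simp
      qed
      define fx0 fy0 where "fx0 = QXX e (tW k W x) * (?r * cos x) + QXY e (tW k W x) * (?r * sin x)"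
        and "fy0 = QXY e (tW k W x) * (?r * cos x) + QYY e (tW k W x) * (?r * sin x)"
      have "sqrt ((qX k m W x)\<^sup>2 + (qY k m W x)\<^sup>2) = ?r" by (rule q_norm[OF k e1 kL W m])
      moreover from this have "(qX k m W x)\<^sup>2 + (qY k m W x)\<^sup>2 = ?r\<^sup>2"
        by (metis real_sqrt_pow2 sum_power2_ge_zero)
      ultimately have F: "\<bar>fX k e m W x - fx0\<bar> \<le> C * ?r\<^sup>2" "\<bar>fY k e m W x - fy0\<bar> \<le> C * ?r\<^sup>2"
        using quad[OF e'(1,2), of "qX k m W x" "qY k m W x" "tW k W x"] rW_le[OF k e1 kL W m, of x]
        unfolding fX_def fY_def fx0_def fy0_def qX_def qY_def by auto
      define K0 where "K0 = ?r * cos x * fy0 - ?r * sin x * fx0"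
      have "KW k e m W x - K0 = ?r * (cos x * (fY k e m W x - fy0)) - ?r * (sin x * (fX k e m W x - fx0))"
        unfolding KW_def K0_def qX_def qY_def by (simp add: algebra_simps)
      moreover have "\<bar>?r * (cos x * (fY k e m W x - fy0))\<bar> \<le> ?r * (1 * (C * ?r\<^sup>2))"
        "\<bar>?r * (sin x * (fX k e m W x - fx0))\<bar> \<le> ?r * (1 * (C * ?r\<^sup>2))"
        unfolding abs_mult by (intro mult_mono F; use rp C in simp)+
      moreover have "?r * (1 * (C * ?r\<^sup>2)) = C * ?r ^ 3"
        by (simp add: power3_eq_cube power2_eq_square)
      ultimately have K: "\<bar>KW k e m W x - K0\<bar> \<le> 2 * C * ?r ^ 3"
        by linarith
      have "G3 k e m W x = ?r\<^sup>2 / (1 - m) * (sin x * KW k e m W x / p - fX k e m W x)"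
        using G3_eq[OF k W m, of x e] unfolding p unfolding W_def by (simp add: cconst_apply)
      moreover have "p ^ 3 / (1 - m) * L x = ?r\<^sup>2 / (1 - m) * (sin x * K0 / p - fx0)"
        unfolding L_def H1_def H2_def H3_def K0_def
        by (rule lead_G3[OF _ ppos _ r fx0_def fy0_def, symmetric]) (use Dk_bounds(1)[OF s, of x] m in auto)
      ultimately have "G3 k e m W x - p ^ 3 / (1 - m) * L x
          = ?r\<^sup>2 / (1 - m) * ((sin x * KW k e m W x / p - fX k e m W x) - (sin x * K0 / p - fx0))"
        by (simp only: right_diff_distrib)
      also have "(sin x * KW k e m W x / p - fX k e m W x) - (sin x * K0 / p - fx0)
          = sin x * (KW k e m W x - K0) / p - (fX k e m W x - fx0)"
        by (simp add: algebra_simps diff_divide_distrib)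
      finally have "G3 k e m W x - p ^ 3 / (1 - m) * L x
          = ?r\<^sup>2 / (1 - m) * (sin x * (KW k e m W x - K0) / p - (fX k e m W x - fx0))" .
      hence "\<bar>G3 k e m W x - p ^ 3 / (1 - m) * L x\<bar>
          = ?r\<^sup>2 / (1 - m) * \<bar>sin x * (KW k e m W x - K0) / p - (fX k e m W x - fx0)\<bar>"
        using m by (simp add: abs_mult)
      also have "\<dots> \<le> (2 * p)\<^sup>2 / (1 - m) * (2 * C * (2 * p) ^ 3 / p + C * (2 * p)\<^sup>2)"
      proof (intro mult_mono divide_right_mono power_mono)
        have "\<bar>sin x * (KW k e m W x - K0)\<bar> \<le> 1 * (2 * C * ?r ^ 3)"
          unfolding abs_mult by (intro mult_mono K) auto
        also have "\<dots> \<le> 2 * C * (2 * p) ^ 3"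
          unfolding mult_1 by (intro mult_left_mono power_mono) (use rp C in auto)
        finally have "\<bar>sin x * (KW k e m W x - K0) / p\<bar> \<le> 2 * C * (2 * p) ^ 3 / p"
          using ppos by (simp add: divide_right_mono)
        moreover have "\<bar>fX k e m W x - fx0\<bar> \<le> C * (2 * p)\<^sup>2"
          using F(1) mult_left_mono[OF power_mono[OF rp(2), of 2] C] rp by linarith
        ultimately show "\<bar>sin x * (KW k e m W x - K0) / p - (fX k e m W x - fx0)\<bar> \<le> 2 * C * (2 * p) ^ 3 / p + C * (2 * p)\<^sup>2"
          by linarith
      qed (use rp m ppos in auto)
      also have "\<dots> = 80 * C * p ^ 4 / (1 - m)"
        using ppos by (simp add: field_simps power2_eq_square power3_eq_cube power4_eq_xxxx)
      finally show ?thesis .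
    qed
    have tWc: "continuous_on UNIV (tW k W)" by (rule cont_basic[OF k e1 kL W m e'(1,2)])
    note Qc = Q_continuous[OF e'(1,3)]
    have Qtc: "continuous_on UNIV (\<lambda>x. QXX e (tW k W x))" "continuous_on UNIV (\<lambda>x. QXY e (tW k W x))"
      "continuous_on UNIV (\<lambda>x. QYY e (tW k W x))"
      by (rule continuous_on_compose2[OF Qc(1) tWc] continuous_on_compose2[OF Qc(2) tWc] continuous_on_compose2[OF Qc(3) tWc]; simp)+
    have Lc: "continuous_on UNIV L"
      unfolding L_def by (intro continuous_intros Qtc kepler_kernels_cont[OF s])
    have G3c: "continuous_on UNIV (G3 k e m W)" by (rule cont_G[OF k e1 kL W m e'(1,2)])
    have tWP: "tW k W 0 = 0" "tW k W (turns k) = 2 * pi"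
      using tW_symm(1)[OF k W, of 0] tW_symm(3)[OF k W] by simp_all
    have sL: "s * prim L P \<ge> pi * k / 2048 - B * C'"
      unfolding L_def P_def
      by (rule kernel_bound_def[THEN iffD1, rule_format, OF av k lam(1,3) _ tWP C' _ _ _ refl _ prim_QXX_ge])
        (use Qd[OF e'(1,2)] prim_QXX_eq_QYY[OF e'(1,3)] tW_deriv[OF k W] e' in \<open>auto simp: hW lam_def\<close>)
    have "\<bar>prim (G3 k e m W) P - prim (\<lambda>x. p ^ 3 / (1 - m) * L x) P\<bar> \<le> (80 * C * p ^ 4 / (1 - m)) * P"
      by (rule abs_prim_diff_le[OF G3c continuous_on_mult_left[OF Lc]]) (use err P in auto)
    hence est: "\<bar>prim (G3 k e m W) P - p ^ 3 / (1 - m) * prim L P\<bar> \<le> p ^ 3 / (1 - m) * (80 * C * p * P)"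
      unfolding prim_cmult[OF Lc] by (simp add: eval_nat_numeral ac_simps)
    have s1: "\<bar>s\<bar> \<le> 1" using s by auto
    have "80 * C * p * P \<le> 80 * (C + 1) * p0 * P"
      using C pp0 ppos P by (intro mult_mono) auto
    also have "\<dots> = P / (2 * 4096)" unfolding p0_def using C by (simp add: field_simps)
    also have "\<dots> = pi * k / 4096" by (simp add: P_def)
    finally have small: "80 * C * p * P \<le> pi * k / 4096" .
    have "1 \<le> pi * k / 4096 - B * C'"
    proof -
      have "1 + B * C' \<le> 2 * (B * C' + 1)" using B C' by simp
      also have "\<dots> \<le> real k / 4096" using Kprop[OF kK] by blast
      also have "\<dots> \<le> pi * k / 4096"
        using mult_right_mono[of 1 pi "real k"] pi_gt3 by (intro divide_right_mono) auto
      finally show ?thesis by (simp only: le_diff_eq)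
    qed
    with sL small have good: "1 \<le> s * prim L P - 80 * C * p * P" by linarith
    define q where "q = p ^ 3 / (1 - m)"
    have q: "q = lam\<^sup>2" unfolding q_def p3 using m by simp
    have q0: "q > 0" unfolding q using lam by simp
    define d where "d = prim (G3 k e m W) P - q * prim L P"
    have d: "\<bar>d\<bar> \<le> q * (80 * C * p * P)" using est unfolding d_def q_def .
    have "\<bar>s * d\<bar> \<le> 1 * \<bar>d\<bar>" unfolding abs_mult using s1 by (intro mult_right_mono) auto
    with d have "- (q * (80 * C * p * P)) \<le> s * d" by linarith
    moreover have "s * prim (G3 k e m W) P = q * (s * prim L P) + s * d"
      unfolding d_def by (simp add: algebra_simps)
    moreover have "q * 1 \<le> q * (s * prim L P - 80 * C * p * P)"
      using good q0 by (intro mult_left_mono) auto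
    ultimately have "q \<le> s * prim (G3 k e m W) P" by (simp add: right_diff_distrib)
    moreover have "1 / (49 * real k ^ 2) \<le> q"
      unfolding q using power_mono[OF lam(2), of 2] by (simp add: power_divide power_mult_distrib)
    ultimately have "1 / (49 * real k ^ 2) / P \<le> s * prim (G3 k e m W) P / P"
      using P by (intro divide_right_mono) auto
    thus ?thesis unfolding meanG3_def P_def W_def by simp
  qed
  show ?thesis
  proof (intro exI[of _ K] allI impI)
    fix k :: nat
    assume *: "k \<ge> K" "k \<ge> 1" "330 / real k ^ 2 \<le> ((1 - e1) / 2) ^ 3"
    have "0 < 1 / (49 * real k ^ 2) / (turns k)" using *(2) by simp
    with main[OF *] show "\<exists>\<eta>>0. \<forall>e\<in>{0..e1}. \<forall>m\<in>{0..1/2}. \<eta> \<le> s * meanG3 k e m (cconst s)" by blast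
  qed
qed

section \<open>Periodic orbits of the scaled problem\<close>

text \<open>Variation of constants, with \<open>H = dt/dx\<close>. The velocity belonging to the
  elements is \<open>(M/c) (- (sn + B), cs + A)\<close>, a point of the circular hodograph. The
  first two identities state that the position has this velocity, the last two that the velocity has
  the acceleration of the perturbed Kepler problem.\<close>

lemma kepler_element_algebra:
  fixes c D A B sn cs K fx fy M m H r :: real
  assumes nz: "c > 0" "M > 0" "D > 0"
    and D: "D = 1 + A * cs + B * sn" and r: "r = c\<^sup>2 / (M * D)" and H: "H = r\<^sup>2 / c"
    and K: "K = r * cs * fy - r * sn * fx" and trig: "sn\<^sup>2 + cs\<^sup>2 = 1"
    and g': "g' = m * (H * (K / c))"
    and A': "A' = m * (H * ((cs + A) * (K / c) + c * fy / M))"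
    and B': "B' = m * (H * ((sn + B) * (K / c) - c * fx / M))"
    and r': "r' = r * (2 * g' - (A' * cs - A * sn + B' * sn + B * cs) / D)"
  shows "r' * cs - r * sn = H * (- (M / c) * (sn + B))"
    and "r' * sn + r * cs = H * ((M / c) * (cs + A))"
    and "(M / c) * g' * (sn + B) - (M / c) * (cs + B') = H * (m * fx - M * cs / r\<^sup>2)"
    and "- (M / c) * g' * (cs + A) + (M / c) * (- sn + A') = H * (m * fy - M * sn / r\<^sup>2)"
proof -
  have rp: "r > 0" unfolding r using nz by simp
  have Hp: "H > 0" unfolding H using rp nz by simp
  have trig': "sn * sn = 1 - cs * cs" using trig by (simp add: power2_eq_square)
  \<comment> \<open>Osculation: the variation of the elements adds \<open>2 D g'\<close> to the
    derivative of \<open>D\<close>, which exactly offsets the derivative of \<open>c^2\<close> in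
    \<open>r = c^2 / (M D)\<close>. Hence \<open>r'\<close> is the same as for frozen
    elements.\<close>
  have "A' * cs + B' * sn = m * H * (K / c * ((cs * cs + sn * sn) + A * cs + B * sn) + c / M * (cs * fy - sn * fx))"
    unfolding A' B' by (simp add: algebra_simps diff_divide_distrib add_divide_distrib)
  also have "cs * cs + sn * sn = 1" using trig' by simp
  also have "1 + A * cs + B * sn = D" by (simp add: D)
  also have "c / M * (cs * fy - sn * fx) = K / c * D"
  proof -
    have "K = c\<^sup>2 / (M * D) * (cs * fy - sn * fx)" unfolding K r by (simp add: right_diff_distrib diff_divide_distrib ac_simps)
    thus ?thesis using nz by (simp add: power2_eq_square)
  qed
  finally have D': "A' * cs + B' * sn = 2 * D * g'" unfolding g' by simp
  have r'': "r' = r * (A * sn - B * cs) / D"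
  proof -
    have "A' * cs - A * sn + B' * sn + B * cs = 2 * D * g' - (A * sn - B * cs)" using D' by simp
    thus ?thesis unfolding r' using nz by (simp add: field_simps)
  qed
  have HM: "H * (M / c) = r / D"
    unfolding H r using nz by (simp add: power2_eq_square)
  have "r' * cs - r * sn = r / D * ((A * sn - B * cs) * cs - sn * D)"
    unfolding r'' using nz by (simp add: field_simps)
  also have "(A * sn - B * cs) * cs - sn * D = - (sn + B)"
    unfolding D using trig' by algebra
  finally show "r' * cs - r * sn = H * (- (M / c) * (sn + B))"
    unfolding HM[symmetric] by (simp only: mult.assoc mult_minus_left mult_minus_right)
  have "r' * sn + r * cs = r / D * ((A * sn - B * cs) * sn + cs * D)"
    unfolding r'' using nz by (simp add: field_simps)
  also have "(A * sn - B * cs) * sn + cs * D = cs + A"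
    unfolding D using trig' by algebra
  finally show "r' * sn + r * cs = H * ((M / c) * (cs + A))"
    unfolding HM[symmetric] by (simp only: mult.assoc)
  have HMr: "M / c = H * (M / r\<^sup>2)" unfolding H using nz rp by simp
  have "(M / c) * g' * (sn + B) - (M / c) * (cs + B') = m * H * fx - (M / c) * cs"
    unfolding g' B' using nz by (simp add: field_simps)
  also have "\<dots> = H * (m * fx - M * cs / r\<^sup>2)"
    unfolding HMr by (simp add: algebra_simps)
  finally show "(M / c) * g' * (sn + B) - (M / c) * (cs + B') = H * (m * fx - M * cs / r\<^sup>2)" .
  have "- (M / c) * g' * (cs + A) + (M / c) * (- sn + A') = m * H * fy - (M / c) * sn"
    unfolding g' A' using nz by (simp add: field_simps)
  also have "\<dots> = H * (m * fy - M * sn / r\<^sup>2)"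
    unfolding HMr by (simp add: algebra_simps)
  finally show "- (M / c) * g' * (cs + A) + (M / c) * (- sn + A') = H * (m * fy - M * sn / r\<^sup>2)" .
qed

definition restricted_orbit :: "real \<Rightarrow> real \<Rightarrow> (real \<Rightarrow> real) \<Rightarrow> (real \<Rightarrow> real) \<Rightarrow> (real \<Rightarrow> real) \<Rightarrow> (real \<Rightarrow> real) \<Rightarrow> bool" where
  "restricted_orbit e m a b u v \<longleftrightarrow> (\<forall>t.
     (a has_real_derivative u t) (at t) \<and> (b has_real_derivative v t) (at t) \<and>
     (u has_real_derivative m * FX e t (a t) (b t) - (1 - m) * a t / sqrt ((a t)\<^sup>2 + (b t)\<^sup>2) ^ 3) (at t) \<and>
     (v has_real_derivative m * FY e t (a t) (b t) - (1 - m) * b t / sqrt ((a t)\<^sup>2 + (b t)\<^sup>2) ^ 3) (at t) \<and>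
     a (t + 2 * pi) = a t \<and> b (t + 2 * pi) = b t)"

text \<open>
  The constants are crude bounds for \<open>k\<^sup>2 rW\<^sup>3\<close>; they separate the orbits for \<open>k\<close> and \<open>1000 k\<close>.
\<close>

definition orbit_size :: "nat \<Rightarrow> real \<Rightarrow> (real \<Rightarrow> real) \<Rightarrow> (real \<Rightarrow> real) \<Rightarrow> bool" where
  "orbit_size k \<delta> a b \<longleftrightarrow> (\<forall>t. 1 / (1000 * real k ^ 2) \<le> sqrt ((a t)\<^sup>2 + (b t)\<^sup>2) ^ 3 \<and>
    sqrt ((a t)\<^sup>2 + (b t)\<^sup>2) ^ 3 \<le> 330 / real k ^ 2 \<and> sqrt ((a t)\<^sup>2 + (b t)\<^sup>2) \<le> \<delta>)"

text \<open>A vanishing mean turns \<open>N3\<close> into the plain antiderivative of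
  \<open>G3\<close>, so the elements satisfy their exact equations. The time grows at least linearly
  with the angle, hence its inverse \<open>\<theta>\<close> is defined everywhere and carries the
  solution to the time variable. A time span of \<open>2\<pi>\<close> corresponds to
  \<open>k\<close> turns, under which the curve is invariant.\<close>

lemma orbit_of_fixed_point:
  assumes k: "k \<ge> 1" and e1: "0 \<le> e1" "e1 < 1" and kL: "330 / real k ^ 2 \<le> ((1 - e1) / 2) ^ 3"
    and W: "W \<in> Wdom k" and m: "0 \<le> m" "m \<le> 1/2" and e: "0 \<le> e" "e \<le> e1"
    and fp: "\<And>x. apply_bcontfun W x = (0, s, 0) + m *\<^sub>R NW k e m W x" and mean: "meanG3 k e m W = 0"
  shows "\<exists>a b u v. restricted_orbit e m a b u v \<and> orbit_size k ((1 - e1) / 2) a b"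
proof -
  define H where "H = (\<lambda>x. lamW k W * hW W x)"
  have H0: "H x > 0" for x unfolding H_def by (rule tW_speed_pos[OF k W])
  have td: "(tW k W has_real_derivative H x) (at x)" for x unfolding H_def by (rule tW_deriv[OF k W])
  have "\<exists>x. tW k W x = t" for t
  proof -
    define N where "N = 4 * \<bar>t\<bar> / lamW k W"
    have l: "lamW k W > 0" by (rule lamW_pos[OF k W])
    have N: "N \<ge> 0" using l by (simp add: N_def)
    have "\<bar>t\<bar> = lamW k W * (N / 4)" using l by (simp add: N_def)
    also have "\<dots> \<le> tW k W N" unfolding tW_def
      using prim_hW_bounds(1)[OF W N] l by (intro mult_left_mono) auto
    finally have up: "\<bar>t\<bar> \<le> tW k W N" .
    have "\<exists>x\<ge>- N. x \<le> N \<and> tW k W x = t"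
      by (rule IVT') (use up N tW_symm(2)[OF k W, of N] cont_basic(1)[OF k e1 kL W m e] in auto)
    thus ?thesis by blast
  qed
  then obtain \<theta> where \<theta>: "\<And>t. tW k W (\<theta> t) = t" by metis
  have \<theta>d: "(\<theta> has_real_derivative inverse (H (\<theta> t))) (at t)" for t
    by (rule has_derivative_right_inverse[OF td H0 \<theta>])
  have \<theta>per: "\<theta> (t + 2 * pi) = \<theta> t + turns k" for t
    using strict_mono_eq[OF strict_mono_DERIV_pos[OF td H0], of "\<theta> (t + 2 * pi)" "\<theta> t + turns k"]
    by (simp add: \<theta> tW_symm(1)[OF k W])
  have comp: "((\<lambda>t. f (\<theta> t)) has_real_derivative d) (at t)"
    if "(f has_real_derivative H (\<theta> t) * d) (at (\<theta> t))" for f d t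
    using DERIV_chain2[OF that \<theta>d] H0[of "\<theta> t"] by (simp add: field_simps)
  note Gc = cont_G[OF k e1 kL W m e]
  have el: "gW W = (\<lambda>x. m * prim (G1 k e m W) x)" "aW W = (\<lambda>x. s + m * prim (G2 k e m W) x)"
    "bW W = (\<lambda>x. m * prim (G3 k e m W) x)"
    unfolding gW_def[abs_def] aW_def[abs_def] bW_def[abs_def] fp NW_def N3_def by (simp_all add: mean)
  have gd: "(gW W has_real_derivative m * G1 k e m W x) (at x)" for x
    unfolding el(1) by (intro DERIV_cmult has_derivative_prim Gc)
  have ad: "(aW W has_real_derivative m * G2 k e m W x) (at x)" for x
    unfolding el(2) using DERIV_add[OF DERIV_const DERIV_cmult[OF has_derivative_prim[OF Gc(2)]]] by fastforce
  have bd: "(bW W has_real_derivative m * G3 k e m W x) (at x)" for x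
    unfolding el(3) by (intro DERIV_cmult has_derivative_prim Gc)
  define M where "M = 1 - m"
  have M: "M > 0" using m by (simp add: M_def)
  define c where "c = cW k m W"
  have cp: "c x > 0" for x unfolding c_def by (rule cW_pos[OF k W m])
  have Dp: "DW W x > 0" for x using DW_bounds(1)[OF W, of x] by linarith
  have cd: "(c has_real_derivative c x * (m * G1 k e m W x)) (at x)" for x
    unfolding c_def cW_def[abs_def] using gd[of x] by (auto intro!: derivative_eq_intros)
  define D' where "D' = (\<lambda>x. m * G2 k e m W x * cos x - aW W x * sin x + m * G3 k e m W x * sin x + bW W x * cos x)"
  have Dd: "(DW W has_real_derivative D' x) (at x)" for x
    unfolding DW_def[abs_def] D'_def using ad[of x] bd[of x] by (auto intro!: derivative_eq_intros)
  define r where "r = rW k m W"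
  have rp: "r x > 0" for x unfolding r_def by (rule rW_pos[OF k W m])
  define r' where "r' = (\<lambda>x. r x * (2 * (m * G1 k e m W x) - D' x / DW W x))"
  have req: "r x = (c x)\<^sup>2 / (M * DW W x)" for x unfolding r_def rW_def c_def M_def ..
  have rd: "(r has_real_derivative r' x) (at x)" for x
  proof -
    have "((\<lambda>x. (c x)\<^sup>2 / (M * DW W x)) has_real_derivative
       (2 * c x * (c x * (m * G1 k e m W x)) * (M * DW W x) - (c x)\<^sup>2 * (M * D' x)) / ((M * DW W x) * (M * DW W x))) (at x)"
      using cd[of x] Dd[of x] Dp[of x] M by (auto intro!: derivative_eq_intros)
    also have "(2 * c x * (c x * (m * G1 k e m W x)) * (M * DW W x) - (c x)\<^sup>2 * (M * D' x)) / ((M * DW W x) * (M * DW W x)) = r' x"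
      unfolding r'_def req using Dp[of x] M by (simp add: field_simps power2_eq_square)
    finally show ?thesis unfolding req[abs_def] by simp
  qed
  have alg: "r' x * cos x - r x * sin x = H x * (- (M / c x) * (sin x + bW W x))"
    "r' x * sin x + r x * cos x = H x * ((M / c x) * (cos x + aW W x))"
    "(M / c x) * (m * G1 k e m W x) * (sin x + bW W x) - (M / c x) * (cos x + m * G3 k e m W x)
      = H x * (m * fX k e m W x - M * cos x / (r x)\<^sup>2)"
    "- (M / c x) * (m * G1 k e m W x) * (cos x + aW W x) + (M / c x) * (- sin x + m * G2 k e m W x)
      = H x * (m * fY k e m W x - M * sin x / (r x)\<^sup>2)" for x
    by (rule kepler_element_algebra[OF cp M Dp DW_def req, where K = "KW k e m W x" and fx = "fX k e m W x" and fy = "fY k e m W x"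
        and m = m and A' = "m * G2 k e m W x" and B' = "m * G3 k e m W x" and g' = "m * G1 k e m W x" and r' = "r' x"];
      simp add: H_def r_c_relation[OF k W m] KW_def qX_def qY_def G1_def G2_def G3_def r'_def D'_def r_def c_def M_def)+
  define a b u v where "a = (\<lambda>t. qX k m W (\<theta> t))" and "b = (\<lambda>t. qY k m W (\<theta> t))"
    and "u = (\<lambda>t. - (M / c (\<theta> t)) * (sin (\<theta> t) + bW W (\<theta> t)))"
    and "v = (\<lambda>t. (M / c (\<theta> t)) * (cos (\<theta> t) + aW W (\<theta> t)))"
  have sq: "sqrt ((a t)\<^sup>2 + (b t)\<^sup>2) = r (\<theta> t)" for t
    unfolding a_def b_def r_def by (rule q_norm[OF k e1 kL W m])
  have "restricted_orbit e m a b u v"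
    unfolding restricted_orbit_def
  proof (intro allI conjI)
    fix t
    let ?x = "\<theta> t"
    show "(a has_real_derivative u t) (at t)" unfolding a_def u_def
    proof (rule comp)
      have "(qX k m W has_real_derivative r' ?x * cos ?x - r ?x * sin ?x) (at ?x)"
        unfolding qX_def[abs_def] r_def[symmetric] using rd[of ?x] by (auto intro!: derivative_eq_intros)
      thus "(qX k m W has_real_derivative H ?x * (- (M / c ?x) * (sin ?x + bW W ?x))) (at ?x)"
        unfolding alg .
    qed
    show "(b has_real_derivative v t) (at t)" unfolding b_def v_def
    proof (rule comp)
      have "(qY k m W has_real_derivative r' ?x * sin ?x + r ?x * cos ?x) (at ?x)"
        unfolding qY_def[abs_def] r_def[symmetric] using rd[of ?x] by (auto intro!: derivative_eq_intros)
      thus "(qY k m W has_real_derivative H ?x * ((M / c ?x) * (cos ?x + aW W ?x))) (at ?x)"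
        unfolding alg .
    qed
    have cn: "c ?x \<noteq> 0" using cp[of ?x] by simp
    have ud: "((\<lambda>x. - (M / c x) * (sin x + bW W x)) has_real_derivative
        (M / c ?x) * (m * G1 k e m W ?x) * (sin ?x + bW W ?x) - (M / c ?x) * (cos ?x + m * G3 k e m W ?x)) (at ?x)"
      using cd[of ?x] bd[of ?x] cn by (auto intro!: derivative_eq_intros simp: field_simps)
    have F: "fX k e m W ?x = FX e t (a t) (b t)" "fY k e m W ?x = FY e t (a t) (b t)"
      unfolding fX_def fY_def a_def b_def \<theta> by simp_all
    have ab: "a t = r ?x * cos ?x" "b t = r ?x * sin ?x"
      unfolding a_def b_def qX_def qY_def r_def by simp_all
    have acc: "M * cos ?x / (r ?x)\<^sup>2 = (1 - m) * a t / r ?x ^ 3" "M * sin ?x / (r ?x)\<^sup>2 = (1 - m) * b t / r ?x ^ 3"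
      unfolding ab M_def using rp[of ?x] by (simp_all add: power2_eq_square power3_eq_cube)
    show "(u has_real_derivative m * FX e t (a t) (b t) - (1 - m) * a t / sqrt ((a t)\<^sup>2 + (b t)\<^sup>2) ^ 3) (at t)"
      unfolding sq acc(1)[symmetric] F[symmetric] u_def
      by (rule comp) (use ud in \<open>simp only: alg\<close>)
    have vd: "((\<lambda>x. (M / c x) * (cos x + aW W x)) has_real_derivative
        - (M / c ?x) * (m * G1 k e m W ?x) * (cos ?x + aW W ?x) + (M / c ?x) * (- sin ?x + m * G2 k e m W ?x)) (at ?x)"
      using cd[of ?x] ad[of ?x] cn by (auto intro!: derivative_eq_intros simp: field_simps)
    show "(v has_real_derivative m * FY e t (a t) (b t) - (1 - m) * b t / sqrt ((a t)\<^sup>2 + (b t)\<^sup>2) ^ 3) (at t)"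
      unfolding sq acc(2)[symmetric] F[symmetric] v_def
      by (rule comp) (use vd in \<open>simp only: alg\<close>)
    show "a (t + 2 * pi) = a t" "b (t + 2 * pi) = b t"
      unfolding a_def b_def \<theta>per by (simp_all add: basic_symm[OF k e1 kL W m e])
  qed
  moreover have "1 / (1000 * real k ^ 2) \<le> r x ^ 3" "r x ^ 3 \<le> 330 / real k ^ 2" "r x \<le> (1 - e1) / 2" for x
    using rW_bounds[OF k W m, of x] rW_le[OF k e1 kL W m, of x] unfolding r_def by simp_all
  ultimately show ?thesis unfolding orbit_size_def
    using sq by (intro exI[of _ a] exI[of _ b] exI[of _ u] exI[of _ v]) simp
qed

text \<open>\<open>K\<close> serves the sign estimates at both ends and, through
  \<open>k \<ge> 330 / \<delta>\<close>, the size condition; it depends on \<open>e1\<close> alone,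
  while \<open>m0\<close> depends on \<open>k\<close> as well.\<close>

lemma restricted_orbits_exist:
  assumes e1: "0 \<le> e1" "e1 < (1::real)"
  shows "\<exists>K\<ge>1. \<forall>k\<ge>K::nat. \<exists>m0>0. m0 \<le> 1/2 \<and> (\<forall>e\<in>{0..e1}. \<forall>m\<in>{0<..<m0}. \<exists>a b u v. restricted_orbit e m a b u v \<and> orbit_size k ((1 - e1) / 2) a b)"
proof -
  define \<delta> where "\<delta> = ((1 - e1) / 2) ^ 3"
  have \<delta>: "\<delta> > 0" using e1 by (simp add: \<delta>_def)
  obtain K1 where K1: "\<And>k::nat. k \<ge> K1 \<Longrightarrow> k \<ge> 1 \<Longrightarrow> 330 / real k ^ 2 \<le> \<delta> \<Longrightarrow>
    \<exists>\<eta>>0. \<forall>e\<in>{0..e1}. \<forall>m\<in>{0..1/2}. \<eta> \<le> 1/4 * meanG3 k e m (cconst (1/4))"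
    using sign_estimate[OF e1, of "1/4"] unfolding \<delta>_def by auto
  obtain K2 where K2: "\<And>k::nat. k \<ge> K2 \<Longrightarrow> k \<ge> 1 \<Longrightarrow> 330 / real k ^ 2 \<le> \<delta> \<Longrightarrow>
    \<exists>\<eta>>0. \<forall>e\<in>{0..e1}. \<forall>m\<in>{0..1/2}. \<eta> \<le> -1/4 * meanG3 k e m (cconst (-1/4))"
    using sign_estimate[OF e1, of "-1/4"] unfolding \<delta>_def by auto
  define K where "K = Max {K1, K2, 1, nat \<lceil>330 / \<delta>\<rceil>}"
  have main: "\<exists>m0>0. m0 \<le> 1/2 \<and> (\<forall>e\<in>{0..e1}. \<forall>m\<in>{0<..<m0}. \<exists>a b u v. restricted_orbit e m a b u v \<and> orbit_size k ((1 - e1) / 2) a b)"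
    if "k \<ge> K" for k :: nat
  proof -
    have k: "k \<ge> K1" "k \<ge> K2" "k \<ge> 1" "k \<ge> nat \<lceil>330 / \<delta>\<rceil>" using that by (auto simp: K_def)
    have "330 / \<delta> \<le> real k" using k(4) by linarith
    also have "real k \<le> real k ^ 2" using k(3) by (simp add: power2_eq_square)
    finally have kL: "330 / real k ^ 2 \<le> \<delta>" using \<delta> k(3) by (simp add: field_simps)
    obtain \<eta>1 where \<eta>1: "\<eta>1 > 0" "\<And>e m. e \<in> {0..e1} \<Longrightarrow> m \<in> {0..1/2} \<Longrightarrow> \<eta>1 \<le> 1/4 * meanG3 k e m (cconst (1/4))"
      using K1[OF k(1,3) kL] by blast
    obtain \<eta>2 where \<eta>2: "\<eta>2 > 0" "\<And>e m. e \<in> {0..e1} \<Longrightarrow> m \<in> {0..1/2} \<Longrightarrow> \<eta>2 \<le> -1/4 * meanG3 k e m (cconst (-1/4))"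
      using K2[OF k(2,3) kL] by blast
    obtain m1 L where m1: "m1 > 0" "m1 \<le> 1/2" and L: "L \<ge> 0"
      and fp: "\<And>e m. e \<in> {0..e1} \<Longrightarrow> m \<in> {0..m1} \<Longrightarrow> \<exists>Ws. fixed_branch k e m L Ws"
      using NW_fixed_points[OF k(3) e1 kL[unfolded \<delta>_def]] by metis
    define \<eta> where "\<eta> = min \<eta>1 \<eta>2"
    have \<eta>: "\<eta> > 0" "\<eta> \<le> \<eta>1" "\<eta> \<le> \<eta>2" using \<eta>1 \<eta>2 by (auto simp: \<eta>_def)
    \<comment> \<open>On the unperturbed ellipses with \<open>s = \<plusminus>1/4\<close> the mean
      has absolute value at least \<open>4 \<eta>\<close>; passing to the solved curve moves it by
      at most \<open>L m \<le> \<eta>\<close>, so the signs persist.\<close>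
    define m0 where "m0 = min m1 (\<eta> / (L + 1))"
    have m0: "m0 > 0" "m0 \<le> m1" "m0 \<le> \<eta> / (L + 1)" using m1 \<eta> L by (auto simp: m0_def)
    show ?thesis
    proof (intro exI[of _ m0] conjI ballI)
      show "m0 > 0" "m0 \<le> 1/2" using m0 m1 by auto
      fix e m assume e: "e \<in> {0..e1}" and m: "m \<in> {0<..<m0}"
      have mm: "m \<in> {0..m1}" "m \<in> {0..1/2}" "0 \<le> m" "m \<le> 1/2" using m m0 m1 by auto
      obtain Ws where Ws: "\<And>s. s \<in> {-1/4..1/4} \<Longrightarrow> Ws s \<in> Wdom k"
        "\<And>s x. s \<in> {-1/4..1/4} \<Longrightarrow> apply_bcontfun (Ws s) x = (0, s, 0) + m *\<^sub>R NW k e m (Ws s) x"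
        "\<And>s. s \<in> {-1/4..1/4} \<Longrightarrow> \<bar>meanG3 k e m (Ws s) - meanG3 k e m (cconst s)\<bar> \<le> L * m"
        "continuous_on {-1/4..1/4} (\<lambda>s. meanG3 k e m (Ws s))"
        using fp[OF e mm(1)] unfolding fixed_branch_def by blast
      have "L * m \<le> L * (\<eta> / (L + 1))" using L m m0 by (intro mult_left_mono) auto
      also have "\<dots> \<le> \<eta>" using L \<eta> by (simp add: field_simps)
      finally have Lm: "L * m \<le> \<eta>" .
      have "0 \<le> meanG3 k e m (Ws (1/4))"
        using Ws(3)[of "1/4"] \<eta>1(2)[OF e mm(2)] Lm \<eta> by auto
      moreover have "meanG3 k e m (Ws (-1/4)) \<le> 0"
        using Ws(3)[of "-1/4"] \<eta>2(2)[OF e mm(2)] Lm \<eta> by auto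
      ultimately have "\<exists>s\<ge>-1/4. s \<le> 1/4 \<and> meanG3 k e m (Ws s) = 0"
        using Ws(4) by (intro IVT') auto
      then obtain s where s: "s \<in> {-1/4..1/4}" "meanG3 k e m (Ws s) = 0" by auto
      show "\<exists>a b u v. restricted_orbit e m a b u v \<and> orbit_size k ((1 - e1) / 2) a b"
        by (rule orbit_of_fixed_point[OF k(3) e1 kL[unfolded \<delta>_def] Ws(1)[OF s(1)] mm(3,4) _ _ Ws(2)[OF s(1)] s(2)])
          (use e in auto)
    qed
  qed
  have "K \<ge> 1" by (simp add: K_def)
  with main show ?thesis by blast
qed

section \<open>Smoothness and return to the original coordinates\<close>

text \<open>
  \<open>n\<close>-fold differentiability; continuity of the last derivative is not required.
\<close>

fun Ck :: "nat \<Rightarrow> (real \<Rightarrow> real) \<Rightarrow> bool" where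
  "Ck 0 f = True"
| "Ck (Suc n) f = (\<exists>f'. (\<forall>t. (f has_real_derivative f' t) (at t)) \<and> Ck n f')"

lemma Ck_Suc_I: "(\<And>t. (f has_real_derivative f' t) (at t)) \<Longrightarrow> Ck n f' \<Longrightarrow> Ck (Suc n) f"
  by auto

lemma Ck_SucD: "Ck (Suc n) f \<Longrightarrow> Ck n f"
proof (induction n arbitrary: f)
  case (Suc n)
  then obtain f' where "\<And>t. (f has_real_derivative f' t) (at t)" "Ck (Suc n) f'" by auto
  with Suc.IH[of f'] show ?case by (intro Ck_Suc_I) auto
qed simp

lemma Ck_const: "Ck n (\<lambda>t. c)"
proof (induction n arbitrary: c)
  case (Suc n)
  show ?case by (rule Ck_Suc_I[OF DERIV_const Suc])
qed simp

lemma Ck_add: "Ck n f \<Longrightarrow> Ck n g \<Longrightarrow> Ck n (\<lambda>t. f t + g t)"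
proof (induction n arbitrary: f g)
  case (Suc n)
  then obtain f' g' where "\<And>t. (f has_real_derivative f' t) (at t)" "Ck n f'"
    "\<And>t. (g has_real_derivative g' t) (at t)" "Ck n g'" by auto
  thus ?case by (intro Ck_Suc_I[of _ "\<lambda>t. f' t + g' t"] DERIV_add Suc.IH)
qed simp

lemma Ck_mult: "Ck n f \<Longrightarrow> Ck n g \<Longrightarrow> Ck n (\<lambda>t. f t * g t)"
proof (induction n arbitrary: f g)
  case (Suc n)
  note low = Ck_SucD[OF Suc.prems(1)] Ck_SucD[OF Suc.prems(2)]
  obtain f' g' where d: "\<And>t. (f has_real_derivative f' t) (at t)" "Ck n f'"
    "\<And>t. (g has_real_derivative g' t) (at t)" "Ck n g'" using Suc.prems by auto
  show ?case
    by (rule Ck_Suc_I[OF DERIV_mult[OF d(1,3)]]) (intro Ck_add Suc.IH d low)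
qed simp

lemma Ck_cmult: "Ck n f \<Longrightarrow> Ck n (\<lambda>t. c * f t)"
  by (rule Ck_mult[OF Ck_const])

lemma Ck_diff: "Ck n f \<Longrightarrow> Ck n g \<Longrightarrow> Ck n (\<lambda>t. f t - g t)"
  using Ck_add[of n f "\<lambda>t. - 1 * g t"] Ck_cmult[of n g "- 1"] by simp

lemma Ck_power: "Ck n f \<Longrightarrow> Ck n (\<lambda>t. f t ^ k)"
  by (induction k) (simp_all add: Ck_const Ck_mult)

lemma Ck_inverse: "Ck n f \<Longrightarrow> (\<And>t. f t \<noteq> 0) \<Longrightarrow> Ck n (\<lambda>t. inverse (f t))"
proof (induction n arbitrary: f)
  case (Suc n)
  obtain f' where d: "\<And>t. (f has_real_derivative f' t) (at t)" "Ck n f'" using Suc.prems by auto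
  have "((\<lambda>t. inverse (f t)) has_real_derivative (-1) * (inverse (f t) * (f' t * inverse (f t)))) (at t)" for t
    using DERIV_inverse'[OF d(1) Suc.prems(2), of t] by (simp add: mult.assoc)
  moreover have "Ck n (\<lambda>t. (-1) * (inverse (f t) * (f' t * inverse (f t))))"
    by (intro Ck_cmult Ck_mult d Suc.IH Suc.prems(2) Ck_SucD[OF Suc.prems(1)])
  ultimately show ?case by (rule Ck_Suc_I)
qed simp

lemma Ck_divide: "Ck n f \<Longrightarrow> Ck n g \<Longrightarrow> (\<And>t. g t \<noteq> 0) \<Longrightarrow> Ck n (\<lambda>t. f t / g t)"
  unfolding divide_inverse by (intro Ck_mult Ck_inverse)

lemma Ck_sqrt: "Ck n f \<Longrightarrow> (\<And>t. f t > 0) \<Longrightarrow> Ck n (\<lambda>t. sqrt (f t))"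
proof (induction n arbitrary: f)
  case (Suc n)
  obtain f' where d: "\<And>t. (f has_real_derivative f' t) (at t)" "Ck n f'" using Suc.prems by auto
  have nz: "sqrt (f t) \<noteq> 0" for t using Suc.prems(2)[of t] by simp
  have "((\<lambda>t. sqrt (f t)) has_real_derivative (1/2) * (inverse (sqrt (f t)) * f' t)) (at t)" for t
    using DERIV_chain2[OF DERIV_real_sqrt[OF Suc.prems(2)] d(1), of t] by simp
  moreover have "Ck n (\<lambda>t. (1/2) * (inverse (sqrt (f t)) * f' t))"
    by (intro Ck_cmult Ck_mult d Ck_inverse nz Suc.IH Suc.prems(2) Ck_SucD[OF Suc.prems(1)])
  ultimately show ?case by (rule Ck_Suc_I)
qed simp

lemma Ck_sin_cos: "Ck n f \<Longrightarrow> Ck n (\<lambda>t. sin (f t)) \<and> Ck n (\<lambda>t. cos (f t))"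
proof (induction n arbitrary: f)
  case (Suc n)
  obtain f' where d: "\<And>t. (f has_real_derivative f' t) (at t)" "Ck n f'" using Suc.prems by auto
  have "((\<lambda>t. sin (f t)) has_real_derivative cos (f t) * f' t) (at t)"
    "((\<lambda>t. cos (f t)) has_real_derivative (-1) * (sin (f t) * f' t)) (at t)" for t
    using d(1)[of t] by (auto intro!: derivative_eq_intros)
  moreover have "Ck n (\<lambda>t. cos (f t) * f' t)" "Ck n (\<lambda>t. (-1) * (sin (f t) * f' t))"
    using Suc.IH[OF Ck_SucD[OF Suc.prems]] by (intro Ck_cmult Ck_mult d; blast)+
  ultimately show ?case by (intro conjI Ck_Suc_I)
qed simp

lemma Ck_scale_arg: "Ck n f \<Longrightarrow> Ck n (\<lambda>t. f (c * t))"
proof (induction n arbitrary: f)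
  case (Suc n)
  obtain f' where d: "\<And>t. (f has_real_derivative f' t) (at t)" "Ck n f'" using Suc.prems by auto
  have "((\<lambda>t. f (c * t)) has_real_derivative f' (c * t) * c) (at t)" for t
    by (rule DERIV_chain2[OF d(1)]) (auto intro!: derivative_eq_intros)
  thus ?case by (rule Ck_Suc_I) (intro Ck_mult Ck_const Suc.IH d)
qed simp

lemma Ck_Y:
  assumes "0 \<le> e" "e < 1"
  shows "Ck n (YX e)" "Ck n (YY e)" "Ck n (rho e)"
proof -
  have E: "Ck n (kepE e)"
  proof (induction n)
    case (Suc n)
    have "1 - e * cos (kepE e t) \<noteq> 0" for t using kepler_rho_pos[OF assms, of "kepE e t"] by simp
    hence "Ck n (\<lambda>t. inverse (1 - e * cos (kepE e t)))"
      by (intro Ck_inverse Ck_diff Ck_const Ck_cmult conjunct2[OF Ck_sin_cos] Suc)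
    thus ?case by (rule Ck_Suc_I[OF kepE_deriv[OF assms]])
  qed simp
  show "Ck n (YX e)" "Ck n (YY e)" "Ck n (rho e)"
    unfolding YX_def[abs_def] YY_def[abs_def] rho_def[abs_def]
    by (intro Ck_diff Ck_const Ck_cmult conjunct1[OF Ck_sin_cos] conjunct2[OF Ck_sin_cos] E)+
qed

text \<open>Bootstrapping: away from both primaries the accelerations are smooth expressions in time
  and position, so each step gains one derivative. Positions and velocities must be carried through
  the induction together.\<close>

lemma Ck_restricted_orbit:
  assumes e: "0 \<le> e" "e < 1" and orb: "restricted_orbit e m a b u v"
    and pos: "\<And>t. 0 < sqrt ((a t)\<^sup>2 + (b t)\<^sup>2)" "\<And>t. sqrt ((a t)\<^sup>2 + (b t)\<^sup>2) \<le> (1 - e) / 2"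
  shows "Ck n a" "Ck n b"
proof -
  have d: "(a has_real_derivative u t) (at t)" "(b has_real_derivative v t) (at t)"
     "(u has_real_derivative m * FX e t (a t) (b t) - (1 - m) * a t / sqrt ((a t)\<^sup>2 + (b t)\<^sup>2) ^ 3) (at t)"
     "(v has_real_derivative m * FY e t (a t) (b t) - (1 - m) * b t / sqrt ((a t)\<^sup>2 + (b t)\<^sup>2) ^ 3) (at t)" for t
    using orb unfolding restricted_orbit_def by blast+
  have p1: "0 < (a t)\<^sup>2 + (b t)\<^sup>2" for t using pos(1)[of t] by simp
  have "(1 - e) / 2 \<le> sqrt ((YX e t - a t)\<^sup>2 + (YY e t - b t)\<^sup>2)" for t
    by (rule sep_lower[OF e e(1) order.refl pos(2)])
  moreover have "0 < (1 - e) / 2" using e by simp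
  ultimately have p2: "0 < sqrt ((YX e t - a t)\<^sup>2 + (YY e t - b t)\<^sup>2)" for t
    using less_le_trans by blast
  hence p3: "0 < (YX e t - a t)\<^sup>2 + (YY e t - b t)\<^sup>2" for t by (simp only: real_sqrt_gt_0_iff)
  have p4: "rho e t \<noteq> 0" for t using rho_pos[OF e, of t] by simp
  have "Ck n a \<and> Ck n b \<and> Ck n u \<and> Ck n v"
  proof (induction n)
    case (Suc n)
    hence ab: "Ck n a" "Ck n b" and uv: "Ck n u" "Ck n v" by auto
    have nz: "sqrt ((a t)\<^sup>2 + (b t)\<^sup>2) ^ 3 \<noteq> 0" "sqrt ((YX e t - a t)\<^sup>2 + (YY e t - b t)\<^sup>2) ^ 3 \<noteq> 0" "rho e t ^ 3 \<noteq> 0" for t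
      by (intro power_not_zero less_imp_neq[THEN not_sym] pos(1) p2 p4)+
    have den: "Ck n (\<lambda>t. sqrt ((a t)\<^sup>2 + (b t)\<^sup>2) ^ 3)" "Ck n (\<lambda>t. sqrt ((YX e t - a t)\<^sup>2 + (YY e t - b t)\<^sup>2) ^ 3)"
      "Ck n (\<lambda>t. rho e t ^ 3)"
      by (intro Ck_power Ck_sqrt Ck_add Ck_diff Ck_Y e ab p1 p3)+
    have acc: "Ck n (\<lambda>t. m * FX e t (a t) (b t) - (1 - m) * a t / sqrt ((a t)\<^sup>2 + (b t)\<^sup>2) ^ 3)"
      "Ck n (\<lambda>t. m * FY e t (a t) (b t) - (1 - m) * b t / sqrt ((a t)\<^sup>2 + (b t)\<^sup>2) ^ 3)"
      unfolding FX_def FY_def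
      by (intro Ck_diff Ck_divide Ck_cmult Ck_Y e ab nz den)+
    show ?case
      using Ck_Suc_I[OF d(1) uv(1)] Ck_Suc_I[OF d(2) uv(2)] Ck_Suc_I[OF d(3) acc(1)] Ck_Suc_I[OF d(4) acc(2)]
      by blast
  qed simp
  thus "Ck n a" "Ck n b" by auto
qed

text \<open>\<open>Ck\<close> offers a separate chain of derivatives for each order; uniqueness of
  derivatives merges them into the single sequence that \<open>smooth_on\<close> demands.\<close>

lemma Ck_iterated_deriv:
  assumes "\<And>n. Ck n f"
  shows "((deriv ^^ k) f has_real_derivative (deriv ^^ Suc k) f t) (at t)"
proof -
  have step: "(\<forall>t. (g has_real_derivative deriv g t) (at t)) \<and> (\<forall>n. Ck n (deriv g))"
    if g: "\<forall>n. Ck n g" for g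
  proof -
    have "(\<forall>t. (g has_real_derivative deriv g t) (at t)) \<and> Ck n (deriv g)" for n
    proof -
      obtain g' where g': "\<forall>t. (g has_real_derivative g' t) (at t)" "Ck n g'"
        using spec[OF g, of "Suc n"] by auto
      have "deriv g = g'" using g'(1) by (auto intro: DERIV_imp_deriv)
      thus ?thesis using g' by simp
    qed
    thus ?thesis by blast
  qed
  have "\<forall>n. Ck n ((deriv ^^ k) f)"
    by (induction k) (use assms step in auto)
  with step show ?thesis by simp
qed

lemma scaleR_has_vector_derivative:
  fixes b :: "'a::real_normed_vector"
  assumes "(f has_real_derivative f') (at t)"
  shows "((\<lambda>t. f t *\<^sub>R b) has_vector_derivative f' *\<^sub>R b) (at t)"
  using has_vector_derivative_scaleR[OF assms has_vector_derivative_const] by simp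

lemma smooth_on_combination:
  fixes b1 b2 :: "'a::real_normed_vector"
  assumes "\<And>n. Ck n f" "\<And>n. Ck n g"
  shows "smooth_on S (\<lambda>t. f t *\<^sub>R b1 + g t *\<^sub>R b2)"
  unfolding smooth_on_def
proof (intro exI conjI allI ballI)
  let ?D = "\<lambda>n t. (deriv ^^ n) f t *\<^sub>R b1 + (deriv ^^ n) g t *\<^sub>R b2"
  show "?D 0 = (\<lambda>t. f t *\<^sub>R b1 + g t *\<^sub>R b2)" by simp
  fix n t
  show "(?D n has_vector_derivative ?D (Suc n) t) (at t within S)"
    by (intro has_vector_derivative_at_within[OF has_vector_derivative_add] scaleR_has_vector_derivative
        Ck_iterated_deriv assms)
qed

section \<open>The orbital plane in space and the inversion of the scaling\<close>

definition emb :: "real^3^3 \<Rightarrow> real \<Rightarrow> real \<Rightarrow> real^3" where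
  "emb R p q = R *v vector [p, q, 0]"

lemma emb_linear:
  "emb R p q = p *\<^sub>R emb R 1 0 + q *\<^sub>R emb R 0 1"
proof -
  have "(vector [p, q, 0] :: real^3) = p *\<^sub>R vector [1, 0, 0] + q *\<^sub>R vector [0, 1, 0]"
    by (simp add: vec_eq_iff forall_3)
  thus ?thesis unfolding emb_def by (simp only: matrix_vector_right_distrib matrix_vector_mult_scaleR)
qed

lemma emb_scaleR: "c *\<^sub>R emb R p q = emb R (c * p) (c * q)"
  unfolding emb_linear[of R p q] emb_linear[of R "c * p" "c * q"] by (simp add: scaleR_add_right)

lemma emb_diff: "emb R p q - emb R p' q' = emb R (p - p') (q - q')"
  unfolding emb_linear[of R p q] emb_linear[of R p' q'] emb_linear[of R "p - p'" "q - q'"]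
  by (simp add: scaleR_diff_left)

lemma emb_add: "emb R p q + emb R p' q' = emb R (p + p') (q + q')"
  unfolding emb_linear[of R p q] emb_linear[of R p' q'] emb_linear[of R "p + p'" "q + q'"]
  by (simp add: scaleR_add_left)

lemma norm_emb:
  assumes "rotation_matrix R"
  shows "norm (emb R p q) = sqrt (p\<^sup>2 + q\<^sup>2)"
proof -
  have "orthogonal_transformation ((*v) R)"
    using assms unfolding rotation_matrix_def
    by (simp add: orthogonal_transformation_matrix)
  hence "norm (emb R p q) = norm (vector [p, q, 0] :: real^3)"
    unfolding emb_def by (rule orthogonal_transformation_norm)
  also have "\<dots> = sqrt (p\<^sup>2 + q\<^sup>2)"
    by (simp add: norm_eq_sqrt_inner inner_vec_def sum_3 power2_eq_square)
  finally show ?thesis .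
qed

lemma emb_has_vector_derivative:
  assumes "(f has_real_derivative f') (at t)" "(g has_real_derivative g') (at t)"
  shows "((\<lambda>t. emb R (f t) (g t)) has_vector_derivative emb R f' g') (at t)"
  unfolding emb_linear[of R "f _"] emb_linear[of R f']
  by (intro has_vector_derivative_add scaleR_has_vector_derivative assms)

text \<open>\<open>n\<close> is the mean motion and \<open>A\<close> the semi-major axis of the
  relative orbit; \<open>n^2 A^3 = 1\<close> is Kepler's third law for total mass 1. Since the
  particle stays away from both primaries, the collision set is empty and the conditions at
  collisions hold vacuously.\<close>

lemma generalized_solution_of_orbit:
  fixes R :: "real^3^3" and X x :: "real \<Rightarrow> real^3"
  assumes R: "rotation_matrix R" and M: "M > 0" "m > 0" "m + M = 1" and a0: "a0 > 0" and e: "0 \<le> e" "e < 1"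
    and v: "\<And>t. v t - e * sin (v t) = m powr (3/2) / a0 powr (3/2) * t"
    and X: "\<And>t. X t = R *v vector [a0 * (cos (v t) - e), a0 * sqrt (1 - e\<^sup>2) * sin (v t), 0]"
    and x: "\<And>t. M *\<^sub>R X t + m *\<^sub>R x t = 0"
    and T: "T = 2 * pi * a0 powr (3/2) / m powr (3/2)"
    and orb: "restricted_orbit e m a b u w"
    and pos: "\<And>t. 0 < sqrt ((a t)\<^sup>2 + (b t)\<^sup>2)" "\<And>t. sqrt ((a t)\<^sup>2 + (b t)\<^sup>2) \<le> (1 - e) / 2"
  shows "\<exists>\<xi>. generalized_periodic_solution M m X x T \<xi> \<and>
    (\<forall>t. norm (\<xi> t - X t) = a0 / m * sqrt ((a (m powr (3/2) / a0 powr (3/2) * t))\<^sup>2 + (b (m powr (3/2) / a0 powr (3/2) * t))\<^sup>2))"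
proof -
  define n where "n = m powr (3/2) / a0 powr (3/2)"
  define A where "A = a0 / m"
  have n: "n > 0" using M a0 by (simp add: n_def)
  have A: "A > 0" using M a0 by (simp add: A_def)
  have Am: "A * m = a0" using M by (simp add: A_def)
  have cube: "(z powr (3/2))\<^sup>2 = z ^ 3" if "z > 0" for z :: real
  proof -
    have "(z powr (3/2))\<^sup>2 = z powr (3/2 * 2)" using that by (simp add: powr_powr flip: powr_numeral)
    also have "\<dots> = z ^ 3" using that by (simp add: powr_numeral)
    finally show ?thesis .
  qed
  have n2: "n\<^sup>2 * A ^ 3 = 1"
    unfolding n_def A_def power_divide cube[OF M(2)] cube[OF a0] using M a0 by simp
  have nT: "n * T = 2 * pi" unfolding n_def T using M a0 by simp
  have v_eq: "v t = kepE e (n * t)" for t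
    using kepE_unique[OF e, of "v t" "n * t"] v[of t] by (simp add: n_def)
  have Xe: "X t = emb R (- (A * m * YX e (n * t))) (- (A * m * YY e (n * t)))" for t
    unfolding X emb_def Am v_eq YX_def YY_def by (simp add: algebra_simps)
  have xe: "x t = emb R (A * (M * YX e (n * t))) (A * (M * YY e (n * t)))" for t
  proof -
    have mx: "m *\<^sub>R x t = (- M) *\<^sub>R X t" using x[of t] by (simp add: eq_neg_iff_add_eq_0 add.commute)
    have "x t = (1 / m) *\<^sub>R (m *\<^sub>R x t)" using M by simp
    also have "\<dots> = (1 / m) *\<^sub>R ((- M) *\<^sub>R X t)" unfolding mx ..
    finally have "x t = (1 / m) *\<^sub>R ((- M) *\<^sub>R X t)" .
    thus ?thesis unfolding Xe emb_scaleR using M by (simp add: mult.left_commute)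
  qed
  \<comment> \<open>\<open>\<xi>\<close> is the primary, at \<open>- A m (YX, YY)\<close> in the
    orbital plane, plus the scaled relative position \<open>A (a, b)\<close>.\<close>
  define f g where "f = (\<lambda>t. A * (a (n * t) - m * YX e (n * t)))" and "g = (\<lambda>t. A * (b (n * t) - m * YY e (n * t)))"
  define \<xi> where "\<xi> = (\<lambda>t. emb R (f t) (g t))"
  define r d where "r = (\<lambda>t. sqrt ((a t)\<^sup>2 + (b t)\<^sup>2))"
    and "d = (\<lambda>t. sqrt ((YX e t - a t)\<^sup>2 + (YY e t - b t)\<^sup>2))"
  have r: "r t > 0" for t unfolding r_def by (rule pos)
  have d: "d t > 0" for t
  proof -
    have "(1 - e) / 2 \<le> d t" unfolding d_def
      by (rule sep_lower[OF e e(1) order.refl pos(2)])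
    moreover have "0 < (1 - e) / 2" using e by simp
    ultimately show ?thesis by linarith
  qed
  have X\<xi>: "X t - \<xi> t = emb R (- (A * a (n * t))) (- (A * b (n * t)))" for t
    unfolding Xe \<xi>_def f_def g_def emb_diff by (simp add: algebra_simps)
  have x\<xi>: "x t - \<xi> t = emb R (A * (YX e (n * t) - a (n * t))) (A * (YY e (n * t) - b (n * t)))" for t
  proof -
    have "A * (M * z) - A * (q - m * z) = A * (z - q)" for z q
    proof -
      have "A * (M * z) - A * (q - m * z) = A * ((m + M) * z - q)" by (simp add: algebra_simps)
      thus ?thesis using M by simp
    qed
    thus ?thesis unfolding xe \<xi>_def f_def g_def emb_diff by simp
  qed
  have sq: "sqrt ((A * p)\<^sup>2 + (A * q)\<^sup>2) = A * sqrt (p\<^sup>2 + q\<^sup>2)" for p q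
  proof -
    have "(A * p)\<^sup>2 + (A * q)\<^sup>2 = A\<^sup>2 * (p\<^sup>2 + q\<^sup>2)" by (simp add: power_mult_distrib distrib_left)
    thus ?thesis using A by (simp add: real_sqrt_mult)
  qed
  have nX: "norm (X t - \<xi> t) = A * r (n * t)" for t
    unfolding X\<xi> norm_emb[OF R] r_def by (simp add: sq)
  have nx: "norm (x t - \<xi> t) = A * d (n * t)" for t
    unfolding x\<xi> norm_emb[OF R] d_def sq ..
  have Z: "{t. \<xi> t = X t} = {}"
  proof -
    have "\<xi> t \<noteq> X t" for t
    proof
      assume "\<xi> t = X t"
      hence "A * r (n * t) = 0" using nX[of t] by simp
      thus False using A r[of "n * t"] by simp
    qed
    thus ?thesis by simp
  qed
  have Zx: "{t. \<xi> t = x t} = {}"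
  proof -
    have "\<xi> t \<noteq> x t" for t
    proof
      assume "\<xi> t = x t"
      hence "A * d (n * t) = 0" using nx[of t] by simp
      thus False using A d[of "n * t"] by simp
    qed
    thus ?thesis by simp
  qed
  have ab: "Ck k a" "Ck k b" for k
    by (rule Ck_restricted_orbit[OF e orb pos])+
  have fg: "Ck k f" "Ck k g" for k
    unfolding f_def g_def by (intro Ck_cmult Ck_diff Ck_scale_arg ab Ck_Y[OF e])+
  have smooth: "smooth_on S \<xi>" for S
    unfolding \<xi>_def emb_linear[of R "f _"] by (rule smooth_on_combination[OF fg])
  define f1 g1 where "f1 = (\<lambda>t. n * A * (u (n * t) - m * VX e (n * t)))" and "g1 = (\<lambda>t. n * A * (w (n * t) - m * VY e (n * t)))"
  define ac where "ac = (\<lambda>(y::real) q t. m * ((y - q) / d t ^ 3) - M * (q / r t ^ 3))"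
  have M1: "1 - m = M" using M by simp
  have od: "(a has_real_derivative u t) (at t)" "(b has_real_derivative w t) (at t)"
     "(u has_real_derivative m * FX e t (a t) (b t) - M * a t / r t ^ 3) (at t)"
     "(w has_real_derivative m * FY e t (a t) (b t) - M * b t / r t ^ 3) (at t)"
     "a (t + 2 * pi) = a t" "b (t + 2 * pi) = b t" for t
    using orb unfolding restricted_orbit_def r_def M1 by blast+
  have scale: "((\<lambda>t. h (n * t)) has_real_derivative n * h') (at t)" if "(h has_real_derivative h') (at (n * t))" for h h' t
    using DERIV_chain2[where g = "\<lambda>t. n * t" and x = t, OF that DERIV_cmult_Id[of n]] by (simp add: mult.commute)
  have f1: "(f has_real_derivative f1 t) (at t)" "(g has_real_derivative g1 t) (at t)" for t
  proof -
    have "(f has_real_derivative A * (n * u (n * t) - m * (n * VX e (n * t)))) (at t)"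
      unfolding f_def by (intro DERIV_cmult DERIV_diff scale od Y_deriv e)
    thus "(f has_real_derivative f1 t) (at t)" unfolding f1_def by (simp add: algebra_simps)
    have "(g has_real_derivative A * (n * w (n * t) - m * (n * VY e (n * t)))) (at t)"
      unfolding g_def by (intro DERIV_cmult DERIV_diff scale od Y_deriv e)
    thus "(g has_real_derivative g1 t) (at t)" unfolding g1_def by (simp add: algebra_simps)
  qed
  have acc: "m * FX e t (a t) (b t) - M * a t / r t ^ 3 - m * (- YX e t / rho e t ^ 3) = ac (YX e t) (a t) t"
    "m * FY e t (a t) (b t) - M * b t / r t ^ 3 - m * (- YY e t / rho e t ^ 3) = ac (YY e t) (b t) t" for t
    unfolding FX_def FY_def ac_def d_def by (simp_all add: algebra_simps)
  have f2: "(f1 has_real_derivative n\<^sup>2 * A * ac (YX e (n * t)) (a (n * t)) (n * t)) (at t)"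
    "(g1 has_real_derivative n\<^sup>2 * A * ac (YY e (n * t)) (b (n * t)) (n * t)) (at t)" for t
  proof -
    have "(f1 has_real_derivative n * A * (n * (m * FX e (n * t) (a (n * t)) (b (n * t)) - M * a (n * t) / r (n * t) ^ 3)
        - m * (n * (- YX e (n * t) / rho e (n * t) ^ 3)))) (at t)"
      unfolding f1_def by (intro DERIV_cmult DERIV_diff scale od V_deriv e)
    thus "(f1 has_real_derivative n\<^sup>2 * A * ac (YX e (n * t)) (a (n * t)) (n * t)) (at t)"
      unfolding acc[symmetric] by (simp add: algebra_simps power2_eq_square)
    have "(g1 has_real_derivative n * A * (n * (m * FY e (n * t) (a (n * t)) (b (n * t)) - M * b (n * t) / r (n * t) ^ 3)
        - m * (n * (- YY e (n * t) / rho e (n * t) ^ 3)))) (at t)"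
      unfolding g1_def by (intro DERIV_cmult DERIV_diff scale od V_deriv e)
    thus "(g1 has_real_derivative n\<^sup>2 * A * ac (YY e (n * t)) (b (n * t)) (n * t)) (at t)"
      unfolding acc[symmetric] by (simp add: algebra_simps power2_eq_square)
  qed
  have vel: "vector_derivative \<xi> (at t) = emb R (f1 t) (g1 t)" for t
    unfolding \<xi>_def by (rule vector_derivative_at[OF emb_has_vector_derivative[OF f1]])
  have vel2: "vector_derivative (\<lambda>t. vector_derivative \<xi> (at t)) (at t)
      = emb R (n\<^sup>2 * A * ac (YX e (n * t)) (a (n * t)) (n * t)) (n\<^sup>2 * A * ac (YY e (n * t)) (b (n * t)) (n * t))" for t
    unfolding vel by (rule vector_derivative_at[OF emb_has_vector_derivative[OF f2]])
  have force: "force M m (X t) (x t) (\<xi> t)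
      = emb R (n\<^sup>2 * A * ac (YX e (n * t)) (a (n * t)) (n * t)) (n\<^sup>2 * A * ac (YY e (n * t)) (b (n * t)) (n * t))" for t
  proof -
    have n2A: "n\<^sup>2 * A = A / A ^ 3" using n2 A by (simp add: field_simps)
    have "M / (A * r (n * t)) ^ 3 * - (A * q) + m / (A * d (n * t)) ^ 3 * (A * (y - q)) = n\<^sup>2 * A * ac y q (n * t)" for y q
      unfolding n2A ac_def power_mult_distrib by (simp add: algebra_simps diff_divide_distrib)
    thus ?thesis unfolding force_def nX nx unfolding X\<xi> x\<xi> emb_scaleR emb_add by simp
  qed
  have per: "\<xi> (t + T) = \<xi> t" for t
  proof -
    have "n * (t + T) = n * t + 2 * pi" using nT by (simp add: distrib_left)
    thus ?thesis unfolding \<xi>_def f_def g_def by (simp add: od Y_periodic[OF e])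
  qed
  have cont: "continuous_on UNIV \<xi>"
    unfolding \<xi>_def
    by (intro continuous_at_imp_continuous_on ballI
        has_vector_derivative_continuous[OF emb_has_vector_derivative[OF f1]])
  have "generalized_periodic_solution M m X x T \<xi>"
    unfolding generalized_periodic_solution_def Let_def Z
    using cont per Zx smooth force vel2 by (simp add: discrete_def)
  moreover have "norm (\<xi> t - X t) = a0 / m * sqrt ((a (m powr (3/2) / a0 powr (3/2) * t))\<^sup>2 + (b (m powr (3/2) / a0 powr (3/2) * t))\<^sup>2)" for t
    using nX[of t] unfolding norm_minus_commute[of "\<xi> t"] A_def r_def n_def .
  ultimately show ?thesis by blast
qed

section \<open>Small parameters and the count of solutions\<close>

lemma smooth_on_at_right_0:
  assumes "smooth_on {0..1} f"
  shows "(f \<longlongrightarrow> f 0) (at_right 0)"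
proof -
  obtain D where "D 0 = f" "\<forall>n. \<forall>t\<in>{0..1}. (D n has_vector_derivative D (Suc n) t) (at t within {0..1})"
    using assms unfolding smooth_on_def by blast
  hence "(f has_vector_derivative D (Suc 0) 0) (at 0 within {0..1})" by force
  hence "continuous (at 0 within {0..1}) f" by (rule has_vector_derivative_continuous)
  thus ?thesis by (simp add: continuous_within at_within_Icc_at_right)
qed

theorem theorem4p1:
  fixes R :: "real \<Rightarrow> real^3^3"
    and m M a e :: "real \<Rightarrow> real"
    and v :: "real \<Rightarrow> real \<Rightarrow> real"
    and X x :: "real \<Rightarrow> real \<Rightarrow> real^3"
    and T :: "real \<Rightarrow> real" and T0 :: real
    and l :: nat
  assumes "\<And>\<epsilon>. \<epsilon> \<in> {0..1} \<Longrightarrow> rotation_matrix (R \<epsilon>)"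
    and "smooth_on {0..1} R"
    and "smooth_on {0..1} m" and "smooth_on {0..1} M"
    and "smooth_on {0..1} a" and "smooth_on {0..1} e"
    and "\<And>\<epsilon>. \<epsilon> \<in> {0<..1} \<Longrightarrow>
           m \<epsilon> > 0 \<and> M \<epsilon> > 0 \<and> m \<epsilon> + M \<epsilon> = 1 \<and> a \<epsilon> > 0 \<and> 0 \<le> e \<epsilon> \<and> e \<epsilon> < 1"
    and "\<And>\<epsilon> t. \<epsilon> \<in> {0<..1} \<Longrightarrow>
           v \<epsilon> t - e \<epsilon> * sin (v \<epsilon> t) = m \<epsilon> powr (3/2) / a \<epsilon> powr (3/2) * t"
    and "\<And>\<epsilon> t. \<epsilon> \<in> {0<..1} \<Longrightarrow>
           X \<epsilon> t = R \<epsilon> *v vector [a \<epsilon> * (cos (v \<epsilon> t) - e \<epsilon>),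
                                   a \<epsilon> * sqrt (1 - (e \<epsilon>)\<^sup>2) * sin (v \<epsilon> t), 0]"
    and "\<And>\<epsilon> t. \<epsilon> \<in> {0<..1} \<Longrightarrow> M \<epsilon> *\<^sub>R X \<epsilon> t + m \<epsilon> *\<^sub>R x \<epsilon> t = 0"
    and "\<And>\<epsilon>. \<epsilon> \<in> {0<..1} \<Longrightarrow> T \<epsilon> = 2 * pi * a \<epsilon> powr (3/2) / m \<epsilon> powr (3/2)"
    and "m 0 = 0" and "e 0 < 1"
    and "(T \<longlongrightarrow> T0) (at_right 0)" and "T0 > 0"
    and "l \<ge> 1"
  shows "\<exists>\<epsilon>l\<in>{0<..1}. \<forall>\<epsilon>\<in>{0<..<\<epsilon>l}.
           \<exists>S. S \<subseteq> {\<xi>. generalized_periodic_solution (M \<epsilon>) (m \<epsilon>) (X \<epsilon>) (x \<epsilon>) (T \<epsilon>) \<xi>} \<and>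
               finite S \<and> card S = l"
proof -
  \<comment> \<open>The midpoint between \<open>e 0\<close> and 1, below which the eccentricities
    stay for small \<open>\<epsilon>\<close> by continuity; the maximum with 0 makes
    \<open>0 \<le> e1\<close> immediate.\<close>
  define e1 where "e1 = (1 + max 0 (e 0)) / 2"
  have e1: "0 \<le> e1" "e1 < 1" "e 0 < e1" using assms(13) by (auto simp: e1_def max_def)
  obtain K where K: "K \<ge> 1" and orbits: "\<And>k. k \<ge> K \<Longrightarrow> \<exists>m0>0. m0 \<le> 1/2 \<and>
    (\<forall>e\<in>{0..e1}. \<forall>m\<in>{0<..<m0}. \<exists>a b u v. restricted_orbit e m a b u v \<and> orbit_size k ((1 - e1) / 2) a b)"
    using restricted_orbits_exist[OF e1(1,2)] by blast
  \<comment> \<open>The factor 1000 makes the size ranges of \<open>orbit_size\<close> disjoint: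
    \<open>330 / (1000 k)^2 < 1 / (1000 k^2)\<close>.\<close>
  define k where "k = (\<lambda>j::nat. K * 1000 ^ j)"
  have kK: "k j \<ge> K" for j unfolding k_def by simp
  from orbits[OF kK] obtain mu where mu: "\<And>j. mu j > 0" and orb: "\<And>j e m. e \<in> {0..e1} \<Longrightarrow> m \<in> {0<..<mu j} \<Longrightarrow>
    \<exists>a b u v. restricted_orbit e m a b u v \<and> orbit_size (k j) ((1 - e1) / 2) a b"
    by metis
  define m1 where "m1 = Min (mu ` {..<l})"
  have m1: "m1 > 0" "\<And>j. j < l \<Longrightarrow> m1 \<le> mu j"
    using assms(16) mu by (auto simp: m1_def Min_gr_iff lessThan_empty_iff)
  have "eventually (\<lambda>\<epsilon>. m \<epsilon> < m1) (at_right 0)"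
    using order_tendstoD(2)[OF smooth_on_at_right_0[OF assms(3)]] m1 assms(12) by simp
  moreover have "eventually (\<lambda>\<epsilon>. e \<epsilon> < e1) (at_right 0)"
    using order_tendstoD(2)[OF smooth_on_at_right_0[OF assms(6)] e1(3)] .
  ultimately have "eventually (\<lambda>\<epsilon>. m \<epsilon> < m1 \<and> e \<epsilon> < e1) (at_right 0)"
    by (rule eventually_conj)
  then obtain \<beta> where \<beta>: "\<beta> > 0" "\<And>\<epsilon>. 0 < \<epsilon> \<Longrightarrow> \<epsilon> < \<beta> \<Longrightarrow> m \<epsilon> < m1 \<and> e \<epsilon> < e1"
    unfolding eventually_at_right_field by auto
  show ?thesis
  proof (intro bexI[of _ "min 1 \<beta>"] ballI)
    show "min 1 \<beta> \<in> {0<..1}" using \<beta> by auto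
    fix \<epsilon> assume "\<epsilon> \<in> {0<..<min 1 \<beta>}"
    hence \<epsilon>: "\<epsilon> \<in> {0<..1}" "\<epsilon> \<in> {0..1}" "0 < \<epsilon>" "\<epsilon> < \<beta>" by auto
    note par = assms(7)[OF \<epsilon>(1)] and small = \<beta>(2)[OF \<epsilon>(3,4)]
    have rot: "rotation_matrix (R \<epsilon>)" by (rule assms(1)[OF \<epsilon>(2)])
    define A where "A = a \<epsilon> / m \<epsilon>"
    have A: "A > 0" using par by (simp add: A_def)
    have "\<exists>\<xi> r. generalized_periodic_solution (M \<epsilon>) (m \<epsilon>) (X \<epsilon>) (x \<epsilon>) (T \<epsilon>) \<xi> \<and>
        norm (\<xi> 0 - X \<epsilon> 0) = A * r \<and> 1 / (1000 * real (k j) ^ 2) \<le> r ^ 3 \<and> r ^ 3 \<le> 330 / real (k j) ^ 2"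
      if j: "j < l" for j
    proof -
      have "e \<epsilon> \<in> {0..e1}" "m \<epsilon> \<in> {0<..<mu j}" using par small m1(2)[OF j] by auto
      from orb[OF this] obtain qa qb u w where q: "restricted_orbit (e \<epsilon>) (m \<epsilon>) qa qb u w"
        "\<And>t. 1 / (1000 * real (k j) ^ 2) \<le> sqrt ((qa t)\<^sup>2 + (qb t)\<^sup>2) ^ 3"
        "\<And>t. sqrt ((qa t)\<^sup>2 + (qb t)\<^sup>2) ^ 3 \<le> 330 / real (k j) ^ 2"
        "\<And>t. sqrt ((qa t)\<^sup>2 + (qb t)\<^sup>2) \<le> (1 - e1) / 2"
        unfolding orbit_size_def by blast
      have pos: "0 < sqrt ((qa t)\<^sup>2 + (qb t)\<^sup>2)" for t
      proof -
        have "0 < 1 / (1000 * real (k j) ^ 2)" using K kK[of j] by simp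
        hence "0 < sqrt ((qa t)\<^sup>2 + (qb t)\<^sup>2) ^ 3" using q(2)[of t] by linarith
        thus ?thesis by (simp add: zero_less_power_eq)
      qed
      have le: "sqrt ((qa t)\<^sup>2 + (qb t)\<^sup>2) \<le> (1 - e \<epsilon>) / 2" for t
      proof -
        have "(1 - e1) / 2 \<le> (1 - e \<epsilon>) / 2" using small by simp
        with q(4)[of t] show ?thesis by linarith
      qed
      obtain \<xi> where \<xi>: "generalized_periodic_solution (M \<epsilon>) (m \<epsilon>) (X \<epsilon>) (x \<epsilon>) (T \<epsilon>) \<xi>"
        "\<And>t. norm (\<xi> t - X \<epsilon> t) = a \<epsilon> / m \<epsilon> * sqrt ((qa (m \<epsilon> powr (3/2) / a \<epsilon> powr (3/2) * t))\<^sup>2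
          + (qb (m \<epsilon> powr (3/2) / a \<epsilon> powr (3/2) * t))\<^sup>2)"
        using generalized_solution_of_orbit[OF rot _ _ _ _ _ _ assms(8)[OF \<epsilon>(1)] assms(9)[OF \<epsilon>(1)]
            assms(10)[OF \<epsilon>(1)] assms(11)[OF \<epsilon>(1)] q(1) pos le] par by blast
      show ?thesis
        using \<xi>(1) \<xi>(2)[of 0] q(2,3)[of 0] unfolding A_def by auto
    qed
    then obtain \<xi> r where \<xi>: "\<And>j. j < l \<Longrightarrow> generalized_periodic_solution (M \<epsilon>) (m \<epsilon>) (X \<epsilon>) (x \<epsilon>) (T \<epsilon>) (\<xi> j)"
      "\<And>j. j < l \<Longrightarrow> norm (\<xi> j 0 - X \<epsilon> 0) = A * r j"
      "\<And>j. j < l \<Longrightarrow> 1 / (1000 * real (k j) ^ 2) \<le> r j ^ 3"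
      "\<And>j. j < l \<Longrightarrow> r j ^ 3 \<le> 330 / real (k j) ^ 2"
      by metis
    \<comment> \<open>The size bounds hold at every time, so the distances from the primary at time
      0 already tell the solutions apart; the common factor \<open>A\<close> cancels.\<close>
    have ne: "\<xi> i \<noteq> \<xi> j" if ij: "i < j" "j < l" for i j
    proof
      assume "\<xi> i = \<xi> j"
      hence "A * r i = A * r j" using \<xi>(2)[of i] \<xi>(2)[of j] ij by (metis less_trans)
      hence rr: "r i = r j" using A by simp
      have ki: "real (k i) > 0" "real (k j) > 0" using K kK[of i] kK[of j] by simp_all
      have "k i * 1000 \<le> k j"
      proof -
        have "(1000::nat) ^ Suc i \<le> 1000 ^ j" using ij by (intro power_increasing) auto
        thus ?thesis unfolding k_def by (simp add: mult.assoc mult.commute[of _ 1000])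
      qed
      hence "real (k i) * 1000 \<le> real (k j)" by (metis of_nat_le_iff of_nat_mult of_nat_numeral)
      hence "(real (k i) * 1000) ^ 2 \<le> real (k j) ^ 2" using ki by (intro power_mono) auto
      hence "330 / real (k j) ^ 2 \<le> 330 / (real (k i) * 1000) ^ 2"
        using ki by (intro divide_left_mono) auto
      also have "\<dots> < 1 / (1000 * real (k i) ^ 2)"
        using ki by (simp add: field_simps power2_eq_square)
      finally show False using \<xi>(3)[of i] \<xi>(4)[of j] ij rr by simp
    qed
    have "inj_on \<xi> {..<l}"
      by (rule linorder_inj_onI) (use ne in auto)
    hence "card (\<xi> ` {..<l}) = l" by (simp add: card_image)
    thus "\<exists>S. S \<subseteq> {\<xi>. generalized_periodic_solution (M \<epsilon>) (m \<epsilon>) (X \<epsilon>) (x \<epsilon>) (T \<epsilon>) \<xi>} \<and> finite S \<and> card S = l"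
      using \<xi>(1) by (intro exI[of _ "\<xi> ` {..<l}"]) auto
  qed
qed

end
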